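(* Let $\mathscr{C}$ be a $C^\infty$-ring, with module of $C^\infty$-Kähler differentials $\Omega^1_{\mathscr{C}}$ and universal derivation $d_{\mathscr{C}}:\mathscr{C}\to\Omega^1_{\mathscr{C}}$. Then $d_{\mathscr{C}}$ extends uniquely to a degree $1$ graded derivation $d$ of the commutative graded algebra $\Lambda^\bullet\Omega^1_{\mathscr{C}}=\{\Lambda^k\Omega^1_{\mathscr{C}}\}_{k\in\mathbb{Z}}$ with the property that $d\circ d=0$. In particular, for any $k>0$ and any $a,b_1,\ldots,b_k\in\mathscr{C}$, $$d\big(a\, d_{\mathscr{C}}b_1\wedge\cdots\wedge d_{\mathscr{C}}b_k\big)=d_{\mathscr{C}}a\wedge d_{\mathscr{C}}b_1\wedge\cdots\wedge d_{\mathscr{C}}b_k .$$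
   Context: A $C^\infty$-ring is a nonempty set $\mathscr{C}$ with, for every $m\ge 0$ and every $g\in C^\infty(\mathbb{R}^m)$, an operation $g_{\mathscr{C}}:\mathscr{C}^m\to\mathscr{C}$, such that coordinate functions act as projections and $(g\circ(f_1,\ldots,f_m))_{\mathscr{C}}(c_1,\ldots,c_n)=g_{\mathscr{C}}((f_1)_{\mathscr{C}}(c_1,\ldots,c_n),\ldots,(f_m)_{\mathscr{C}}(c_1,\ldots,c_n))$ for all $f_1,\ldots,f_m\in C^\infty(\mathbb{R}^n)$. (Equivalently: a finite-product-preserving functor to sets from the category of spaces $\mathbb{R}^n$ and smooth maps.) Every $C^\infty$-ring has an underlying commutative unital $\mathbb{R}$-algebra, and a module over $\mathscr{C}$ is a module over this $\mathbb{R}$-algebra. A $C^\infty$-derivation of $\mathscr{C}$ with values in a $\mathscr{C}$-module $\mathscr{M}$ is a map $X:\mathscr{C}\to\mathscr{M}$ with $X(f_{\mathscr{C}}(a_1,\ldots,a_n))=\sum_{i=1}^n(\partial_i f)_{\mathscr{C}}(a_1,\ldots,a_n)\cdot X(a_i)$ for all $n>0$, $f\in C^\infty(\mathbb{R}^n)$, $a_i\in\mathscr{C}$. The module of $C^\infty$-Kähler differentials is a $\mathscr{C}$-module $\Omega^1_{\mathscr{C}}$ with a $C^\infty$-derivation $d_{\mathscr{C}}:\mathscr{C}\to\Omega^1_{\mathscr{C}}$ (the universal derivation) such that for every $\mathscr{C}$-module $\mathscr{N}$ and $C^\infty$-derivation $X:\mathscr{C}\to\mathscr{N}$ there is a unique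 $\mathscr{C}$-linear $\varphi_X:\Omega^1_{\mathscr{C}}\to\mathscr{N}$ with $\varphi_X\circ d_{\mathscr{C}}=X$. It exists (Dubuc–Kock): it is the free $\mathscr{C}$-module on symbols $\hat d b$, $b\in\mathscr{C}$, modulo the submodule generated by all $\hat d(f_{\mathscr{C}}(a_1,\ldots,a_n))-\sum_i(\partial_i f)_{\mathscr{C}}(a_1,\ldots,a_n)\,\hat d a_i$. $\Lambda^k\Omega^1_{\mathscr{C}}$ is the $k$-th exterior power over $\mathscr{C}$, with $\Lambda^0\Omega^1_{\mathscr{C}}=\mathscr{C}$ and $\Lambda^k\Omega^1_{\mathscr{C}}=0$ for $k<0$. A graded derivation of degree $k$ of a commutative graded algebra $(B^\bullet,\wedge)$ is a sequence of $\mathbb{R}$-linear maps $X:B^\ell\to B^{\ell+k}$ with $X(x\wedge y)=X(x)\wedge y+(-1)^{|x|k}x\wedge X(y)$ for homogeneous $x,y$. *)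

theory Defs
  imports
    "HOL-Analysis.Analysis"
    "HOL-Algebra.Algebraic_Closure_Type"
    "HOL-Algebra.Module"
begin

section \<open>Smooth functions on Euclidean spaces of varying dimension\<close>

text \<open>
  The dimension must range over all natural numbers inside the axioms of a C-infinity-ring,
  so it cannot be a type. A function on n-dimensional space is represented by the function on
  all real sequences that depends only on the coordinates with index below n. For such functions,
  continuity in the product topology is continuity of the function on n-dimensional space.
\<close>

definition depends_on_first :: "nat \<Rightarrow> ((nat \<Rightarrow> real) \<Rightarrow> real) \<Rightarrow> bool" where
  "depends_on_first n f \<longleftrightarrow> (\<forall>x y. (\<forall>i<n. x i = y i) \<longrightarrow> f x = f y)"

definition partial_deriv :: "nat \<Rightarrow> ((nat \<Rightarrow> real) \<Rightarrow> real) \<Rightarrow> (nat \<Rightarrow> real) \<Rightarrow> real" where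
  "partial_deriv i f x = deriv (\<lambda>t. f (x(i := t))) (x i)"

primrec C_k :: "nat \<Rightarrow> nat \<Rightarrow> ((nat \<Rightarrow> real) \<Rightarrow> real) \<Rightarrow> bool" where
  "C_k n 0 f \<longleftrightarrow> continuous_on UNIV f"
| "C_k n (Suc k) f \<longleftrightarrow> continuous_on UNIV f \<and>
     (\<forall>i<n. (\<forall>x. (\<lambda>t. f (x(i := t))) differentiable (at (x i))) \<and> C_k n k (partial_deriv i f))"

definition C_infinity :: "nat \<Rightarrow> ((nat \<Rightarrow> real) \<Rightarrow> real) set" where
  "C_infinity n = {f. depends_on_first n f \<and> (\<forall>k. C_k n k f)}"

section \<open>C-infinity-rings\<close>

text \<open>
  \<open>cop C g cs\<close> is the operation of \<open>g \<in> C_infinity m\<close> on the m-tuple \<open>cs\<close>;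
  the arity m is the length of the list \<open>cs\<close>.
\<close>

record 'c cinfty = "'c partial_object" +
  cop :: "((nat \<Rightarrow> real) \<Rightarrow> real) \<Rightarrow> 'c list \<Rightarrow> 'c"

locale cinfty_ring =
  fixes C :: "'c cinfty"
  assumes nonempty: "carrier C \<noteq> {}"
    and cop_closed:
      "\<lbrakk>set cs \<subseteq> carrier C; g \<in> C_infinity (length cs)\<rbrakk> \<Longrightarrow> cop C g cs \<in> carrier C"
    and cop_coordinate:
      "\<lbrakk>set cs \<subseteq> carrier C; i < length cs\<rbrakk> \<Longrightarrow> cop C (\<lambda>x. x i) cs = cs ! i"
    and cop_compose:
      "\<lbrakk>set cs \<subseteq> carrier C; g \<in> C_infinity m; \<And>i. i < m \<Longrightarrow> f i \<in> C_infinity (length cs)\<rbrakk> \<Longrightarrow>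
        cop C (\<lambda>x. g (\<lambda>i. f i x)) cs = cop C g (map (\<lambda>i. cop C (f i) cs) [0..<m])"

definition cinfty_const :: "'c cinfty \<Rightarrow> real \<Rightarrow> 'c" where
  "cinfty_const C r = cop C (\<lambda>_. r) []"

definition cinfty_alg :: "'c cinfty \<Rightarrow> 'c ring" where
  "cinfty_alg C = \<lparr>carrier = carrier C,
     mult = (\<lambda>a b. cop C (\<lambda>x. x 0 * x 1) [a, b]), one = cinfty_const C 1,
     zero = cinfty_const C 0, add = (\<lambda>a b. cop C (\<lambda>x. x 0 + x 1) [a, b])\<rparr>"

text \<open>The real scalars act on a module over a C-infinity-ring through its constants.\<close>

definition real_module :: "'c cinfty \<Rightarrow> ('c, 'm) module \<Rightarrow> (real, 'm) module" where
  "real_module C M = \<lparr>carrier = carrier M, mult = mult M, one = one M,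
     zero = zero M, add = add M, smult = (\<lambda>r x. cinfty_const C r \<odot>\<^bsub>M\<^esub> x)\<rparr>"

definition cinfty_derivation :: "'c cinfty \<Rightarrow> ('c, 'm) module \<Rightarrow> ('c \<Rightarrow> 'm) \<Rightarrow> bool" where
  "cinfty_derivation C M D \<longleftrightarrow> D \<in> carrier C \<rightarrow> carrier M \<and>
     (\<forall>as f. as \<noteq> [] \<and> set as \<subseteq> carrier C \<and> f \<in> C_infinity (length as) \<longrightarrow>
        D (cop C f as) =
          (\<Oplus>\<^bsub>M\<^esub>i\<in>{..<length as}. cop C (partial_deriv i f) as \<odot>\<^bsub>M\<^esub> D (as ! i)))"

section \<open>Modules given by generators and relations\<close>

text \<open>
  The multiplicative fields of the records below are irrelevant: a module uses only the additive
  structure and the scalar multiplication.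
\<close>

definition free_module :: "('c, 'r) ring_scheme \<Rightarrow> 's set \<Rightarrow> ('c, 's \<Rightarrow> 'c) module" where
  "free_module R S =
    \<lparr>carrier = {f. range f \<subseteq> carrier R \<and> finite {s. f s \<noteq> \<zero>\<^bsub>R\<^esub>} \<and> {s. f s \<noteq> \<zero>\<^bsub>R\<^esub>} \<subseteq> S},
     mult = undefined, one = undefined, zero = (\<lambda>s. \<zero>\<^bsub>R\<^esub>),
     add = (\<lambda>f g s. f s \<oplus>\<^bsub>R\<^esub> g s), smult = (\<lambda>a f s. a \<otimes>\<^bsub>R\<^esub> f s)\<rparr>"

definition free_gen :: "('c, 'r) ring_scheme \<Rightarrow> 's \<Rightarrow> 's \<Rightarrow> 'c" where
  "free_gen R s = (\<lambda>t. if t = s then \<one>\<^bsub>R\<^esub> else \<zero>\<^bsub>R\<^esub>)"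

definition submodule_generated :: "('c, 'r) ring_scheme \<Rightarrow> ('c, 'm) module \<Rightarrow> 'm set \<Rightarrow> 'm set" where
  "submodule_generated R M A = \<Inter>{N. submodule N R M \<and> A \<subseteq> N}"

definition quotient_module :: "('c, 'm) module \<Rightarrow> 'm set \<Rightarrow> ('c, 'm set) module" where
  "quotient_module M N =
    \<lparr>carrier = a_rcosets\<^bsub>M\<^esub> N, mult = undefined, one = undefined, zero = N,
     add = set_add M, smult = (\<lambda>a A. \<Union>x\<in>A. N +>\<^bsub>M\<^esub> (a \<odot>\<^bsub>M\<^esub> x))\<rparr>"

definition presented_module ::
    "('c, 'r) ring_scheme \<Rightarrow> 's set \<Rightarrow> ('s \<Rightarrow> 'c) set \<Rightarrow> ('c, ('s \<Rightarrow> 'c) set) module" where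
  "presented_module R S Rel =
     quotient_module (free_module R S) (submodule_generated R (free_module R S) Rel)"

definition presented_class ::
    "('c, 'r) ring_scheme \<Rightarrow> 's set \<Rightarrow> ('s \<Rightarrow> 'c) set \<Rightarrow> ('s \<Rightarrow> 'c) \<Rightarrow> ('s \<Rightarrow> 'c) set" where
  "presented_class R S Rel f =
     submodule_generated R (free_module R S) Rel +>\<^bsub>free_module R S\<^esub> f"

section \<open>C-infinity Kaehler differentials\<close>

definition kaehler_relations :: "'c cinfty \<Rightarrow> ('c \<Rightarrow> 'c) set" where
  "kaehler_relations C =
    (let R = cinfty_alg C; F = free_module R (carrier C) in
     {free_gen R (cop C f as) \<ominus>\<^bsub>F\<^esub>
        (\<Oplus>\<^bsub>F\<^esub>i\<in>{..<length as}. cop C (partial_deriv i f) as \<odot>\<^bsub>F\<^esub> free_gen R (as ! i)) | f as.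
      as \<noteq> [] \<and> set as \<subseteq> carrier C \<and> f \<in> C_infinity (length as)})"

definition kaehler :: "'c cinfty \<Rightarrow> ('c, ('c \<Rightarrow> 'c) set) module" where
  "kaehler C = presented_module (cinfty_alg C) (carrier C) (kaehler_relations C)"

definition kaehler_d :: "'c cinfty \<Rightarrow> 'c \<Rightarrow> ('c \<Rightarrow> 'c) set" where
  "kaehler_d C b =
     presented_class (cinfty_alg C) (carrier C) (kaehler_relations C) (free_gen (cinfty_alg C) b)"

section \<open>Exterior powers\<close>

text \<open>
  The k-th exterior power of M is the free module on the k-tuples of elements of M (lists of
  length k) modulo the relations of multilinearity and the vanishing of tuples with a repeated
  entry. There are no k-tuples for negative k, so these exterior powers vanish.
\<close>

definition tuples :: "('c, 'm) module \<Rightarrow> int \<Rightarrow> 'm list set" where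
  "tuples M k = {xs. set xs \<subseteq> carrier M \<and> int (length xs) = k}"

definition ext_relations ::
    "('c, 'r) ring_scheme \<Rightarrow> ('c, 'm) module \<Rightarrow> int \<Rightarrow> ('m list \<Rightarrow> 'c) set" where
  "ext_relations R M k =
    (let F = free_module R (tuples M k) in
     {free_gen R (xs[i := x \<oplus>\<^bsub>M\<^esub> y]) \<ominus>\<^bsub>F\<^esub> (free_gen R (xs[i := x]) \<oplus>\<^bsub>F\<^esub> free_gen R (xs[i := y]))
        | xs i x y. xs \<in> tuples M k \<and> i < length xs \<and> x \<in> carrier M \<and> y \<in> carrier M} \<union>
     {free_gen R (xs[i := a \<odot>\<^bsub>M\<^esub> x]) \<ominus>\<^bsub>F\<^esub> a \<odot>\<^bsub>F\<^esub> free_gen R (xs[i := x])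
        | xs i a x. xs \<in> tuples M k \<and> i < length xs \<and> a \<in> carrier R \<and> x \<in> carrier M} \<union>
     {free_gen R xs | xs i j. xs \<in> tuples M k \<and> i < j \<and> j < length xs \<and> xs ! i = xs ! j})"

definition ext_power ::
    "('c, 'r) ring_scheme \<Rightarrow> ('c, 'm) module \<Rightarrow> int \<Rightarrow> ('c, ('m list \<Rightarrow> 'c) set) module" where
  "ext_power R M k = presented_module R (tuples M k) (ext_relations R M k)"

definition ext_class ::
    "('c, 'r) ring_scheme \<Rightarrow> ('c, 'm) module \<Rightarrow> int \<Rightarrow> ('m list \<Rightarrow> 'c) \<Rightarrow> ('m list \<Rightarrow> 'c) set" where
  "ext_class R M k = presented_class R (tuples M k) (ext_relations R M k)"

text \<open>
  \<open>concat_mult R k\<close> is the bilinear extension of concatenation of lists when the left factor is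
  supported on lists of length k.
\<close>

definition concat_mult ::
    "('c, 'r) ring_scheme \<Rightarrow> int \<Rightarrow> ('m list \<Rightarrow> 'c) \<Rightarrow> ('m list \<Rightarrow> 'c) \<Rightarrow> 'm list \<Rightarrow> 'c" where
  "concat_mult R k p q = (\<lambda>zs. p (take (nat k) zs) \<otimes>\<^bsub>R\<^esub> q (drop (nat k) zs))"

text \<open>
  As for products of cosets in a quotient ring, the union is over all representatives; they all
  give the same coset.
\<close>

definition ext_wedge ::
    "('c, 'r) ring_scheme \<Rightarrow> ('c, 'm) module \<Rightarrow> int \<Rightarrow> int \<Rightarrow>
      ('m list \<Rightarrow> 'c) set \<Rightarrow> ('m list \<Rightarrow> 'c) set \<Rightarrow> ('m list \<Rightarrow> 'c) set" where
  "ext_wedge R M k l A B = (\<Union>p\<in>A. \<Union>q\<in>B. ext_class R M (k + l) (concat_mult R k p q))"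

text \<open>The canonical isomorphisms of the ring with the 0-th and of the module with the first exterior
  power.\<close>

definition ext_incl0 :: "('c, 'r) ring_scheme \<Rightarrow> ('c, 'm) module \<Rightarrow> 'c \<Rightarrow> ('m list \<Rightarrow> 'c) set" where
  "ext_incl0 R M a = a \<odot>\<^bsub>ext_power R M 0\<^esub> ext_class R M 0 (free_gen R [])"

definition ext_incl1 :: "('c, 'r) ring_scheme \<Rightarrow> ('c, 'm) module \<Rightarrow> 'm \<Rightarrow> ('m list \<Rightarrow> 'c) set" where
  "ext_incl1 R M x = ext_class R M 1 (free_gen R [x])"

primrec wedge_list ::
    "('c, 'r) ring_scheme \<Rightarrow> ('c, 'm) module \<Rightarrow> 'm list \<Rightarrow> ('m list \<Rightarrow> 'c) set" where
  "wedge_list R M [] = ext_incl0 R M \<one>\<^bsub>R\<^esub>"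
| "wedge_list R M (x # xs) =
     ext_wedge R M 1 (int (length xs)) (ext_incl1 R M x) (wedge_list R M xs)"

section \<open>Graded derivations of commutative graded algebras\<close>

abbreviation real_ring :: "real ring" where
  "real_ring \<equiv> ring_of_type_algebra"

locale comm_graded_algebra =
  fixes B :: "int \<Rightarrow> (real, 'b) module"
    and wedge :: "int \<Rightarrow> int \<Rightarrow> 'b \<Rightarrow> 'b \<Rightarrow> 'b"
    and unit :: 'b
  assumes graded_module: "Module.module real_ring (B p)"
    and wedge_closed:
      "\<lbrakk>x \<in> carrier (B p); y \<in> carrier (B q)\<rbrakk> \<Longrightarrow> wedge p q x y \<in> carrier (B (p + q))"
    and wedge_add_left:
      "\<lbrakk>x \<in> carrier (B p); x' \<in> carrier (B p); y \<in> carrier (B q)\<rbrakk> \<Longrightarrow>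
        wedge p q (x \<oplus>\<^bsub>B p\<^esub> x') y = wedge p q x y \<oplus>\<^bsub>B (p + q)\<^esub> wedge p q x' y"
    and wedge_add_right:
      "\<lbrakk>x \<in> carrier (B p); y \<in> carrier (B q); y' \<in> carrier (B q)\<rbrakk> \<Longrightarrow>
        wedge p q x (y \<oplus>\<^bsub>B q\<^esub> y') = wedge p q x y \<oplus>\<^bsub>B (p + q)\<^esub> wedge p q x y'"
    and wedge_smult_left:
      "\<lbrakk>x \<in> carrier (B p); y \<in> carrier (B q)\<rbrakk> \<Longrightarrow>
        wedge p q (r \<odot>\<^bsub>B p\<^esub> x) y = r \<odot>\<^bsub>B (p + q)\<^esub> wedge p q x y"
    and wedge_smult_right:
      "\<lbrakk>x \<in> carrier (B p); y \<in> carrier (B q)\<rbrakk> \<Longrightarrow>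
        wedge p q x (r \<odot>\<^bsub>B q\<^esub> y) = r \<odot>\<^bsub>B (p + q)\<^esub> wedge p q x y"
    and wedge_assoc:
      "\<lbrakk>x \<in> carrier (B p); y \<in> carrier (B q); z \<in> carrier (B r)\<rbrakk> \<Longrightarrow>
        wedge (p + q) r (wedge p q x y) z = wedge p (q + r) x (wedge q r y z)"
    and unit_closed: "unit \<in> carrier (B 0)"
    and wedge_unit_left: "x \<in> carrier (B p) \<Longrightarrow> wedge 0 p unit x = x"
    and wedge_unit_right: "x \<in> carrier (B p) \<Longrightarrow> wedge p 0 x unit = x"
    and wedge_comm:
      "\<lbrakk>x \<in> carrier (B p); y \<in> carrier (B q)\<rbrakk> \<Longrightarrow>
        wedge p q x y = (-1) powi (p * q) \<odot>\<^bsub>B (p + q)\<^esub> wedge q p y x"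

text \<open>
  The components of a graded derivation are required to be extensional functions, so that two
  graded derivations are equal as soon as they agree on the carriers.
\<close>

locale graded_derivation = comm_graded_algebra B wedge unit
  for B :: "int \<Rightarrow> (real, 'b) module"
    and wedge :: "int \<Rightarrow> int \<Rightarrow> 'b \<Rightarrow> 'b \<Rightarrow> 'b"
    and unit :: 'b +
  fixes k :: int
    and D :: "int \<Rightarrow> 'b \<Rightarrow> 'b"
  assumes map: "D p \<in> carrier (B p) \<rightarrow>\<^sub>E carrier (B (p + k))"
    and additive:
      "\<lbrakk>x \<in> carrier (B p); y \<in> carrier (B p)\<rbrakk> \<Longrightarrow> D p (x \<oplus>\<^bsub>B p\<^esub> y) = D p x \<oplus>\<^bsub>B (p + k)\<^esub> D p y"
    and homogeneous:
      "x \<in> carrier (B p) \<Longrightarrow> D p (r \<odot>\<^bsub>B p\<^esub> x) = r \<odot>\<^bsub>B (p + k)\<^esub> D p x"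
    and graded_leibniz:
      "\<lbrakk>x \<in> carrier (B p); y \<in> carrier (B q)\<rbrakk> \<Longrightarrow>
        D (p + q) (wedge p q x y) =
          wedge (p + k) q (D p x) y \<oplus>\<^bsub>B (p + q + k)\<^esub>
          (-1) powi (p * k) \<odot>\<^bsub>B (p + q + k)\<^esub> wedge p (q + k) x (D q y)"

section \<open>The graded algebra of a C-infinity-ring\<close>

abbreviation cinfty_forms :: "'c cinfty \<Rightarrow> int \<Rightarrow> ('c, (('c \<Rightarrow> 'c) set list \<Rightarrow> 'c) set) module" where
  "cinfty_forms C k \<equiv> ext_power (cinfty_alg C) (kaehler C) k"

definition square_zero_extension ::
    "'c cinfty \<Rightarrow> (int \<Rightarrow> (('c \<Rightarrow> 'c) set list \<Rightarrow> 'c) set \<Rightarrow> (('c \<Rightarrow> 'c) set list \<Rightarrow> 'c) set) \<Rightarrow> bool"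
  where
  "square_zero_extension C d \<longleftrightarrow>
     graded_derivation (\<lambda>k. real_module C (cinfty_forms C k))
       (ext_wedge (cinfty_alg C) (kaehler C)) (wedge_list (cinfty_alg C) (kaehler C) []) 1 d \<and>
     (\<forall>a\<in>carrier C. d 0 (ext_incl0 (cinfty_alg C) (kaehler C) a) =
                    ext_incl1 (cinfty_alg C) (kaehler C) (kaehler_d C a)) \<and>
     (\<forall>k. \<forall>x\<in>carrier (cinfty_forms C k). d (k + 1) (d k x) = \<zero>\<^bsub>cinfty_forms C (k + 2)\<^esub>)"

section \<open>The underlying ring of a C-infinity-ring\<close>

lemma C_k_continuous: "C_k n k f \<Longrightarrow> continuous_on UNIV f"
  by (cases k) auto

lemma C_k_mono: "C_k n (Suc k) f \<Longrightarrow> C_k n k f"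
proof (induction k arbitrary: f)
  case (Suc k)
  then show ?case unfolding C_k.simps(2)[of n "Suc k"] unfolding C_k.simps(2)[of n k f] by blast
qed (simp add: C_k_continuous)

lemma C_k_const: "C_k n k (\<lambda>_. r)"
proof (induction k arbitrary: r)
  case (Suc k)
  have "partial_deriv i (\<lambda>_. r) = (\<lambda>_. 0)" for i
    by (auto simp: partial_deriv_def)
  with Suc show ?case by simp
qed simp

lemma partial_deriv_coordinate: "partial_deriv j (\<lambda>x. x i) = (\<lambda>_. if i = j then 1 else 0)"
  by (auto simp: partial_deriv_def)

lemma C_k_coordinate: "C_k n k (\<lambda>x. x i)"
proof (cases k)
  case (Suc l)
  have "(\<lambda>t. (x(j := t)) i) differentiable at (x j)" for j and x :: "nat \<Rightarrow> real"
    by (cases "i = j") auto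
  then show ?thesis unfolding Suc
    by (simp add: partial_deriv_coordinate C_k_const)
qed simp

lemma C_k_add: "C_k n k f \<Longrightarrow> C_k n k g \<Longrightarrow> C_k n k (\<lambda>x. f x + g x)"
proof (induction k arbitrary: f g)
  case (Suc k)
  have "partial_deriv i (\<lambda>x. f x + g x) = (\<lambda>x. partial_deriv i f x + partial_deriv i g x)" if "i < n" for i
    using Suc.prems that unfolding partial_deriv_def
    by (auto simp: fun_eq_iff intro!: deriv_add simp: field_differentiable_def real_differentiable_def has_field_derivative_def)
  with Suc show ?case
    by (auto intro!: continuous_intros)
qed (auto intro: continuous_intros)

lemma C_k_mult: "C_k n k f \<Longrightarrow> C_k n k g \<Longrightarrow> C_k n k (\<lambda>x. f x * g x)"
proof (induction k arbitrary: f g)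
  case (Suc k)
  have "partial_deriv i (\<lambda>x. f x * g x) = (\<lambda>x. f x * partial_deriv i g x + partial_deriv i f x * g x)"
    if "i < n" for i
    using Suc.prems that unfolding partial_deriv_def
    by (auto simp: fun_eq_iff simp: field_differentiable_def real_differentiable_def has_field_derivative_def)
  with Suc C_k_mono[OF Suc.prems(1)] C_k_mono[OF Suc.prems(2)] show ?case
    by (auto intro!: continuous_intros C_k_add)
qed (auto intro: continuous_intros)

lemma C_infinity_const: "(\<lambda>_. r) \<in> C_infinity n"
  by (simp add: C_infinity_def depends_on_first_def C_k_const)

lemma C_infinity_coordinate: "i < n \<Longrightarrow> (\<lambda>x. x i) \<in> C_infinity n"
  by (simp add: C_infinity_def depends_on_first_def C_k_coordinate)

lemma C_infinity_add:
  "f \<in> C_infinity n \<Longrightarrow> g \<in> C_infinity n \<Longrightarrow> (\<lambda>x. f x + g x) \<in> C_infinity n"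
  unfolding C_infinity_def depends_on_first_def by (auto intro!: C_k_add) metis

lemma C_infinity_mult:
  "f \<in> C_infinity n \<Longrightarrow> g \<in> C_infinity n \<Longrightarrow> (\<lambda>x. f x * g x) \<in> C_infinity n"
  unfolding C_infinity_def depends_on_first_def by (auto intro!: C_k_mult) metis

lemma C_infinity_partial_deriv:
  assumes "f \<in> C_infinity n" "i < n"
  shows "partial_deriv i f \<in> C_infinity n"
proof -
  have "C_k n (Suc k) f" for k using assms unfolding C_infinity_def by blast
  then have "C_k n k (partial_deriv i f)" for k using assms by simp
  moreover have "depends_on_first n (partial_deriv i f)"
    unfolding depends_on_first_def partial_deriv_def
  proof (intro allI impI)
    fix x y :: "nat \<Rightarrow> real" assume xy: "\<forall>i<n. x i = y i"
    then have "(\<lambda>t. f (x(i := t))) = (\<lambda>t. f (y(i := t)))"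
      using assms(1) unfolding C_infinity_def depends_on_first_def by (auto simp: fun_eq_iff)
    then show "deriv (\<lambda>t. f (x(i := t))) (x i) = deriv (\<lambda>t. f (y(i := t))) (y i)"
      using xy assms(2) by simp
  qed
  ultimately show ?thesis by (simp add: C_infinity_def)
qed

context cinfty_ring
begin

lemma cop_binary:
  assumes "set cs \<subseteq> carrier C" "f \<in> C_infinity (length cs)" "g \<in> C_infinity (length cs)"
    and "(\<lambda>x. b (x 0) (x 1)) \<in> C_infinity 2"
  shows "cop C (\<lambda>x. b (x 0) (x 1)) [cop C f cs, cop C g cs] = cop C (\<lambda>x. b (f x) (g x)) cs"
proof -
  have "cop C (\<lambda>x. b (f x) (g x)) cs =
        cop C (\<lambda>x. b (x 0) (x 1)) (map (\<lambda>i. cop C (if i = 0 then f else g) cs) [0..<2])"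
    using cop_compose[of cs "\<lambda>x. b (x 0) (x 1)" 2 "\<lambda>i. if i = 0 then f else g"] assms
    by simp
  then show ?thesis by (simp add: numeral_2_eq_2)
qed

lemma cop_const: "set cs \<subseteq> carrier C \<Longrightarrow> cinfty_const C r = cop C (\<lambda>_. r) cs"
  using cop_compose[of cs "\<lambda>_. r" 0] by (simp add: cinfty_const_def C_infinity_const)

lemma smooth_plus: "(\<lambda>x. x 0 + x 1) \<in> C_infinity 2" and smooth_times: "(\<lambda>x. x 0 * x 1) \<in> C_infinity 2"
  by (auto intro!: C_infinity_add C_infinity_mult C_infinity_coordinate)

lemma cop_add:
  assumes "set cs \<subseteq> carrier C" "f \<in> C_infinity (length cs)" "g \<in> C_infinity (length cs)"
  shows "cop C f cs \<oplus>\<^bsub>cinfty_alg C\<^esub> cop C g cs = cop C (\<lambda>x. f x + g x) cs"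
  using cop_binary[OF assms smooth_plus] by (simp add: cinfty_alg_def)

lemma cop_mult:
  assumes "set cs \<subseteq> carrier C" "f \<in> C_infinity (length cs)" "g \<in> C_infinity (length cs)"
  shows "cop C f cs \<otimes>\<^bsub>cinfty_alg C\<^esub> cop C g cs = cop C (\<lambda>x. f x * g x) cs"
  using cop_binary[OF assms smooth_times] by (simp add: cinfty_alg_def)

lemma alg_closed: "a \<in> carrier C \<Longrightarrow> b \<in> carrier C \<Longrightarrow> a \<oplus>\<^bsub>cinfty_alg C\<^esub> b \<in> carrier C"
  "a \<in> carrier C \<Longrightarrow> b \<in> carrier C \<Longrightarrow> a \<otimes>\<^bsub>cinfty_alg C\<^esub> b \<in> carrier C"
  "cinfty_const C r \<in> carrier C"
  using smooth_plus smooth_times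
  by (auto simp: cinfty_alg_def cinfty_const_def C_infinity_const numeral_2_eq_2 intro!: cop_closed)

lemma carrier_alg [simp]: "carrier (cinfty_alg C) = carrier C"
  by (simp add: cinfty_alg_def)

lemma one_alg: "\<one>\<^bsub>cinfty_alg C\<^esub> = cinfty_const C 1" and zero_alg: "\<zero>\<^bsub>cinfty_alg C\<^esub> = cinfty_const C 0"
  by (simp_all add: cinfty_alg_def)

lemma coord3:
  assumes "a \<in> carrier C" "b \<in> carrier C" "c \<in> carrier C"
  shows "a = cop C (\<lambda>x. x 0) [a,b,c]" "b = cop C (\<lambda>x. x 1) [a,b,c]" "c = cop C (\<lambda>x. x 2) [a,b,c]"
  using assms by (simp_all add: cop_coordinate)

lemma ring_laws:
  assumes "a \<in> carrier C" "b \<in> carrier C" "c \<in> carrier C"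
  shows "a \<oplus>\<^bsub>cinfty_alg C\<^esub> b \<oplus>\<^bsub>cinfty_alg C\<^esub> c = a \<oplus>\<^bsub>cinfty_alg C\<^esub> (b \<oplus>\<^bsub>cinfty_alg C\<^esub> c)"
   "a \<otimes>\<^bsub>cinfty_alg C\<^esub> b \<otimes>\<^bsub>cinfty_alg C\<^esub> c = a \<otimes>\<^bsub>cinfty_alg C\<^esub> (b \<otimes>\<^bsub>cinfty_alg C\<^esub> c)"
   "a \<oplus>\<^bsub>cinfty_alg C\<^esub> b = b \<oplus>\<^bsub>cinfty_alg C\<^esub> a"
   "a \<otimes>\<^bsub>cinfty_alg C\<^esub> b = b \<otimes>\<^bsub>cinfty_alg C\<^esub> a"
   "(a \<oplus>\<^bsub>cinfty_alg C\<^esub> b) \<otimes>\<^bsub>cinfty_alg C\<^esub> c = a \<otimes>\<^bsub>cinfty_alg C\<^esub> c \<oplus>\<^bsub>cinfty_alg C\<^esub> b \<otimes>\<^bsub>cinfty_alg C\<^esub> c"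
   "cinfty_const C 1 \<otimes>\<^bsub>cinfty_alg C\<^esub> a = a"
   "cinfty_const C 0 \<oplus>\<^bsub>cinfty_alg C\<^esub> a = a"
   "cinfty_const C (-1) \<otimes>\<^bsub>cinfty_alg C\<^esub> a \<oplus>\<^bsub>cinfty_alg C\<^esub> a = cinfty_const C 0"
proof -
  define cs where "cs = [a,b,c]"
  have cs: "set cs \<subseteq> carrier C" using assms by (simp add: cs_def)
  note sm = C_infinity_add C_infinity_mult C_infinity_coordinate C_infinity_const
  have l: "length cs = 3" by (simp add: cs_def)
  have *: "a = cop C (\<lambda>x. x 0) cs" "b = cop C (\<lambda>x. x 1) cs" "c = cop C (\<lambda>x. x 2) cs"
    using coord3[OF assms] by (simp_all add: cs_def)
  note r = cop_add[OF cs] cop_mult[OF cs] cop_const[OF cs] sm l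
  show "a \<oplus>\<^bsub>cinfty_alg C\<^esub> b \<oplus>\<^bsub>cinfty_alg C\<^esub> c = a \<oplus>\<^bsub>cinfty_alg C\<^esub> (b \<oplus>\<^bsub>cinfty_alg C\<^esub> c)"
    unfolding * by (simp add: r add_ac)
  show "a \<otimes>\<^bsub>cinfty_alg C\<^esub> b \<otimes>\<^bsub>cinfty_alg C\<^esub> c = a \<otimes>\<^bsub>cinfty_alg C\<^esub> (b \<otimes>\<^bsub>cinfty_alg C\<^esub> c)"
    unfolding * by (simp add: r mult_ac)
  show "a \<oplus>\<^bsub>cinfty_alg C\<^esub> b = b \<oplus>\<^bsub>cinfty_alg C\<^esub> a" unfolding * by (simp add: r add_ac)
  show "a \<otimes>\<^bsub>cinfty_alg C\<^esub> b = b \<otimes>\<^bsub>cinfty_alg C\<^esub> a" unfolding * by (simp add: r mult_ac)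
  show "(a \<oplus>\<^bsub>cinfty_alg C\<^esub> b) \<otimes>\<^bsub>cinfty_alg C\<^esub> c = a \<otimes>\<^bsub>cinfty_alg C\<^esub> c \<oplus>\<^bsub>cinfty_alg C\<^esub> b \<otimes>\<^bsub>cinfty_alg C\<^esub> c"
    unfolding * by (simp add: r distrib_right)
  show "cinfty_const C 1 \<otimes>\<^bsub>cinfty_alg C\<^esub> a = a" unfolding * by (simp add: r)
  show "cinfty_const C 0 \<oplus>\<^bsub>cinfty_alg C\<^esub> a = a" unfolding * by (simp add: r)
  show "cinfty_const C (-1) \<otimes>\<^bsub>cinfty_alg C\<^esub> a \<oplus>\<^bsub>cinfty_alg C\<^esub> a = cinfty_const C 0"
    unfolding *(1) unfolding cop_const[OF cs]
  proof (subst cop_mult[OF cs])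
    have "cop C (\<lambda>x. -1 * x 0) cs \<oplus>\<^bsub>cinfty_alg C\<^esub> cop C (\<lambda>x. x 0) cs = cop C (\<lambda>x. -1 * x 0 + x 0) cs"
      by (rule cop_add[OF cs]; intro sm; simp add: l)
    then show "cop C (\<lambda>x. -1 * x 0) cs \<oplus>\<^bsub>cinfty_alg C\<^esub> cop C (\<lambda>x. x 0) cs = cop C (\<lambda>_. 0) cs" by simp
  qed (simp_all add: sm l)
qed

theorem cring_alg: "cring (cinfty_alg C)"
proof (intro cringI abelian_groupI comm_monoidI)
  fix x assume "x \<in> carrier (cinfty_alg C)"
  then show "\<exists>y\<in>carrier (cinfty_alg C). y \<oplus>\<^bsub>cinfty_alg C\<^esub> x = \<zero>\<^bsub>cinfty_alg C\<^esub>"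
    by (intro bexI[of _ "cinfty_const C (-1) \<otimes>\<^bsub>cinfty_alg C\<^esub> x"])
       (use ring_laws(8)[of x x x] in \<open>auto simp: zero_alg alg_closed\<close>)
qed (auto simp: ring_laws(1,2,5,6,7) zero_alg one_alg alg_closed intro: ring_laws(3,4))

end

section \<open>Universal property of the Kaehler differentials\<close>

text \<open>
  The rest of this theory verifies that \<open>kaehler\<close> with \<open>kaehler_d\<close> is a module with a
  C-infinity-derivation and that it is universal among these (for modules over any type).
\<close>

definition linear_map :: "('c, 'r) ring_scheme \<Rightarrow> ('c, 'm) module \<Rightarrow> ('c, 'n) module \<Rightarrow> ('m \<Rightarrow> 'n) \<Rightarrow> bool" where
  "linear_map R M N \<phi> \<longleftrightarrow> \<phi> \<in> carrier M \<rightarrow> carrier N \<and>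
     (\<forall>x\<in>carrier M. \<forall>y\<in>carrier M. \<phi> (x \<oplus>\<^bsub>M\<^esub> y) = \<phi> x \<oplus>\<^bsub>N\<^esub> \<phi> y) \<and>
     (\<forall>a\<in>carrier R. \<forall>x\<in>carrier M. \<phi> (a \<odot>\<^bsub>M\<^esub> x) = a \<odot>\<^bsub>N\<^esub> \<phi> x)"

context cring
begin

lemma free_module_simps:
  "f \<in> carrier (free_module R S) \<longleftrightarrow>
     range f \<subseteq> carrier R \<and> finite {s. f s \<noteq> \<zero>} \<and> {s. f s \<noteq> \<zero>} \<subseteq> S"
  "f \<oplus>\<^bsub>free_module R S\<^esub> g = (\<lambda>s. f s \<oplus> g s)"
  "a \<odot>\<^bsub>free_module R S\<^esub> f = (\<lambda>s. a \<otimes> f s)"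
  "\<zero>\<^bsub>free_module R S\<^esub> = (\<lambda>s. \<zero>)"
  by (simp_all add: free_module_def)

lemma free_add_closed:
  assumes "f \<in> carrier (free_module R S)" "g \<in> carrier (free_module R S)"
  shows "f \<oplus>\<^bsub>free_module R S\<^esub> g \<in> carrier (free_module R S)"
proof -
  have "{s. f s \<oplus> g s \<noteq> \<zero>} \<subseteq> {s. f s \<noteq> \<zero>} \<union> {s. g s \<noteq> \<zero>}" by auto
  then have "finite {s. f s \<oplus> g s \<noteq> \<zero>}" "{s. f s \<oplus> g s \<noteq> \<zero>} \<subseteq> S"
    using assms unfolding free_module_simps by (meson finite_UnI finite_subset, blast)
  with assms show ?thesis unfolding free_module_simps image_subset_iff by simp
qed

lemma free_smult_closed:
  assumes "f \<in> carrier (free_module R S)" "a \<in> carrier R"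
  shows "a \<odot>\<^bsub>free_module R S\<^esub> f \<in> carrier (free_module R S)"
proof -
  have "{s. a \<otimes> f s \<noteq> \<zero>} \<subseteq> {s. f s \<noteq> \<zero>}" using assms by auto
  then have "finite {s. a \<otimes> f s \<noteq> \<zero>}" "{s. a \<otimes> f s \<noteq> \<zero>} \<subseteq> S"
    using assms unfolding free_module_simps by (meson finite_subset, blast)
  with assms show ?thesis unfolding free_module_simps image_subset_iff by simp
qed

lemma module_free: "Module.module R (free_module R S)"
proof (rule moduleI)
  show "cring R" by (rule is_cring)
  show "abelian_group (free_module R S)"
  proof (rule abelian_groupI)
    fix f assume f: "f \<in> carrier (free_module R S)"
    then have "(\<ominus> \<one>) \<odot>\<^bsub>free_module R S\<^esub> f \<oplus>\<^bsub>free_module R S\<^esub> f = \<zero>\<^bsub>free_module R S\<^esub>"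
      unfolding free_module_simps by (auto simp: fun_eq_iff l_minus l_neg image_subset_iff)
    then show "\<exists>g\<in>carrier (free_module R S). g \<oplus>\<^bsub>free_module R S\<^esub> f = \<zero>\<^bsub>free_module R S\<^esub>"
      using f by (auto intro!: bexI[of _ "(\<ominus> \<one>) \<odot>\<^bsub>free_module R S\<^esub> f"] free_smult_closed)
  next
    show "\<And>x y. x \<in> carrier (free_module R S) \<Longrightarrow> y \<in> carrier (free_module R S) \<Longrightarrow> x \<oplus>\<^bsub>free_module R S\<^esub> y \<in> carrier (free_module R S)"
      by (rule free_add_closed)
  qed (auto simp: free_module_simps a_assoc image_subset_iff intro: a_comm)
  fix a x assume "a \<in> carrier R" "x \<in> carrier (free_module R S)"
  then show "a \<odot>\<^bsub>free_module R S\<^esub> x \<in> carrier (free_module R S)" by (rule free_smult_closed[rotated])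
qed (auto simp: free_module_simps l_distr r_distr m_assoc image_subset_iff)

lemma free_gen_closed: "s \<in> S \<Longrightarrow> free_gen R s \<in> carrier (free_module R S)"
  by (auto simp: free_module_simps free_gen_def)

end

locale record_module = module R M for R :: "('c, 'r) ring_scheme" and M :: "('c, 'm) module"
begin

lemma submodule_generated_submodule:
  assumes "A \<subseteq> carrier M" shows "submodule (submodule_generated R M A) R M"
proof (rule submoduleI)
  show "submodule_generated R M A \<subseteq> carrier M"
    using carrier_is_submodule assms by (auto simp: submodule_generated_def)
  show "\<zero>\<^bsub>M\<^esub> \<in> submodule_generated R M A"
    using subgroup.one_closed[OF submodule.axioms(1)]
    by (auto simp: submodule_generated_def)
qed (auto simp: submodule_generated_def submodule.smult_closed submoduleE)

lemma submodule_generated_incl: "A \<subseteq> submodule_generated R M A"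
  by (auto simp: submodule_generated_def)

lemma submodule_generated_least: "submodule N R M \<Longrightarrow> A \<subseteq> N \<Longrightarrow> submodule_generated R M A \<subseteq> N"
  by (auto simp: submodule_generated_def)

end

locale quotient_by_submodule = record_module R M for R :: "('c, 'r) ring_scheme" and M :: "('c, 'm) module" +
  fixes N assumes sub: "submodule N R M"
begin

abbreviation Q where "Q \<equiv> quotient_module M N"

lemma absub: "abelian_subgroup N M"
  using sub by (intro abelian_subgroupI3 additive_subgroup.intro)
    (auto simp: submodule_def abelian_group_axioms)

sublocale A: abelian_subgroup N M by (rule absub)

lemma N_sub: "N \<subseteq> carrier M" using submoduleE(1)[OF sub] .

lemma N_zero: "\<zero>\<^bsub>M\<^esub> \<in> N" using A.zero_closed .

lemma coset_eq: "N +>\<^bsub>M\<^esub> x = {n \<oplus>\<^bsub>M\<^esub> x | n. n \<in> N}"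
  by (auto simp: a_r_coset_def')

lemma Q_carrier: "A \<in> carrier Q \<longleftrightarrow> (\<exists>x\<in>carrier M. A = N +>\<^bsub>M\<^esub> x)"
  by (auto simp: quotient_module_def A_RCOSETS_def')

lemma coset_shift:
  assumes "x \<in> carrier M" "n \<in> N" shows "N +>\<^bsub>M\<^esub> (n \<oplus>\<^bsub>M\<^esub> x) = N +>\<^bsub>M\<^esub> x"
proof (intro equalityI subsetI)
  have n: "n \<in> carrier M" using assms N_sub by auto
  show "y \<in> N +>\<^bsub>M\<^esub> x" if yy: "y \<in> N +>\<^bsub>M\<^esub> (n \<oplus>\<^bsub>M\<^esub> x)" for y
  proof -
    obtain m where m: "m \<in> N" "y = m \<oplus>\<^bsub>M\<^esub> (n \<oplus>\<^bsub>M\<^esub> x)" using yy unfolding coset_eq by blast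
    then have "m \<in> carrier M" using N_sub by auto
    then have "y = (m \<oplus>\<^bsub>M\<^esub> n) \<oplus>\<^bsub>M\<^esub> x" using m(2) n assms(1) M.a_assoc[of m n x] by simp
    with m show ?thesis using submoduleE(5)[OF sub] assms unfolding coset_eq by blast
  qed
  fix y assume "y \<in> N +>\<^bsub>M\<^esub> x"
  then obtain m where m: "m \<in> N" "y = m \<oplus>\<^bsub>M\<^esub> x" by (auto simp: coset_eq)
  then have mm: "m \<in> carrier M" using N_sub by auto
  have "y = (m \<oplus>\<^bsub>M\<^esub> (\<ominus>\<^bsub>M\<^esub> n)) \<oplus>\<^bsub>M\<^esub> (n \<oplus>\<^bsub>M\<^esub> x)"
    using n mm m(2) assms(1) M.a_assoc[of m "\<ominus>\<^bsub>M\<^esub> n" "n \<oplus>\<^bsub>M\<^esub> x"] M.r_neg1[of n x] by simp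
  moreover have "m \<oplus>\<^bsub>M\<^esub> (\<ominus>\<^bsub>M\<^esub> n) \<in> N" using submoduleE(3,5)[OF sub] m assms by simp
  ultimately show "y \<in> N +>\<^bsub>M\<^esub> (n \<oplus>\<^bsub>M\<^esub> x)" unfolding coset_eq by blast
qed

lemma coset_self: "x \<in> carrier M \<Longrightarrow> x \<in> N +>\<^bsub>M\<^esub> x"
  using N_zero M.l_zero[of x, symmetric] unfolding coset_eq by blast

lemma coset_add:
  assumes "x \<in> carrier M" "y \<in> carrier M"
  shows "(N +>\<^bsub>M\<^esub> x) \<oplus>\<^bsub>Q\<^esub> (N +>\<^bsub>M\<^esub> y) = N +>\<^bsub>M\<^esub> (x \<oplus>\<^bsub>M\<^esub> y)"
  using A.a_rcos_sum[OF assms] by (simp add: quotient_module_def)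

lemma coset_smult:
  assumes a: "a \<in> carrier R" and x: "x \<in> carrier M"
  shows "a \<odot>\<^bsub>Q\<^esub> (N +>\<^bsub>M\<^esub> x) = N +>\<^bsub>M\<^esub> (a \<odot>\<^bsub>M\<^esub> x)"
proof -
  have eq: "N +>\<^bsub>M\<^esub> (a \<odot>\<^bsub>M\<^esub> y) = N +>\<^bsub>M\<^esub> (a \<odot>\<^bsub>M\<^esub> x)" if y: "y \<in> N +>\<^bsub>M\<^esub> x" for y
  proof -
    obtain n where n: "n \<in> N" "y = n \<oplus>\<^bsub>M\<^esub> x" using y unfolding coset_eq by blast
    then have nM: "n \<in> carrier M" using N_sub by blast
    have "a \<odot>\<^bsub>M\<^esub> y = a \<odot>\<^bsub>M\<^esub> n \<oplus>\<^bsub>M\<^esub> a \<odot>\<^bsub>M\<^esub> x" unfolding n(2) by (rule smult_r_distr[OF a nM x])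
    then show ?thesis
      using coset_shift[OF smult_closed[OF a x] submoduleE(4)[OF sub a n(1)]] by simp
  qed
  have "x \<in> N +>\<^bsub>M\<^esub> x" by (rule coset_self[OF x])
  then have "(\<Union>y\<in>N +>\<^bsub>M\<^esub> x. N +>\<^bsub>M\<^esub> (a \<odot>\<^bsub>M\<^esub> y)) = N +>\<^bsub>M\<^esub> (a \<odot>\<^bsub>M\<^esub> x)"
    using eq by blast
  then show ?thesis by (simp add: quotient_module_def)
qed

lemma coset_zero: "\<zero>\<^bsub>Q\<^esub> = N +>\<^bsub>M\<^esub> \<zero>\<^bsub>M\<^esub>"
proof -
  have "n \<oplus>\<^bsub>M\<^esub> \<zero>\<^bsub>M\<^esub> = n" if "n \<in> N" for n using that N_sub by auto
  then have "N = {n \<oplus>\<^bsub>M\<^esub> \<zero>\<^bsub>M\<^esub> | n. n \<in> N}" by force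
  then show ?thesis unfolding coset_eq by (simp add: quotient_module_def)
qed

lemma module_Q: "Module.module R Q"
proof (rule moduleI)
  show "cring R" by (rule R.is_cring)
  show "abelian_group Q"
  proof (rule abelian_groupI)
    show "\<exists>y\<in>carrier Q. y \<oplus>\<^bsub>Q\<^esub> A = \<zero>\<^bsub>Q\<^esub>" if A: "A \<in> carrier Q" for A
    proof -
      obtain x where x: "x \<in> carrier M" "A = N +>\<^bsub>M\<^esub> x" using A by (auto simp: Q_carrier)
      then show ?thesis
        by (intro bexI[of _ "N +>\<^bsub>M\<^esub> (\<ominus>\<^bsub>M\<^esub> x)"]) (auto simp: coset_add coset_zero M.l_neg Q_carrier)
    qed
  next
    fix A B assume "A \<in> carrier Q" "B \<in> carrier Q"
    then obtain x y where *: "x \<in> carrier M" "A = N +>\<^bsub>M\<^esub> x" "y \<in> carrier M" "B = N +>\<^bsub>M\<^esub> y"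
      by (auto simp: Q_carrier)
    then have "A \<oplus>\<^bsub>Q\<^esub> B = N +>\<^bsub>M\<^esub> (x \<oplus>\<^bsub>M\<^esub> y)" by (simp add: coset_add)
    with * show "A \<oplus>\<^bsub>Q\<^esub> B \<in> carrier Q" unfolding Q_carrier by (meson M.add.m_closed)
    from * show "A \<oplus>\<^bsub>Q\<^esub> B = B \<oplus>\<^bsub>Q\<^esub> A" by (simp add: coset_add M.a_comm)
  next
    show "\<zero>\<^bsub>Q\<^esub> \<in> carrier Q" unfolding Q_carrier coset_zero using M.zero_closed by blast
  next
    fix A assume "A \<in> carrier Q"
    then obtain x where *: "x \<in> carrier M" "A = N +>\<^bsub>M\<^esub> x" by (auto simp: Q_carrier)
    then show "\<zero>\<^bsub>Q\<^esub> \<oplus>\<^bsub>Q\<^esub> A = A" by (simp add: coset_add coset_zero)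
  next
    fix A B C assume "A \<in> carrier Q" "B \<in> carrier Q" "C \<in> carrier Q"
    then obtain x y z where *: "x \<in> carrier M" "A = N +>\<^bsub>M\<^esub> x" "y \<in> carrier M" "B = N +>\<^bsub>M\<^esub> y"
      "z \<in> carrier M" "C = N +>\<^bsub>M\<^esub> z"
      by (auto simp: Q_carrier)
    then show "A \<oplus>\<^bsub>Q\<^esub> B \<oplus>\<^bsub>Q\<^esub> C = A \<oplus>\<^bsub>Q\<^esub> (B \<oplus>\<^bsub>Q\<^esub> C)" by (simp add: coset_add M.a_assoc)
  qed
next
  fix a A assume a: "a \<in> carrier R" and A: "A \<in> carrier Q"
  then obtain x where *: "x \<in> carrier M" "A = N +>\<^bsub>M\<^esub> x" by (auto simp: Q_carrier)
  with a have "a \<odot>\<^bsub>Q\<^esub> A = N +>\<^bsub>M\<^esub> (a \<odot>\<^bsub>M\<^esub> x)" by (simp add: coset_smult)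
  with * a show "a \<odot>\<^bsub>Q\<^esub> A \<in> carrier Q" unfolding Q_carrier by (meson smult_closed)
  fix b assume b: "b \<in> carrier R"
  from * a b show "(a \<oplus>\<^bsub>R\<^esub> b) \<odot>\<^bsub>Q\<^esub> A = a \<odot>\<^bsub>Q\<^esub> A \<oplus>\<^bsub>Q\<^esub> b \<odot>\<^bsub>Q\<^esub> A"
    "a \<otimes>\<^bsub>R\<^esub> b \<odot>\<^bsub>Q\<^esub> A = a \<odot>\<^bsub>Q\<^esub> (b \<odot>\<^bsub>Q\<^esub> A)"
    by (simp_all add: coset_add coset_smult smult_l_distr smult_assoc1)
next
  fix A assume A: "A \<in> carrier Q"
  then obtain x where *: "x \<in> carrier M" "A = N +>\<^bsub>M\<^esub> x" by (auto simp: Q_carrier)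
  then show "\<one>\<^bsub>R\<^esub> \<odot>\<^bsub>Q\<^esub> A = A" by (simp add: coset_smult)
next
  fix a A B assume "a \<in> carrier R" "A \<in> carrier Q" "B \<in> carrier Q"
  then obtain x y where *: "x \<in> carrier M" "A = N +>\<^bsub>M\<^esub> x" "y \<in> carrier M" "B = N +>\<^bsub>M\<^esub> y" "a \<in> carrier R"
    by (auto simp: Q_carrier)
  then show "a \<odot>\<^bsub>Q\<^esub> (A \<oplus>\<^bsub>Q\<^esub> B) = a \<odot>\<^bsub>Q\<^esub> A \<oplus>\<^bsub>Q\<^esub> a \<odot>\<^bsub>Q\<^esub> B"
    by (simp add: coset_add coset_smult smult_r_distr)
qed

end

locale free_extension = N: record_module R N for R :: "('c, 'r) ring_scheme" and N :: "('c, 'n) module" +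
  fixes S :: "'s set" and f :: "'s \<Rightarrow> 'n"
  assumes f: "f \<in> S \<rightarrow> carrier N"
begin

abbreviation F where "F \<equiv> free_module R S"

lemma fS: "s \<in> S \<Longrightarrow> f s \<in> carrier N" using f by auto

definition lin where "lin p = (\<Oplus>\<^bsub>N\<^esub>s\<in>{s. p s \<noteq> \<zero>\<^bsub>R\<^esub>}. p s \<odot>\<^bsub>N\<^esub> f s)"

lemma lin_superset:
  assumes "p \<in> carrier F" "finite A" "{s. p s \<noteq> \<zero>\<^bsub>R\<^esub>} \<subseteq> A" "A \<subseteq> S"
  shows "lin p = (\<Oplus>\<^bsub>N\<^esub>s\<in>A. p s \<odot>\<^bsub>N\<^esub> f s)"
  unfolding lin_def
proof (rule N.M.add.finprod_mono_neutral_cong_left[OF assms(2,3)])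
  have "p s \<in> carrier R" for s using assms(1) by (auto simp: N.R.free_module_simps)
  then show "(\<lambda>s. p s \<odot>\<^bsub>N\<^esub> f s) \<in> A \<rightarrow> carrier N" using f assms(4) by auto
  show "p s \<odot>\<^bsub>N\<^esub> f s = \<zero>\<^bsub>N\<^esub>" if "s \<in> A - {s. p s \<noteq> \<zero>\<^bsub>R\<^esub>}" for s
    using that fS[of s] assms(4) by auto
qed simp

lemma lin_closed: "p \<in> carrier F \<Longrightarrow> lin p \<in> carrier N"
  unfolding lin_def using fS by (intro N.M.finsum_closed) (auto simp: N.R.free_module_simps subset_iff)

lemma lin_linear: "linear_map R F N lin"
  unfolding linear_map_def
proof (intro conjI ballI)
  show "lin \<in> carrier F \<rightarrow> carrier N" by (simp add: lin_closed)
next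
  fix p q assume p: "p \<in> carrier F" and q: "q \<in> carrier F"
  define A where "A = {s. p s \<noteq> \<zero>\<^bsub>R\<^esub>} \<union> {s. q s \<noteq> \<zero>\<^bsub>R\<^esub>}"
  have A: "finite A" "A \<subseteq> S" using p q by (auto simp: A_def N.R.free_module_simps)
  have fA: "s \<in> A \<Longrightarrow> f s \<in> carrier N" for s using fS A by auto
  have c: "p s \<in> carrier R" "q s \<in> carrier R" for s using p q by (auto simp: N.R.free_module_simps)
  have "lin (p \<oplus>\<^bsub>F\<^esub> q) = (\<Oplus>\<^bsub>N\<^esub>s\<in>A. (p s \<oplus>\<^bsub>R\<^esub> q s) \<odot>\<^bsub>N\<^esub> f s)"
    using N.R.free_add_closed[OF p q] A
    by (subst lin_superset[of _ A]) (auto simp: N.R.free_module_simps A_def)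
  also have "\<dots> = (\<Oplus>\<^bsub>N\<^esub>s\<in>A. p s \<odot>\<^bsub>N\<^esub> f s \<oplus>\<^bsub>N\<^esub> q s \<odot>\<^bsub>N\<^esub> f s)"
    using fA A(1) c by (intro N.M.finsum_cong') (auto simp: N.smult_l_distr)
  also have "\<dots> = (\<Oplus>\<^bsub>N\<^esub>s\<in>A. p s \<odot>\<^bsub>N\<^esub> f s) \<oplus>\<^bsub>N\<^esub> (\<Oplus>\<^bsub>N\<^esub>s\<in>A. q s \<odot>\<^bsub>N\<^esub> f s)"
    using fA A(1) c by (intro N.M.finsum_addf) auto
  also have "\<dots> = lin p \<oplus>\<^bsub>N\<^esub> lin q"
    using p q A by (subst (1 2) lin_superset[of _ A]) (auto simp: A_def)
  finally show "lin (p \<oplus>\<^bsub>F\<^esub> q) = lin p \<oplus>\<^bsub>N\<^esub> lin q" .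
next
  fix a p assume a: "a \<in> carrier R" and p: "p \<in> carrier F"
  define A where "A = {s. p s \<noteq> \<zero>\<^bsub>R\<^esub>}"
  have A: "finite A" "A \<subseteq> S" using p by (auto simp: A_def N.R.free_module_simps)
  have fA: "s \<in> A \<Longrightarrow> f s \<in> carrier N" for s using fS A by auto
  have c: "p s \<in> carrier R" for s using p by (auto simp: N.R.free_module_simps)
  have "lin (a \<odot>\<^bsub>F\<^esub> p) = (\<Oplus>\<^bsub>N\<^esub>s\<in>A. (a \<otimes>\<^bsub>R\<^esub> p s) \<odot>\<^bsub>N\<^esub> f s)"
    using N.R.free_smult_closed[OF p a] A a
    by (subst lin_superset[of _ A]) (auto simp: N.R.free_module_simps A_def)
  also have "\<dots> = (\<Oplus>\<^bsub>N\<^esub>s\<in>A. a \<odot>\<^bsub>N\<^esub> (p s \<odot>\<^bsub>N\<^esub> f s))"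
    using fA A(1) c a by (intro N.M.finsum_cong') (auto simp: N.smult_assoc1)
  also have "\<dots> = a \<odot>\<^bsub>N\<^esub> lin p"
    unfolding lin_def A_def[symmetric] using fA A(1) c a by (subst N.finsum_smult_ldistr) auto
  finally show "lin (a \<odot>\<^bsub>F\<^esub> p) = a \<odot>\<^bsub>N\<^esub> lin p" .
qed

lemma lin_gen: "s \<in> S \<Longrightarrow> lin (free_gen R s) = f s"
proof -
  assume s: "s \<in> S"
  then have "lin (free_gen R s) = (\<Oplus>\<^bsub>N\<^esub>t\<in>{s}. free_gen R s t \<odot>\<^bsub>N\<^esub> f t)"
    using N.R.free_gen_closed[OF s] by (intro lin_superset) (auto simp: free_gen_def)
  then show ?thesis using s f by (simp add: free_gen_def Pi_iff)
qed

end

lemma linear_map_zero: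
  assumes "Module.module R M" "Module.module R N" "linear_map R M N \<phi>"
  shows "\<phi> \<zero>\<^bsub>M\<^esub> = \<zero>\<^bsub>N\<^esub>"
proof -
  interpret M: module R M by fact
  interpret N: module R N by fact
  have "\<phi> (\<zero>\<^bsub>R\<^esub> \<odot>\<^bsub>M\<^esub> \<zero>\<^bsub>M\<^esub>) = \<zero>\<^bsub>R\<^esub> \<odot>\<^bsub>N\<^esub> \<phi> \<zero>\<^bsub>M\<^esub>" "\<phi> \<zero>\<^bsub>M\<^esub> \<in> carrier N"
    using assms(3) M.M.zero_closed M.R.zero_closed unfolding linear_map_def by blast+
  then show ?thesis by simp
qed

lemma linear_map_minus:
  assumes "Module.module R M" "Module.module R N" "linear_map R M N \<phi>" "x \<in> carrier M"
  shows "\<phi> (\<ominus>\<^bsub>M\<^esub> x) = \<ominus>\<^bsub>N\<^esub> \<phi> x"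
proof -
  interpret M: module R M by fact
  interpret N: module R N by fact
  have c: "\<phi> x \<in> carrier N" using assms(3,4) unfolding linear_map_def by auto
  have "\<ominus>\<^bsub>M\<^esub> x = (\<ominus>\<^bsub>R\<^esub> \<one>\<^bsub>R\<^esub>) \<odot>\<^bsub>M\<^esub> x" using assms(4) by (simp add: M.smult_l_minus)
  then have "\<phi> (\<ominus>\<^bsub>M\<^esub> x) = (\<ominus>\<^bsub>R\<^esub> \<one>\<^bsub>R\<^esub>) \<odot>\<^bsub>N\<^esub> \<phi> x"
    using assms(3,4) unfolding linear_map_def by simp
  then show ?thesis using c by (simp add: N.smult_l_minus)
qed

lemma linear_map_finsum:
  assumes "Module.module R M" "Module.module R N" "linear_map R M N \<phi>" "finite A" "g \<in> A \<rightarrow> carrier M"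
  shows "\<phi> (finsum M g A) = finsum N (\<lambda>i. \<phi> (g i)) A"
  using assms(4,5)
proof (induction A)
  interpret M: module R M by fact
  interpret N: module R N by fact
  case empty
  then show ?case using linear_map_zero[OF assms(1-3)] by simp
next
  interpret M: module R M by fact
  interpret N: module R N by fact
  case (insert a A)
  have "finsum M g A \<in> carrier M" "g a \<in> carrier M" using insert by auto
  moreover have "(\<lambda>i. \<phi> (g i)) \<in> insert a A \<rightarrow> carrier N"
    using insert assms(3) unfolding linear_map_def by auto
  ultimately show ?case using insert assms(3) unfolding linear_map_def by (simp add: Pi_iff)
qed

lemma (in cring) free_expand:
  assumes p: "p \<in> carrier (free_module R S)"
  shows "p = finsum (free_module R S) (\<lambda>s. p s \<odot>\<^bsub>free_module R S\<^esub> free_gen R s) {s. p s \<noteq> \<zero>}"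
    (is "_ = finsum ?F ?g ?A")
proof -
  interpret F: module R ?F by (rule module_free)
  have c: "p s \<in> carrier R" for s using p by (auto simp: free_module_simps)
  have fin: "finite ?A" and S: "?A \<subseteq> S" using p by (auto simp: free_module_simps)
  have "finsum ?F ?g B = (\<lambda>s. if s \<in> B then p s else \<zero>)" if "finite B" "B \<subseteq> ?A" for B
    using that
  proof (induction B)
    case empty then show ?case by (simp add: free_module_simps)
  next
    case (insert b B)
    have g: "?g \<in> insert b B \<rightarrow> carrier ?F"
      using insert S c by (auto intro!: F.smult_closed free_gen_closed)
    then have "finsum ?F ?g (insert b B) = ?g b \<oplus>\<^bsub>?F\<^esub> finsum ?F ?g B"
      using insert by (intro F.finsum_insert) auto
    also have "finsum ?F ?g B = (\<lambda>s. if s \<in> B then p s else \<zero>)" using insert by auto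
    finally show ?case using insert.hyps c by (auto simp: free_module_simps(2-4) free_gen_def fun_eq_iff)
  qed
  from this[OF fin] show ?thesis by auto
qed

locale presentation = cring R for R :: "('c, 'r) ring_scheme" +
  fixes S :: "'s set" and Rel
  assumes Rel: "Rel \<subseteq> carrier (free_module R S)"
begin

abbreviation F where "F \<equiv> free_module R S"
abbreviation N where "N \<equiv> submodule_generated R F Rel"
abbreviation P where "P \<equiv> presented_module R S Rel"
abbreviation cl where "cl \<equiv> presented_class R S Rel"

sublocale Fm: record_module R F by (unfold record_module_def) (rule module_free)

sublocale Qt: quotient_by_submodule R F N
  by (simp add: quotient_by_submodule_def quotient_by_submodule_axioms_def Fm.record_module_axioms Fm.submodule_generated_submodule[OF Rel])

lemma module_P: "Module.module R P"
  using Qt.module_Q by (simp add: presented_module_def)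

lemma P_carrier: "A \<in> carrier P \<longleftrightarrow> (\<exists>x\<in>carrier F. A = cl x)"
  by (simp add: presented_module_def Qt.Q_carrier presented_class_def)

lemma cl_linear: "linear_map R F P cl"
  using Qt.coset_add Qt.coset_smult P_carrier
  unfolding linear_map_def presented_module_def presented_class_def by auto

lemma cl_Rel: "r \<in> N \<Longrightarrow> cl r = \<zero>\<^bsub>P\<^esub>"
  using Qt.coset_shift[of "\<zero>\<^bsub>F\<^esub>" r] Qt.N_sub Qt.coset_zero
  by (auto simp: presented_module_def presented_class_def subset_iff)

theorem universal:
  assumes L: "Module.module R L" and f: "f \<in> S \<rightarrow> carrier L"
    and kill: "\<And>r \<psi>. r \<in> Rel \<Longrightarrow> linear_map R F L \<psi> \<Longrightarrow> (\<forall>s\<in>S. \<psi> (free_gen R s) = f s) \<Longrightarrow> \<psi> r = \<zero>\<^bsub>L\<^esub>"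
  shows "\<exists>!\<phi>. \<phi> \<in> extensional (carrier P) \<and> linear_map R P L \<phi> \<and> (\<forall>s\<in>S. \<phi> (cl (free_gen R s)) = f s)"
proof -
  interpret L: module R L by fact
  interpret E: free_extension R L S f
    by (unfold_locales) (rule f)
  note lin = E.lin_linear
  let ?K = "{p \<in> carrier F. E.lin p = \<zero>\<^bsub>L\<^esub>}"
  have "submodule ?K R F"
  proof (rule Fm.submoduleI)
    show "\<zero>\<^bsub>F\<^esub> \<in> ?K" using linear_map_zero[OF module_free L lin] by simp
    show "\<ominus>\<^bsub>F\<^esub> a \<in> ?K" if "a \<in> ?K" for a
      using that linear_map_minus[OF module_free L lin, of a] by simp
    show "a \<oplus>\<^bsub>F\<^esub> b \<in> ?K" if "a \<in> ?K" "b \<in> ?K" for a b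
      using that lin unfolding linear_map_def by simp
    show "a \<odot>\<^bsub>F\<^esub> b \<in> ?K" if "a \<in> carrier R" "b \<in> ?K" for a b
      using that lin unfolding linear_map_def by simp
  qed auto
  moreover have "Rel \<subseteq> ?K" using kill[OF _ lin] E.lin_gen Rel by auto
  ultimately have NK: "N \<subseteq> ?K" by (rule Fm.submodule_generated_least)
  have indep: "E.lin p = E.lin q" if "p \<in> carrier F" "q \<in> cl p" for p q
  proof -
    obtain n where n: "n \<in> N" "q = n \<oplus>\<^bsub>F\<^esub> p"
      using \<open>q \<in> cl p\<close> unfolding presented_class_def Qt.coset_eq by blast
    then have n': "n \<in> carrier F" "E.lin n = \<zero>\<^bsub>L\<^esub>" using NK by auto
    have "E.lin (n \<oplus>\<^bsub>F\<^esub> p) = E.lin n \<oplus>\<^bsub>L\<^esub> E.lin p"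
      using lin n'(1) that(1) unfolding linear_map_def by blast
    then show ?thesis using n n' that E.lin_closed[OF that(1)] by simp
  qed
  define \<phi> where "\<phi> = restrict (\<lambda>A. E.lin (SOME p. p \<in> A)) (carrier P)"
  have \<phi>: "\<phi> (cl p) = E.lin p" if "p \<in> carrier F" for p
  proof -
    have "p \<in> cl p" using Qt.coset_self[OF that] by (simp add: presented_class_def)
    then have "(SOME q. q \<in> cl p) \<in> cl p" by (rule someI[where P = "\<lambda>q. q \<in> cl p"])
    from indep[OF that this] show ?thesis using that P_carrier by (auto simp: \<phi>_def)
  qed
  have cla: "cl p \<oplus>\<^bsub>P\<^esub> cl q = cl (p \<oplus>\<^bsub>F\<^esub> q)" if "p \<in> carrier F" "q \<in> carrier F" for p q
    using cl_linear that unfolding linear_map_def by simp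
  have cls: "a \<odot>\<^bsub>P\<^esub> cl q = cl (a \<odot>\<^bsub>F\<^esub> q)" if "a \<in> carrier R" "q \<in> carrier F" for a q
    using cl_linear that unfolding linear_map_def by simp
  have "linear_map R P L \<phi>"
    unfolding linear_map_def
  proof (intro conjI ballI)
    show "\<phi> \<in> carrier P \<rightarrow> carrier L" using \<phi> E.lin_closed P_carrier by auto
  next
    fix A B assume "A \<in> carrier P" "B \<in> carrier P"
    then obtain p q where *: "p \<in> carrier F" "A = cl p" "q \<in> carrier F" "B = cl q" by (auto simp: P_carrier)
    have "p \<oplus>\<^bsub>F\<^esub> q \<in> carrier F" using * by simp
    then show "\<phi> (A \<oplus>\<^bsub>P\<^esub> B) = \<phi> A \<oplus>\<^bsub>L\<^esub> \<phi> B"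
      using * \<phi> cla lin unfolding linear_map_def by simp
  next
    fix a A assume "a \<in> carrier R" "A \<in> carrier P"
    then obtain p where *: "p \<in> carrier F" "A = cl p" "a \<in> carrier R" by (auto simp: P_carrier)
    have "a \<odot>\<^bsub>F\<^esub> p \<in> carrier F" using * by simp
    then show "\<phi> (a \<odot>\<^bsub>P\<^esub> A) = a \<odot>\<^bsub>L\<^esub> \<phi> A"
      using * \<phi> cls lin unfolding linear_map_def by simp
  qed
  moreover have "\<forall>s\<in>S. \<phi> (cl (free_gen R s)) = f s"
  proof
    fix s assume s: "s \<in> S"
    show "\<phi> (cl (free_gen R s)) = f s"
      using \<phi>[OF free_gen_closed[OF s]] E.lin_gen[OF s] by simp
  qed
  moreover have "\<theta> = \<phi>" if \<theta>: "\<theta> \<in> extensional (carrier P)" "linear_map R P L \<theta>" "\<forall>s\<in>S. \<theta> (cl (free_gen R s)) = f s" for \<theta>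
  proof (rule extensionalityI[OF \<theta>(1)])
    show "\<phi> \<in> extensional (carrier P)" by (simp add: \<phi>_def)
    fix A assume "A \<in> carrier P"
    then obtain p where p: "p \<in> carrier F" "A = cl p" by (auto simp: P_carrier)
    let ?A = "{s. p s \<noteq> \<zero>\<^bsub>R\<^esub>}"
    have c: "p s \<in> carrier R" for s using p by (auto simp: free_module_simps)
    have fin: "finite ?A" and S: "?A \<subseteq> S" using p by (auto simp: free_module_simps)
    have comp: "linear_map R F L (\<lambda>x. \<theta> (cl x))"
      using cl_linear \<theta>(2) unfolding linear_map_def by (auto simp: Pi_iff)
    have "\<theta> (cl p) = \<theta> (cl (finsum F (\<lambda>s. p s \<odot>\<^bsub>F\<^esub> free_gen R s) ?A))"
      using free_expand[OF p(1)] by simp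
    also have "\<dots> = finsum L (\<lambda>s. \<theta> (cl (p s \<odot>\<^bsub>F\<^esub> free_gen R s))) ?A"
      using S c by (intro linear_map_finsum[OF module_free L comp fin]) (auto intro!: Fm.smult_closed free_gen_closed)
    also have "\<dots> = finsum L (\<lambda>s. p s \<odot>\<^bsub>L\<^esub> f s) ?A"
    proof (rule L.finsum_cong'[OF refl])
      show "(\<lambda>s. p s \<odot>\<^bsub>L\<^esub> f s) \<in> ?A \<rightarrow> carrier L" using f S c by auto
      fix s assume "s \<in> ?A"
      then have "s \<in> S" using S by auto
      then show "\<theta> (cl (p s \<odot>\<^bsub>F\<^esub> free_gen R s)) = p s \<odot>\<^bsub>L\<^esub> f s"
        using comp \<theta>(3) c free_gen_closed[of s S] unfolding linear_map_def by simp
    qed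
    finally show "\<theta> A = \<phi> A" using p \<phi>[OF p(1)] by (simp add: E.lin_def)
  qed
  ultimately show ?thesis by (intro ex1I[of _ \<phi>]) (auto simp: \<phi>_def)
qed

end

context cinfty_ring begin

interpretation R: cring "cinfty_alg C" by (rule cring_alg)

lemma kaehler_relations_closed: "kaehler_relations C \<subseteq> carrier (free_module (cinfty_alg C) (carrier C))"
proof -
  interpret F: module "cinfty_alg C" "free_module (cinfty_alg C) (carrier C)" by (rule R.module_free)
  have "free_gen (cinfty_alg C) (cop C f as) \<ominus>\<^bsub>free_module (cinfty_alg C) (carrier C)\<^esub>
      (\<Oplus>\<^bsub>free_module (cinfty_alg C) (carrier C)\<^esub>i\<in>{..<length as}.
        cop C (partial_deriv i f) as \<odot>\<^bsub>free_module (cinfty_alg C) (carrier C)\<^esub> free_gen (cinfty_alg C) (as ! i))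
      \<in> carrier (free_module (cinfty_alg C) (carrier C))"
    if "set as \<subseteq> carrier C" "f \<in> C_infinity (length as)" for f as
    using that
    by (intro F.M.minus_closed F.M.finsum_closed)
       (auto intro!: R.free_gen_closed cop_closed F.smult_closed C_infinity_partial_deriv)
  then show ?thesis unfolding kaehler_relations_def Let_def by auto
qed

sublocale K: presentation "cinfty_alg C" "carrier C" "kaehler_relations C"
  by (simp add: presentation_def presentation_axioms_def cring_alg kaehler_relations_closed)

theorem kaehler_module: "Module.module (cinfty_alg C) (kaehler C)"
  using K.module_P by (simp add: kaehler_def)

lemma kaehler_relation_image:
  assumes L: "Module.module (cinfty_alg C) L" and \<psi>: "linear_map (cinfty_alg C) (free_module (cinfty_alg C) (carrier C)) L \<psi>"
    and as: "set as \<subseteq> carrier C" and f: "f \<in> C_infinity (length as)"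
  shows "\<psi> (free_gen (cinfty_alg C) (cop C f as) \<ominus>\<^bsub>free_module (cinfty_alg C) (carrier C)\<^esub>
      (\<Oplus>\<^bsub>free_module (cinfty_alg C) (carrier C)\<^esub>i\<in>{..<length as}.
        cop C (partial_deriv i f) as \<odot>\<^bsub>free_module (cinfty_alg C) (carrier C)\<^esub> free_gen (cinfty_alg C) (as ! i))) =
    \<psi> (free_gen (cinfty_alg C) (cop C f as)) \<ominus>\<^bsub>L\<^esub>
      (\<Oplus>\<^bsub>L\<^esub>i\<in>{..<length as}. cop C (partial_deriv i f) as \<odot>\<^bsub>L\<^esub> \<psi> (free_gen (cinfty_alg C) (as ! i)))"
    (is "\<psi> (?g \<ominus>\<^bsub>?F\<^esub> ?s) = _")
proof -
  interpret L: module "cinfty_alg C" L by (rule L)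
  have g: "?g \<in> carrier ?F" using as f by (intro R.free_gen_closed cop_closed)
  have t: "(\<lambda>i. cop C (partial_deriv i f) as \<odot>\<^bsub>?F\<^esub> free_gen (cinfty_alg C) (as ! i)) \<in> {..<length as} \<rightarrow> carrier ?F"
    using as f by (auto intro!: R.free_gen_closed cop_closed K.Fm.smult_closed C_infinity_partial_deriv)
  then have s: "?s \<in> carrier ?F" by (rule K.Fm.M.finsum_closed)
  have c: "cop C (partial_deriv i f) as \<in> carrier (cinfty_alg C)" "free_gen (cinfty_alg C) (as ! i) \<in> carrier ?F" if "i < length as" for i
    using that as f by (auto intro!: R.free_gen_closed cop_closed C_infinity_partial_deriv)
  have "\<psi> (?g \<ominus>\<^bsub>?F\<^esub> ?s) = \<psi> ?g \<oplus>\<^bsub>L\<^esub> \<psi> (\<ominus>\<^bsub>?F\<^esub> ?s)"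
    using \<psi> g s unfolding linear_map_def a_minus_def by simp
  also have "\<psi> (\<ominus>\<^bsub>?F\<^esub> ?s) = \<ominus>\<^bsub>L\<^esub> \<psi> ?s"
    by (rule linear_map_minus[OF R.module_free L \<psi> s])
  also have "\<psi> ?s = (\<Oplus>\<^bsub>L\<^esub>i\<in>{..<length as}. \<psi> (cop C (partial_deriv i f) as \<odot>\<^bsub>?F\<^esub> free_gen (cinfty_alg C) (as ! i)))"
    by (rule linear_map_finsum[OF R.module_free L \<psi> _ t]) simp
  also have "\<dots> = (\<Oplus>\<^bsub>L\<^esub>i\<in>{..<length as}. cop C (partial_deriv i f) as \<odot>\<^bsub>L\<^esub> \<psi> (free_gen (cinfty_alg C) (as ! i)))"
    using \<psi> c unfolding linear_map_def
    by (intro L.M.finsum_cong') (auto intro!: L.smult_closed)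
  finally show ?thesis by (simp add: a_minus_def)
qed

theorem kaehler_d_derivation: "cinfty_derivation C (kaehler C) (kaehler_d C)"
  unfolding cinfty_derivation_def
proof (intro conjI allI impI)
  interpret K': module "cinfty_alg C" "kaehler C" by (rule kaehler_module)
  have lin: "linear_map (cinfty_alg C) (free_module (cinfty_alg C) (carrier C)) (kaehler C) K.cl"
    using K.cl_linear by (simp add: kaehler_def)
  have d: "kaehler_d C b = K.cl (free_gen (cinfty_alg C) b)" for b by (simp add: kaehler_d_def)
  have dc: "kaehler_d C b \<in> carrier (kaehler C)" if "b \<in> carrier C" for b
    using lin R.free_gen_closed[OF that] unfolding d linear_map_def by blast
  then show "kaehler_d C \<in> carrier C \<rightarrow> carrier (kaehler C)" by auto
  fix as f assume *: "as \<noteq> [] \<and> set as \<subseteq> carrier C \<and> f \<in> C_infinity (length as)"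
  let ?r = "free_gen (cinfty_alg C) (cop C f as) \<ominus>\<^bsub>free_module (cinfty_alg C) (carrier C)\<^esub>
      (\<Oplus>\<^bsub>free_module (cinfty_alg C) (carrier C)\<^esub>i\<in>{..<length as}.
        cop C (partial_deriv i f) as \<odot>\<^bsub>free_module (cinfty_alg C) (carrier C)\<^esub> free_gen (cinfty_alg C) (as ! i))"
  let ?s = "\<Oplus>\<^bsub>kaehler C\<^esub>i\<in>{..<length as}. cop C (partial_deriv i f) as \<odot>\<^bsub>kaehler C\<^esub> kaehler_d C (as ! i)"
  have "?r \<in> kaehler_relations C" using * unfolding kaehler_relations_def Let_def by blast
  then have "K.cl ?r = \<zero>\<^bsub>kaehler C\<^esub>"
    using K.cl_Rel K.Fm.submodule_generated_incl by (auto simp: kaehler_def)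
  then have "kaehler_d C (cop C f as) \<ominus>\<^bsub>kaehler C\<^esub> ?s = \<zero>\<^bsub>kaehler C\<^esub>"
    using kaehler_relation_image[OF kaehler_module lin, of as f] * by (simp add: d)
  moreover have "kaehler_d C (cop C f as) \<in> carrier (kaehler C)" using * by (intro dc cop_closed) auto
  moreover have "?s \<in> carrier (kaehler C)"
    using * by (auto intro!: K'.M.finsum_closed K'.smult_closed dc cop_closed C_infinity_partial_deriv)
  ultimately show "kaehler_d C (cop C f as) = ?s"
    using K'.M.minus_equality[of "kaehler_d C (cop C f as)" "\<ominus>\<^bsub>kaehler C\<^esub> ?s"]
    by (simp add: a_minus_def)
qed

theorem kaehler_universal:
  fixes L :: "('c, 'n) module"
  assumes L: "Module.module (cinfty_alg C) L" and D: "cinfty_derivation C L D"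
  shows "\<exists>!\<phi>. \<phi> \<in> extensional (carrier (kaehler C)) \<and> linear_map (cinfty_alg C) (kaehler C) L \<phi> \<and>
    (\<forall>b\<in>carrier C. \<phi> (kaehler_d C b) = D b)"
  unfolding kaehler_def kaehler_d_def
proof (rule K.universal[OF L, of D, simplified carrier_alg])
  interpret L: module "cinfty_alg C" L by (rule L)
  show "D \<in> carrier C \<rightarrow> carrier L" using D by (simp add: cinfty_derivation_def)
  then have Dc: "D b \<in> carrier L" if "b \<in> carrier C" for b using that by auto
  fix r \<psi>
  assume r: "r \<in> kaehler_relations C" and \<psi>: "linear_map (cinfty_alg C) (free_module (cinfty_alg C) (carrier C)) L \<psi>"
    and g: "\<forall>s\<in>carrier C. \<psi> (free_gen (cinfty_alg C) s) = D s"
  obtain f as where *: "as \<noteq> []" "set as \<subseteq> carrier C" "f \<in> C_infinity (length as)"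
    and r': "r = free_gen (cinfty_alg C) (cop C f as) \<ominus>\<^bsub>free_module (cinfty_alg C) (carrier C)\<^esub>
      (\<Oplus>\<^bsub>free_module (cinfty_alg C) (carrier C)\<^esub>i\<in>{..<length as}.
        cop C (partial_deriv i f) as \<odot>\<^bsub>free_module (cinfty_alg C) (carrier C)\<^esub> free_gen (cinfty_alg C) (as ! i))"
    using r unfolding kaehler_relations_def Let_def by blast
  let ?s = "\<Oplus>\<^bsub>L\<^esub>i\<in>{..<length as}. cop C (partial_deriv i f) as \<odot>\<^bsub>L\<^esub> D (as ! i)"
  have ai: "as ! i \<in> carrier C" "cop C (partial_deriv i f) as \<in> carrier (cinfty_alg C)" if "i < length as" for i
    using that * by (auto intro!: cop_closed C_infinity_partial_deriv)
  have "\<psi> r = D (cop C f as) \<ominus>\<^bsub>L\<^esub>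
      (\<Oplus>\<^bsub>L\<^esub>i\<in>{..<length as}. cop C (partial_deriv i f) as \<odot>\<^bsub>L\<^esub> \<psi> (free_gen (cinfty_alg C) (as ! i)))"
    unfolding r' kaehler_relation_image[OF L \<psi> *(2,3)] using g cop_closed[OF *(2,3)] by simp
  also have "(\<Oplus>\<^bsub>L\<^esub>i\<in>{..<length as}. cop C (partial_deriv i f) as \<odot>\<^bsub>L\<^esub> \<psi> (free_gen (cinfty_alg C) (as ! i))) = ?s"
    using ai g Dc by (intro L.M.finsum_cong') auto
  also have "?s = D (cop C f as)" using D * unfolding cinfty_derivation_def by simp
  also have "D (cop C f as) \<ominus>\<^bsub>L\<^esub> D (cop C f as) = \<zero>\<^bsub>L\<^esub>"
    using Dc[OF cop_closed[OF *(2,3)]] by (simp add: a_minus_def L.M.r_neg)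
  finally show "\<psi> r = \<zero>\<^bsub>L\<^esub>" .
qed

end

end

(*
  A derivation D of the exterior algebra extending d is not C-linear, but the map sending a form w to
  (w, D w) is C-linear when a acts on such pairs by a (w, h) = (a w, a h + da /\ w). With this twisted
  action on pairs of forms of degrees k and k + 1, linear maps can be obtained from universal
  properties. In degree 1, b |-> (db, 0) is a C-infinity-derivation because second partial derivatives
  commute, so it induces a map x |-> (x, delta x) on the Kaehler differentials. Wedging with
  (x, delta x) is then an alternating operation on pairs, which extends the construction to all
  exterior powers. The derivation rule, D D = 0 and uniqueness are checked on products of 1-forms.
*)
theory Submission
  imports Defs
begin

section \<open>Symmetry of second partial derivatives\<close>

text \<open>The action on pairs comes from sending \<open>a\<close> to \<open>a + e da\<close> with
  \<open>e\<close> of square zero: multiplicativity of this map is the Leibniz rule for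
  \<open>d\<close>. The operation of a one-form \<open>x\<close> is forced in the same way. Since
  \<open>D (x \<and> \<omega>)\<close> has to be
  \<open>\<delta> x \<and> \<omega> - x \<and> D \<omega>\<close>, a pair
  \<open>(\<omega>, \<eta>)\<close> goes to \<open>(x \<and> \<omega>, \<delta> x \<and> \<omega> -
  x \<and> \<eta>)\<close>. The minus sign matches the twisted scalars because
  \<open>x \<and> da = - da \<and> x\<close>, and the operation has square zero because
  \<open>\<delta> x\<close> has even degree and therefore commutes with \<open>x\<close>. The
  analysis enters at a single point. The chain rule for the pairs \<open>(db, 0)\<close> leaves, in
  degree two, the sum of the terms (second partial derivative) times
  \<open>da_j \<and> da_i\<close>. It vanishes exactly because a symmetric coefficient meets an
  antisymmetric product, and the zero in \<open>(db, 0)\<close> is the requirement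
  \<open>D (db) = 0\<close>.\<close>

lemma mixed_derivatives_commute:
  fixes g gs gt gst gts :: "real \<Rightarrow> real \<Rightarrow> real"
  assumes gs: "\<And>s t. ((\<lambda>s. g s t) has_real_derivative gs s t) (at s)"
    and gt: "\<And>s t. ((\<lambda>t. g s t) has_real_derivative gt s t) (at t)"
    and gst: "\<And>s t. ((\<lambda>t. gs s t) has_real_derivative gst s t) (at t)"
    and gts: "\<And>s t. ((\<lambda>s. gt s t) has_real_derivative gts s t) (at s)"
    and cont: "continuous_on UNIV (\<lambda>p. gst (fst p) (snd p))" "continuous_on UNIV (\<lambda>p. gts (fst p) (snd p))"
  shows "gst a b = gts a b"
proof (rule ccontr)
  assume ne: "gst a b \<noteq> gts a b"
  define e where "e = \<bar>gst a b - gts a b\<bar> / 2"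
  have e: "e > 0" using ne by (simp add: e_def)
  have near: "\<exists>d>0. \<forall>s t. \<bar>s - a\<bar> + \<bar>t - b\<bar> < d \<longrightarrow> \<bar>h s t - h a b\<bar> < e"
    if "continuous_on UNIV (\<lambda>p. h (fst p) (snd p))" for h :: "real \<Rightarrow> real \<Rightarrow> real"
  proof -
    have "\<exists>d>0. \<forall>p\<in>UNIV. dist p (a, b) < d \<longrightarrow> dist (h (fst p) (snd p)) (h (fst (a, b)) (snd (a, b))) < e"
      using that e unfolding continuous_on_iff by blast
    then obtain d where d: "d > 0" "\<And>p. dist p (a, b) < d \<Longrightarrow> dist (h (fst p) (snd p)) (h a b) < e"
      by auto
    have le: "dist (s, t) (a, b) \<le> \<bar>s - a\<bar> + \<bar>t - b\<bar>" for s t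
      using sqrt_sum_squares_le_sum_abs[of "dist s a" "dist t b"] by (simp add: dist_Pair_Pair dist_real_def)
    have "\<bar>h s t - h a b\<bar> < e" if "\<bar>s - a\<bar> + \<bar>t - b\<bar> < d" for s t
      using d(2)[OF order_le_less_trans[OF le that]] by (simp add: dist_real_def)
    with d(1) show ?thesis by blast
  qed
  obtain d1 d2 where d: "d1 > 0" "d2 > 0"
    and d1: "\<And>s t. \<bar>s - a\<bar> + \<bar>t - b\<bar> < d1 \<Longrightarrow> \<bar>gst s t - gst a b\<bar> < e"
    and d2: "\<And>s t. \<bar>s - a\<bar> + \<bar>t - b\<bar> < d2 \<Longrightarrow> \<bar>gts s t - gts a b\<bar> < e"
    using near[OF cont(1)] near[OF cont(2)] by blast
  \<comment> \<open>Points of the square with corner \<open>(a, b)\<close> and side \<open>h\<close>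
    have coordinate differences summing to less than \<open>2 * h\<close>, so they lie in both
    neighbourhoods.\<close>
  define h where "h = min d1 d2 / 2"
  have h: "h > 0" using d by (simp add: h_def)
  define \<Delta> where "\<Delta> = g (a + h) (b + h) - g (a + h) b - g a (b + h) + g a b"
  \<comment> \<open>The second difference of \<open>g\<close> over this square is evaluated by the
    mean value theorem in both orders. This gives \<open>h^2\<close> times a value of
    \<open>gst\<close> and \<open>h^2\<close> times a value of \<open>gts\<close>, at two possibly
    different points of the square; the equality of these values contradicts the gap
    \<open>2 * e\<close>.\<close>
  obtain s where s: "a < s" "s < a + h" "g (a + h) (b + h) - g (a + h) b - (g a (b + h) - g a b) = h * (gs s (b + h) - gs s b)"
    using MVT2[of a "a + h" "\<lambda>s. g s (b + h) - g s b" "\<lambda>s. gs s (b + h) - gs s b"] h gs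
    by (force intro: DERIV_diff)
  obtain t where t: "b < t" "t < b + h" "gs s (b + h) - gs s b = h * gst s t"
    using MVT2[of b "b + h" "gs s" "gst s"] h gst by force
  obtain t' where t': "b < t'" "t' < b + h" "g (a + h) (b + h) - g a (b + h) - (g (a + h) b - g a b) = h * (gt (a + h) t' - gt a t')"
    using MVT2[of b "b + h" "\<lambda>t. g (a + h) t - g a t" "\<lambda>t. gt (a + h) t - gt a t"] h gt
    by (force intro: DERIV_diff)
  obtain s' where s': "a < s'" "s' < a + h" "gt (a + h) t' - gt a t' = h * gts s' t'"
    using MVT2[of a "a + h" "\<lambda>s. gt s t'" "\<lambda>s. gts s t'"] h gts by force
  have "h * (h * gst s t) = h * (h * gts s' t')" using s(3) t'(3) unfolding t(3) s'(3) by linarith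
  then have "gst s t = gts s' t'" using h by simp
  moreover have "\<bar>gst s t - gst a b\<bar> < e" using s(1,2) t(1,2) by (intro d1) (simp add: h_def min_def split: if_splits)
  moreover have "\<bar>gts s' t' - gts a b\<bar> < e" using s'(1,2) t'(1,2) by (intro d2) (simp add: h_def min_def split: if_splits)
  moreover have "\<bar>gst a b - gts a b\<bar> = 2 * e" by (simp add: e_def)
  ultimately show False by (simp only: abs_if split: if_splits)
qed

text \<open>Applying the hypothesis at the moved base point \<open>x(i := s)\<close> turns
  differentiability at \<open>x i\<close> into differentiability along the whole coordinate
  line.\<close>

lemma has_derivative_partial_deriv:
  assumes "\<And>x. (\<lambda>t. f (x(i := t))) differentiable (at (x i))"
  shows "((\<lambda>t. f (x(i := t))) has_real_derivative partial_deriv i f (x(i := s))) (at s)"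
  using assms[of "x(i := s)"] unfolding partial_deriv_def
  by (auto simp: real_differentiable_def dest: DERIV_imp_deriv)

theorem partial_deriv_commute:
  assumes f: "f \<in> C_infinity n" and ij: "i < n" "j < n"
  shows "partial_deriv i (partial_deriv j f) = partial_deriv j (partial_deriv i f)"
proof (cases "i = j")
  case False
  have diff: "(\<lambda>t. h (x(k := t))) differentiable (at (x k))" if "h \<in> C_infinity n" "k < n" for h k x
  proof -
    have "C_k n (Suc 0) h" using that(1) unfolding C_infinity_def by blast
    then show ?thesis using that(2) by simp
  qed
  note deriv = has_derivative_partial_deriv[OF diff]
  note fi = C_infinity_partial_deriv[OF f ij(1)] and fj = C_infinity_partial_deriv[OF f ij(2)]
  have cont: "continuous_on UNIV (\<lambda>p. h (x(i := fst p, j := snd p)))" if "h \<in> C_infinity n"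
    for h and x :: "nat \<Rightarrow> real"
  proof (rule continuous_on_compose2[of UNIV h])
    show "continuous_on UNIV h" using that C_k_continuous unfolding C_infinity_def by blast
    show "continuous_on UNIV (\<lambda>p. x(i := fst p, j := snd p))"
    proof (rule continuous_on_coordinatewise_then_product)
      show "continuous_on UNIV (\<lambda>p. (x(i := fst p, j := snd p)) l)" for l
        by (cases "l = j"; cases "l = i") (auto intro!: continuous_intros)
    qed
  qed simp
  show ?thesis
  proof
    fix x :: "nat \<Rightarrow> real"
    \<comment> \<open>The two updates commute because \<open>i\<close> and \<open>j\<close> differ;
      this lets either coordinate be the one that moves last, as \<open>deriv\<close>
      expects.\<close>
    have tw: "x(j := t, i := s) = x(i := s, j := t)" for s t
      using False by (rule fun_upd_twist[OF not_sym])
    let ?y = "\<lambda>(s :: real) (t :: real). x(i := s, j := t)"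
    have "partial_deriv j (partial_deriv i f) (?y (x i) (x j)) = partial_deriv i (partial_deriv j f) (?y (x i) (x j))"
    proof (rule mixed_derivatives_commute[of "\<lambda>s t. f (?y s t)" "\<lambda>s t. partial_deriv i f (?y s t)"
          "\<lambda>s t. partial_deriv j f (?y s t)" "\<lambda>s t. partial_deriv j (partial_deriv i f) (?y s t)"
          "\<lambda>s t. partial_deriv i (partial_deriv j f) (?y s t)"])
      fix s t
      show "((\<lambda>s. f (?y s t)) has_real_derivative partial_deriv i f (?y s t)) (at s)"
        using deriv[OF f ij(1), of "x(j := t)" s] unfolding tw .
      show "((\<lambda>t. f (?y s t)) has_real_derivative partial_deriv j f (?y s t)) (at t)"
        by (rule deriv[OF f ij(2)])
      show "((\<lambda>t. partial_deriv i f (?y s t)) has_real_derivative partial_deriv j (partial_deriv i f) (?y s t)) (at t)"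
        by (rule deriv[OF fi ij(2)])
      show "((\<lambda>s. partial_deriv j f (?y s t)) has_real_derivative partial_deriv i (partial_deriv j f) (?y s t)) (at s)"
        using deriv[OF fj ij(1), of "x(j := t)" s] unfolding tw .
    qed (intro cont C_infinity_partial_deriv fi fj ij)+
    then show "partial_deriv i (partial_deriv j f) x = partial_deriv j (partial_deriv i f) x" by simp
  qed
qed simp

section \<open>Presented modules\<close>

text \<open>Elements are finite sums of multiples of generators. The scalar stays inside the
  generator case, so \<open>P\<close> need not be closed under scalar multiplication.\<close>

lemma (in cring) free_module_induct [consumes 1, case_names zero add smult_gen]:
  assumes p: "p \<in> carrier (free_module R S)"
    and zero: "P \<zero>\<^bsub>free_module R S\<^esub>"
    and add: "\<And>p q. \<lbrakk>p \<in> carrier (free_module R S); q \<in> carrier (free_module R S); P p; P q\<rbrakk> \<Longrightarrow>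
      P (p \<oplus>\<^bsub>free_module R S\<^esub> q)"
    and gen: "\<And>a s. \<lbrakk>a \<in> carrier R; s \<in> S\<rbrakk> \<Longrightarrow> P (a \<odot>\<^bsub>free_module R S\<^esub> free_gen R s)"
  shows "P p"
proof -
  let ?F = "free_module R S" and ?g = "\<lambda>s. p s \<odot>\<^bsub>free_module R S\<^esub> free_gen R s"
  interpret F: module R ?F by (rule module_free)
  have c: "p s \<in> carrier R" for s using p by (auto simp: free_module_simps)
  have fin: "finite {s. p s \<noteq> \<zero>}" and S: "{s. p s \<noteq> \<zero>} \<subseteq> S" using p by (auto simp: free_module_simps)
  have g: "?g s \<in> carrier ?F" if "s \<in> S" for s using that c by (auto intro!: F.smult_closed free_gen_closed)
  have "P (finsum ?F ?g A)" if "finite A" "A \<subseteq> S" for A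
    using that
  proof (induction A)
    case empty
    then show ?case using zero by simp
  next
    case (insert s A)
    then have "finsum ?F ?g (insert s A) = ?g s \<oplus>\<^bsub>?F\<^esub> finsum ?F ?g A"
      using g by (intro F.finsum_insert) auto
    moreover have "finsum ?F ?g A \<in> carrier ?F" using insert.prems g by (intro F.finsum_closed) auto
    ultimately show ?case using insert g c by (auto intro!: add gen)
  qed
  from this[OF fin S] show ?thesis using free_expand[OF p] by simp
qed

context presentation
begin

lemma presented_induct [consumes 1, case_names zero add smult_gen]:
  assumes A: "A \<in> carrier P"
    and zero: "Q \<zero>\<^bsub>P\<^esub>"
    and add: "\<And>A B. \<lbrakk>A \<in> carrier P; B \<in> carrier P; Q A; Q B\<rbrakk> \<Longrightarrow> Q (A \<oplus>\<^bsub>P\<^esub> B)"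
    and gen: "\<And>a s. \<lbrakk>a \<in> carrier R; s \<in> S\<rbrakk> \<Longrightarrow> Q (a \<odot>\<^bsub>P\<^esub> cl (free_gen R s))"
  shows "Q A"
proof -
  obtain p where p: "p \<in> carrier F" "A = cl p" using A by (auto simp: P_carrier)
  note lin = cl_linear[unfolded linear_map_def]
  have "Q (cl p)" using p(1)
  proof (induction rule: free_module_induct)
    case zero
    then show ?case using assms(2) linear_map_zero[OF module_free module_P cl_linear] by simp
  next
    case (add p q)
    then show ?case using assms(3)[of "cl p" "cl q"] lin by auto
  next
    case (smult_gen a s)
    then show ?case using gen[of a s] lin free_gen_closed[of s S] by auto
  qed
  with p show ?thesis by simp
qed

text \<open>The preimage of a submodule is a submodule, hence contains everything generated by
  \<open>Rel\<close> once it contains \<open>Rel\<close>. With the zero submodule as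
  \<open>N'\<close> this shows that maps descend to the quotient.\<close>

lemma linear_map_generated:
  assumes L: "Module.module R L" and \<phi>: "linear_map R F L \<phi>" and N': "submodule N' R L"
    and Rel': "\<And>r. r \<in> Rel \<Longrightarrow> \<phi> r \<in> N'" and p: "p \<in> N"
  shows "\<phi> p \<in> N'"
proof -
  interpret L: module R L by fact
  have \<phi>': "\<phi> p \<in> carrier L" "\<phi> (p \<oplus>\<^bsub>F\<^esub> q) = \<phi> p \<oplus>\<^bsub>L\<^esub> \<phi> q" "a \<in> carrier R \<Longrightarrow> \<phi> (a \<odot>\<^bsub>F\<^esub> p) = a \<odot>\<^bsub>L\<^esub> \<phi> p"
    if "p \<in> carrier F" "q \<in> carrier F" for p q a
    using \<phi> that unfolding linear_map_def by auto
  have "submodule {p \<in> carrier F. \<phi> p \<in> N'} R F"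
  proof (rule Fm.submoduleI)
    show "\<zero>\<^bsub>F\<^esub> \<in> {p \<in> carrier F. \<phi> p \<in> N'}"
      using linear_map_zero[OF module_free L \<phi>] subgroup.one_closed[OF submodule.axioms(1)[OF N']] by simp
  qed (use L.submoduleE[OF N'] \<phi>' linear_map_minus[OF module_free L \<phi>] in auto)
  moreover have "Rel \<subseteq> {p \<in> carrier F. \<phi> p \<in> N'}" using Rel Rel' by auto
  ultimately show ?thesis using p Fm.submodule_generated_least by blast
qed

end

lemma submodule_zero: 
  assumes "Module.module R L" shows "submodule {\<zero>\<^bsub>L\<^esub>} R L"
proof -
  interpret L: module R L by fact
  show ?thesis by (rule L.submoduleI) auto
qed

section \<open>Exterior powers\<close>

locale exterior = record_module R M for R :: "('c, 'r) ring_scheme" and M :: "('c, 'm) module"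
begin

abbreviation T where "T \<equiv> tuples M"
abbreviation L where "L \<equiv> ext_power R M"
abbreviation cl where "cl \<equiv> ext_class R M"
abbreviation gen where "gen k xs \<equiv> ext_class R M k (free_gen R xs)"
abbreviation W where "W \<equiv> ext_wedge R M"

lemma tuplesI: "set xs \<subseteq> carrier M \<Longrightarrow> int (length xs) = k \<Longrightarrow> xs \<in> T k"
  by (simp add: tuples_def)

lemma tuples_update: "xs \<in> T k \<Longrightarrow> x \<in> carrier M \<Longrightarrow> xs[i := x] \<in> T k"
  using set_update_subset_insert[of xs i x] by (auto simp: tuples_def)

lemma ext_relations_closed: "ext_relations R M k \<subseteq> carrier (free_module R (T k))"
proof -
  interpret F: module R "free_module R (T k)" by (rule module_free)
  show ?thesis
    unfolding ext_relations_def Let_def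
    by (auto intro!: F.minus_closed F.a_closed F.smult_closed free_gen_closed tuples_update)
qed

sublocale E: presentation R "T k" "ext_relations R M k" for k
  by (simp add: presentation_def presentation_axioms_def is_cring ext_relations_closed)

abbreviation FT where "FT k \<equiv> free_module R (T k)"

lemma module_L: "Module.module R (L k)"
  using E.module_P by (simp add: ext_power_def)

sublocale L: module R "L k" for k
  by (rule module_L)

lemma cl_eq: "cl k = E.cl k" and L_eq: "L k = E.P k"
  by (simp_all add: ext_class_def ext_power_def)

lemma L_carrier: "A \<in> carrier (L k) \<longleftrightarrow> (\<exists>p\<in>carrier (FT k). A = cl k p)"
  by (simp add: L_eq cl_eq E.P_carrier)

lemma cl_closed [simp]: "p \<in> carrier (FT k) \<Longrightarrow> cl k p \<in> carrier (L k)"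
  by (auto simp: L_carrier)

lemma cl_linear: "linear_map R (FT k) (L k) (cl k)"
  by (simp add: L_eq cl_eq E.cl_linear)

lemma cl_add: "p \<in> carrier (FT k) \<Longrightarrow> q \<in> carrier (FT k) \<Longrightarrow> cl k (p \<oplus>\<^bsub>FT k\<^esub> q) = cl k p \<oplus>\<^bsub>L k\<^esub> cl k q"
  and cl_smult: "a \<in> carrier R \<Longrightarrow> p \<in> carrier (FT k) \<Longrightarrow> cl k (a \<odot>\<^bsub>FT k\<^esub> p) = a \<odot>\<^bsub>L k\<^esub> cl k p"
  using cl_linear unfolding linear_map_def by auto

lemma cl_uminus: "p \<in> carrier (FT k) \<Longrightarrow> cl k (\<ominus>\<^bsub>FT k\<^esub> p) = \<ominus>\<^bsub>L k\<^esub> cl k p"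
  by (rule linear_map_minus[OF module_free module_L cl_linear])

lemma cl_minus: "p \<in> carrier (FT k) \<Longrightarrow> q \<in> carrier (FT k) \<Longrightarrow> cl k (p \<ominus>\<^bsub>FT k\<^esub> q) = cl k p \<ominus>\<^bsub>L k\<^esub> cl k q"
  by (simp add: a_minus_def cl_add cl_uminus E.Fm.M.a_inv_closed)

lemma cl_relation: "r \<in> ext_relations R M k \<Longrightarrow> cl k r = \<zero>\<^bsub>L k\<^esub>"
  using E.cl_Rel[of r k] E.Fm.submodule_generated_incl by (auto simp: L_eq cl_eq)

lemma gen_closed [simp]: "xs \<in> T k \<Longrightarrow> gen k xs \<in> carrier (L k)"
  by (simp add: free_gen_closed)

lemma L_induct [consumes 1, case_names zero add smult_gen]:
  assumes "A \<in> carrier (L k)" "Q \<zero>\<^bsub>L k\<^esub>"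
    and "\<And>A B. \<lbrakk>A \<in> carrier (L k); B \<in> carrier (L k); Q A; Q B\<rbrakk> \<Longrightarrow> Q (A \<oplus>\<^bsub>L k\<^esub> B)"
    and "\<And>a xs. \<lbrakk>a \<in> carrier R; xs \<in> T k\<rbrakk> \<Longrightarrow> Q (a \<odot>\<^bsub>L k\<^esub> gen k xs)"
  shows "Q A"
  using assms unfolding L_eq cl_eq by (rule E.presented_induct)

lemma eq_of_minus:
  assumes "x \<in> carrier (L k)" "y \<in> carrier (L k)" "x \<ominus>\<^bsub>L k\<^esub> y = \<zero>\<^bsub>L k\<^esub>"
  shows "x = y"
proof -
  have "\<ominus>\<^bsub>L k\<^esub> (\<ominus>\<^bsub>L k\<^esub> y) = x"
    using assms by (intro L.M.minus_equality) (simp_all add: a_minus_def)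
  with assms show ?thesis by simp
qed

lemma gen_add_update:
  assumes "xs \<in> T k" "i < length xs" "x \<in> carrier M" "y \<in> carrier M"
  shows "gen k (xs[i := x \<oplus>\<^bsub>M\<^esub> y]) = gen k (xs[i := x]) \<oplus>\<^bsub>L k\<^esub> gen k (xs[i := y])"
proof -
  have t: "xs[i := x \<oplus>\<^bsub>M\<^esub> y] \<in> T k" "xs[i := x] \<in> T k" "xs[i := y] \<in> T k" using assms by (auto intro: tuples_update)
  have "free_gen R (xs[i := x \<oplus>\<^bsub>M\<^esub> y]) \<ominus>\<^bsub>FT k\<^esub> (free_gen R (xs[i := x]) \<oplus>\<^bsub>FT k\<^esub> free_gen R (xs[i := y])) \<in> ext_relations R M k"
    unfolding ext_relations_def Let_def using assms by blast
  from cl_relation[OF this] t show ?thesis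
    by - (rule eq_of_minus, (simp_all add: free_gen_closed cl_minus cl_add E.Fm.M.a_closed)+)
qed

lemma gen_smult_update:
  assumes "xs \<in> T k" "i < length xs" "a \<in> carrier R" "x \<in> carrier M"
  shows "gen k (xs[i := a \<odot>\<^bsub>M\<^esub> x]) = a \<odot>\<^bsub>L k\<^esub> gen k (xs[i := x])"
proof -
  have t: "xs[i := a \<odot>\<^bsub>M\<^esub> x] \<in> T k" "xs[i := x] \<in> T k" using assms by (auto intro: tuples_update)
  have "free_gen R (xs[i := a \<odot>\<^bsub>M\<^esub> x]) \<ominus>\<^bsub>FT k\<^esub> a \<odot>\<^bsub>FT k\<^esub> free_gen R (xs[i := x]) \<in> ext_relations R M k"
    unfolding ext_relations_def Let_def using assms by blast
  from cl_relation[OF this] t assms(3) show ?thesis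
    by - (rule eq_of_minus, (simp_all add: free_gen_closed cl_minus cl_smult E.Fm.smult_closed)+)
qed

lemma gen_repeated:
  assumes "xs \<in> T k" "i < j" "j < length xs" "xs ! i = xs ! j"
  shows "gen k xs = \<zero>\<^bsub>L k\<^esub>"
proof (rule cl_relation)
  show "free_gen R xs \<in> ext_relations R M k"
    unfolding ext_relations_def Let_def using assms by blast
qed

section \<open>Sign rules for permuting the entries of a tuple\<close>

lemma gen_add:
  assumes "xs @ x # ys \<in> T k" "y \<in> carrier M"
  shows "gen k (xs @ (x \<oplus>\<^bsub>M\<^esub> y) # ys) = gen k (xs @ x # ys) \<oplus>\<^bsub>L k\<^esub> gen k (xs @ y # ys)"
  using gen_add_update[of "xs @ x # ys" k "length xs" x y] assms by (simp add: tuples_def)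

lemma gen_smult:
  assumes "xs @ x # ys \<in> T k" "a \<in> carrier R"
  shows "gen k (xs @ (a \<odot>\<^bsub>M\<^esub> x) # ys) = a \<odot>\<^bsub>L k\<^esub> gen k (xs @ x # ys)"
  using gen_smult_update[of "xs @ x # ys" k "length xs" a x] assms by (simp add: tuples_def)

text \<open>Polarization: expand the tuple with \<open>x + y\<close> in both adjacent places, which
  vanishes, and drop the two terms with a repeated entry.\<close>

lemma gen_swap:
  assumes t: "xs @ x # y # ys \<in> T k"
  shows "gen k (xs @ x # y # ys) = \<ominus>\<^bsub>L k\<^esub> gen k (xs @ y # x # ys)"
proof -
  have x: "x \<in> carrier M" "y \<in> carrier M" using t by (auto simp: tuples_def)
  have T: "xs @ u # v # ys \<in> T k" if "u \<in> carrier M" "v \<in> carrier M" for u v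
    using t that by (auto simp: tuples_def)
  have rep: "gen k (xs @ u # u # ys) = \<zero>\<^bsub>L k\<^esub>" if "u \<in> carrier M" for u
    using T[OF that that] by (rule gen_repeated[of _ _ "length xs" "Suc (length xs)"]) (auto simp: nth_append)
  have add2: "gen k (xs @ u # (x \<oplus>\<^bsub>M\<^esub> y) # ys) = gen k (xs @ u # x # ys) \<oplus>\<^bsub>L k\<^esub> gen k (xs @ u # y # ys)"
    if "u \<in> carrier M" for u
    using gen_add[of "xs @ [u]" x ys k y] T[OF that x(1)] x by simp
  have "\<zero>\<^bsub>L k\<^esub> = gen k (xs @ (x \<oplus>\<^bsub>M\<^esub> y) # (x \<oplus>\<^bsub>M\<^esub> y) # ys)" using rep x by simp
  also have "\<dots> = gen k (xs @ x # (x \<oplus>\<^bsub>M\<^esub> y) # ys) \<oplus>\<^bsub>L k\<^esub> gen k (xs @ y # (x \<oplus>\<^bsub>M\<^esub> y) # ys)"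
    using x by (intro gen_add T) auto
  also have "\<dots> = gen k (xs @ x # y # ys) \<oplus>\<^bsub>L k\<^esub> gen k (xs @ y # x # ys)"
    using x T by (simp add: add2 rep)
  finally show ?thesis using x T by (intro L.M.minus_equality[symmetric]) (simp_all add: T)
qed

text \<open>The sign (-1)^k as a scalar of \<open>R\<close>, so that sign rules are covered by
  \<open>R\<close>-linearity of the wedge product.\<close>

definition koszul_sign :: "int \<Rightarrow> 'c" where "koszul_sign k = (if even k then \<one>\<^bsub>R\<^esub> else \<ominus>\<^bsub>R\<^esub> \<one>\<^bsub>R\<^esub>)"

lemma koszul_sign_closed [simp]: "koszul_sign k \<in> carrier R" by (simp add: koszul_sign_def)

lemma koszul_sign_smult: "x \<in> carrier (L l) \<Longrightarrow> koszul_sign k \<odot>\<^bsub>L l\<^esub> x = (if even k then x else \<ominus>\<^bsub>L l\<^esub> x)"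
  by (simp add: koszul_sign_def L.smult_l_minus)

text \<open>One adjacent swap for each entry of \<open>ys\<close>; every entry that has been passed
  joins the prefix \<open>xs\<close>, which is why \<open>xs\<close> is arbitrary in the
  induction.\<close>

lemma gen_move:
  "xs @ x # ys @ zs \<in> T k \<Longrightarrow>
    gen k (xs @ x # ys @ zs) = koszul_sign (int (length ys)) \<odot>\<^bsub>L k\<^esub> gen k (xs @ ys @ x # zs)"
proof (induction ys arbitrary: xs)
  case Nil
  then show ?case by (simp add: koszul_sign_smult)
next
  case (Cons y ys)
  have T: "xs @ y # x # ys @ zs \<in> T k" "xs @ y # ys @ x # zs \<in> T k" using Cons.prems by (auto simp: tuples_def)
  then show ?case
    using gen_swap[of xs x y "ys @ zs" k] Cons.prems Cons.IH[of "xs @ [y]"]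
    by (auto simp: koszul_sign_smult)
qed

text \<open>The head \<open>x\<close> travels to the far right past \<open>xs @ ys\<close>, and the
  induction hypothesis is then used with \<open>ys @ [x]\<close>. With \<open>m\<close>,
  \<open>n\<close> the lengths of \<open>xs\<close>, \<open>ys\<close>, the sign exponent
  \<open>(m + n) + m (1 + n)\<close> has the parity of \<open>(1 + m) n\<close>.\<close>

lemma gen_append_commute:
  "xs @ ys \<in> T k \<Longrightarrow> gen k (xs @ ys) = koszul_sign (int (length xs) * int (length ys)) \<odot>\<^bsub>L k\<^esub> gen k (ys @ xs)"
proof (induction xs arbitrary: ys)
  case Nil
  then show ?case by (simp add: koszul_sign_smult)
next
  case (Cons x xs)
  have T: "xs @ ys @ [x] \<in> T k" "x # xs @ ys \<in> T k" "ys @ x # xs \<in> T k" using Cons.prems by (auto simp: tuples_def)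
  have "gen k ((x # xs) @ ys) = koszul_sign (int (length xs + length ys)) \<odot>\<^bsub>L k\<^esub> gen k (xs @ ys @ [x])"
    using gen_move[of "[]" x "xs @ ys" "[]" k] T by simp
  also have "gen k (xs @ ys @ [x]) = koszul_sign (int (length xs) * (1 + int (length ys))) \<odot>\<^bsub>L k\<^esub> gen k (ys @ x # xs)"
    using Cons.IH[OF T(1)] by simp
  finally show ?case using T by (auto simp: koszul_sign_smult)
qed

end

section \<open>The wedge product of classes and its algebraic laws\<close>

lemma linear_map_diff:
  assumes "Module.module R M" "Module.module R N" "linear_map R M N \<phi>" "x \<in> carrier M" "y \<in> carrier M"
  shows "\<phi> (x \<ominus>\<^bsub>M\<^esub> y) = \<phi> x \<ominus>\<^bsub>N\<^esub> \<phi> y"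
proof -
  interpret M: module R M by fact
  have "\<phi> (x \<oplus>\<^bsub>M\<^esub> \<ominus>\<^bsub>M\<^esub> y) = \<phi> x \<oplus>\<^bsub>N\<^esub> \<phi> (\<ominus>\<^bsub>M\<^esub> y)"
    using assms(3-5) M.M.a_inv_closed unfolding linear_map_def by blast
  then show ?thesis using linear_map_minus[OF assms(1-3,5)] by (simp add: a_minus_def)
qed

context exterior
begin

text \<open>The defining relations express multilinearity and alternation on tuples. This form
  serves both the well-definedness of the wedge product and the construction of maps out of exterior
  powers.\<close>

lemma ext_relations_vanish:
  assumes N: "Module.module R N" and \<psi>: "linear_map R (FT k) N \<psi>"
    and add: "\<And>xs i x y. \<lbrakk>xs \<in> T k; i < length xs; x \<in> carrier M; y \<in> carrier M\<rbrakk> \<Longrightarrow>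
      \<psi> (free_gen R (xs[i := x \<oplus>\<^bsub>M\<^esub> y])) = \<psi> (free_gen R (xs[i := x])) \<oplus>\<^bsub>N\<^esub> \<psi> (free_gen R (xs[i := y]))"
    and smult: "\<And>xs i a x. \<lbrakk>xs \<in> T k; i < length xs; a \<in> carrier R; x \<in> carrier M\<rbrakk> \<Longrightarrow>
      \<psi> (free_gen R (xs[i := a \<odot>\<^bsub>M\<^esub> x])) = a \<odot>\<^bsub>N\<^esub> \<psi> (free_gen R (xs[i := x]))"
    and alt: "\<And>xs i j. \<lbrakk>xs \<in> T k; i < j; j < length xs; xs ! i = xs ! j\<rbrakk> \<Longrightarrow> \<psi> (free_gen R xs) = \<zero>\<^bsub>N\<^esub>"
    and r: "r \<in> ext_relations R M k"
  shows "\<psi> r = \<zero>\<^bsub>N\<^esub>"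
proof -
  interpret N: module R N by fact
  have \<psi>c: "\<psi> p \<in> carrier N" if "p \<in> carrier (FT k)" for p using \<psi> that unfolding linear_map_def by auto
  have \<psi>a: "\<psi> (p \<oplus>\<^bsub>FT k\<^esub> q) = \<psi> p \<oplus>\<^bsub>N\<^esub> \<psi> q" if "p \<in> carrier (FT k)" "q \<in> carrier (FT k)" for p q
    using \<psi> that unfolding linear_map_def by auto
  have \<psi>s: "\<psi> (a \<odot>\<^bsub>FT k\<^esub> p) = a \<odot>\<^bsub>N\<^esub> \<psi> p" if "p \<in> carrier (FT k)" "a \<in> carrier R" for a p
    using \<psi> that unfolding linear_map_def by auto
  note \<psi>m = linear_map_diff[OF module_free N \<psi>]
  have u: "free_gen R (xs[i := x]) \<in> carrier (FT k)" if "xs \<in> T k" "x \<in> carrier M" for xs i x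
    using that by (intro free_gen_closed tuples_update)
  consider (A) xs i x y where "xs \<in> T k" "i < length xs" "x \<in> carrier M" "y \<in> carrier M"
      "r = free_gen R (xs[i := x \<oplus>\<^bsub>M\<^esub> y]) \<ominus>\<^bsub>FT k\<^esub> (free_gen R (xs[i := x]) \<oplus>\<^bsub>FT k\<^esub> free_gen R (xs[i := y]))"
    | (B) xs i a x where "xs \<in> T k" "i < length xs" "a \<in> carrier R" "x \<in> carrier M"
      "r = free_gen R (xs[i := a \<odot>\<^bsub>M\<^esub> x]) \<ominus>\<^bsub>FT k\<^esub> a \<odot>\<^bsub>FT k\<^esub> free_gen R (xs[i := x])"
    | (C) xs i j where "xs \<in> T k" "i < j" "j < length xs" "xs ! i = xs ! j" "r = free_gen R xs"
    using r unfolding ext_relations_def Let_def by blast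
  then show ?thesis
  proof cases
    case A
    note * = u[OF A(1) M.a_closed[OF A(3,4)], of i] u[OF A(1,3), of i] u[OF A(1,4), of i]
    have "\<psi> r = \<psi> (free_gen R (xs[i := x \<oplus>\<^bsub>M\<^esub> y])) \<ominus>\<^bsub>N\<^esub> (\<psi> (free_gen R (xs[i := x])) \<oplus>\<^bsub>N\<^esub> \<psi> (free_gen R (xs[i := y])))"
      unfolding A(5) using * by (simp add: \<psi>m \<psi>a E.Fm.M.a_closed)
    then show ?thesis using \<psi>c[OF *(2)] \<psi>c[OF *(3)] by (simp add: add[OF A(1-4)] a_minus_def N.M.r_neg)
  next
    case B
    note * = u[OF B(1) smult_closed[OF B(3,4)], of i] u[OF B(1,4), of i]
    have "\<psi> r = \<psi> (free_gen R (xs[i := a \<odot>\<^bsub>M\<^esub> x])) \<ominus>\<^bsub>N\<^esub> a \<odot>\<^bsub>N\<^esub> \<psi> (free_gen R (xs[i := x]))"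
      unfolding B(5) using * B(3) by (simp add: \<psi>m \<psi>s E.Fm.smult_closed)
    then show ?thesis using \<psi>c[OF *(2)] B(3) by (simp add: smult[OF B(1-4)] a_minus_def N.M.r_neg)
  next
    case C
    show ?thesis unfolding C(5) by (rule alt[OF C(1-4)])
  qed
qed

lemma free_val: "p \<in> carrier (FT k) \<Longrightarrow> p xs \<in> carrier R"
  by (auto simp: free_module_simps)

lemma free_support: "p \<in> carrier (FT k) \<Longrightarrow> xs \<notin> T k \<Longrightarrow> p xs = \<zero>\<^bsub>R\<^esub>"
  by (auto simp: free_module_simps)

lemma concat_mult_closed:
  assumes "p \<in> carrier (FT k)" "q \<in> carrier (FT l)"
  shows "concat_mult R k p q \<in> carrier (FT (k + l))"
proof -
  let ?S = "{zs. concat_mult R k p q zs \<noteq> \<zero>\<^bsub>R\<^esub>}"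
  note v = free_val[OF assms(1)] free_val[OF assms(2)]
  \<comment> \<open>A tuple with nonzero coefficient splits into supporting tuples of both factors,
    so the support is contained in the image of a finite product under concatenation.\<close>
  have S: "\<exists>xs ys. zs = xs @ ys \<and> p xs \<noteq> \<zero>\<^bsub>R\<^esub> \<and> q ys \<noteq> \<zero>\<^bsub>R\<^esub>" if zs: "zs \<in> ?S" for zs
  proof (intro exI conjI)
    show "zs = take (nat k) zs @ drop (nat k) zs" by simp
    show "p (take (nat k) zs) \<noteq> \<zero>\<^bsub>R\<^esub>" "q (drop (nat k) zs) \<noteq> \<zero>\<^bsub>R\<^esub>"
      using zs v by (auto simp: concat_mult_def)
  qed
  have "?S \<subseteq> (\<lambda>(xs, ys). xs @ ys) ` ({xs. p xs \<noteq> \<zero>\<^bsub>R\<^esub>} \<times> {ys. q ys \<noteq> \<zero>\<^bsub>R\<^esub>})"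
    using S by fast
  moreover have "finite {xs. p xs \<noteq> \<zero>\<^bsub>R\<^esub>}" "finite {ys. q ys \<noteq> \<zero>\<^bsub>R\<^esub>}"
    using assms by (simp_all add: free_module_simps)
  ultimately have "finite ?S" by (meson finite_SigmaI finite_imageI finite_subset)
  moreover have "?S \<subseteq> T (k + l)"
  proof
    fix zs assume "zs \<in> ?S"
    from S[OF this] obtain xs ys where *: "zs = xs @ ys" "p xs \<noteq> \<zero>\<^bsub>R\<^esub>" "q ys \<noteq> \<zero>\<^bsub>R\<^esub>" by blast
    then have "xs \<in> T k" "ys \<in> T l" using free_support assms by blast+
    then show "zs \<in> T (k + l)" using *(1) by (auto simp: tuples_def)
  qed
  moreover have "range (concat_mult R k p q) \<subseteq> carrier R"
    using v by (auto simp: concat_mult_def)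
  ultimately show ?thesis by (simp add: free_module_simps)
qed

lemma concat_mult_linear_left:
  assumes q: "q \<in> carrier (FT l)"
  shows "linear_map R (FT k) (FT (k + l)) (\<lambda>p. concat_mult R k p q)"
  unfolding linear_map_def
  using q free_val concat_mult_closed
  by (auto simp: concat_mult_def free_module_simps(2,3) fun_eq_iff R.l_distr R.m_assoc)

lemma concat_mult_linear_right:
  assumes p: "p \<in> carrier (FT k)"
  shows "linear_map R (FT l) (FT (k + l)) (concat_mult R k p)"
  unfolding linear_map_def
  using p free_val concat_mult_closed
  by (auto simp: concat_mult_def free_module_simps(2,3) fun_eq_iff R.r_distr R.m_lcomm)

lemma concat_mult_gen:
  assumes "xs \<in> T k"
  shows "concat_mult R k (free_gen R xs) (free_gen R ys) = free_gen R (xs @ ys)"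
proof
  fix zs
  have k: "nat k = length xs" using assms by (auto simp: tuples_def)
  have "zs = xs @ ys \<longleftrightarrow> take (nat k) zs = xs \<and> drop (nat k) zs = ys"
    by (metis append_eq_conv_conj append_take_drop_id k)
  then show "concat_mult R k (free_gen R xs) (free_gen R ys) zs = free_gen R (xs @ ys) zs"
    by (auto simp: concat_mult_def free_gen_def)
qed

lemma linear_map_comp:
  "linear_map R A B \<phi> \<Longrightarrow> linear_map R B C \<psi> \<Longrightarrow> linear_map R A C (\<lambda>x. \<psi> (\<phi> x))"
  unfolding linear_map_def by (auto simp: Pi_iff)

lemmas cl_concat_linear_left = linear_map_comp[OF concat_mult_linear_left cl_linear]
lemmas cl_concat_linear_right = linear_map_comp[OF concat_mult_linear_right cl_linear]

lemma tuples_append: "xs \<in> T k \<Longrightarrow> ys \<in> T l \<Longrightarrow> xs @ ys \<in> T (k + l)"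
  by (auto simp: tuples_def)

lemma linear_map_kernel:
  assumes "linear_map R (FT k) (L l) \<phi>" "\<And>xs. xs \<in> T k \<Longrightarrow> \<phi> (free_gen R xs) = \<zero>\<^bsub>L l\<^esub>" "p \<in> carrier (FT k)"
  shows "\<phi> p = \<zero>\<^bsub>L l\<^esub>"
  using assms(3)
proof (induction rule: free_module_induct)
  case zero
  show ?case by (rule linear_map_zero[OF module_free module_L assms(1)])
next
  case (add p q)
  then show ?case using assms(1) unfolding linear_map_def by simp
next
  case (smult_gen a xs)
  then show ?case using assms(1,2) free_gen_closed[of xs "T k"] unfolding linear_map_def by simp
qed

text \<open>By linearity in \<open>q\<close> it suffices to append a fixed tuple \<open>ys\<close>,
  and a relation with \<open>ys\<close> appended is again a relation of the same kind, at the same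
  positions.\<close>

lemma cl_concat_relation_left:
  assumes p: "p \<in> E.N k" and q: "q \<in> carrier (FT l)"
  shows "cl (k + l) (concat_mult R k p q) = \<zero>\<^bsub>L (k + l)\<^esub>"
proof -
  have *: "cl (k + l) (concat_mult R k r q) = \<zero>\<^bsub>L (k + l)\<^esub>" if r: "r \<in> ext_relations R M k" for r
  proof (rule linear_map_kernel[OF cl_concat_linear_right _ q])
    show "r \<in> carrier (FT k)" using r ext_relations_closed by auto
    fix ys assume ys: "ys \<in> T l"
    show "cl (k + l) (concat_mult R k r (free_gen R ys)) = \<zero>\<^bsub>L (k + l)\<^esub>"
    proof (rule ext_relations_vanish[OF module_L cl_concat_linear_left[OF free_gen_closed[OF ys]] _ _ _ r])
      fix xs i x y assume *: "xs \<in> T k" "i < length xs" "x \<in> carrier M" "y \<in> carrier M"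
      show "cl (k + l) (concat_mult R k (free_gen R (xs[i := x \<oplus>\<^bsub>M\<^esub> y])) (free_gen R ys)) =
        cl (k + l) (concat_mult R k (free_gen R (xs[i := x])) (free_gen R ys)) \<oplus>\<^bsub>L (k + l)\<^esub>
        cl (k + l) (concat_mult R k (free_gen R (xs[i := y])) (free_gen R ys))"
        using gen_add_update[OF tuples_append[OF *(1) ys], of i x y] *
        by (simp add: concat_mult_gen tuples_update list_update_append1)
    next
      fix xs i a x assume *: "xs \<in> T k" "i < length xs" "a \<in> carrier R" "x \<in> carrier M"
      show "cl (k + l) (concat_mult R k (free_gen R (xs[i := a \<odot>\<^bsub>M\<^esub> x])) (free_gen R ys)) =
        a \<odot>\<^bsub>L (k + l)\<^esub> cl (k + l) (concat_mult R k (free_gen R (xs[i := x])) (free_gen R ys))"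
        using gen_smult_update[OF tuples_append[OF *(1) ys], of i a x] *
        by (simp add: concat_mult_gen tuples_update list_update_append1)
    next
      fix xs i j assume *: "xs \<in> T k" "i < j" "j < length xs" "xs ! i = xs ! j"
      show "cl (k + l) (concat_mult R k (free_gen R xs) (free_gen R ys)) = \<zero>\<^bsub>L (k + l)\<^esub>"
        using gen_repeated[OF tuples_append[OF *(1) ys], of i j] *
        by (simp add: concat_mult_gen nth_append)
    qed
  qed
  have "cl (k + l) (concat_mult R k p q) \<in> {\<zero>\<^bsub>L (k + l)\<^esub>}"
    using * by (intro E.linear_map_generated[OF module_L cl_concat_linear_left[OF q] submodule_zero[OF module_L] _ p]) simp
  then show ?thesis by simp
qed

text \<open>Mirror image of the left factor: position \<open>i\<close> of the right factor becomes
  \<open>length ys + i\<close> in the concatenation.\<close>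

lemma cl_concat_relation_right:
  assumes p: "p \<in> carrier (FT k)" and q: "q \<in> E.N l"
  shows "cl (k + l) (concat_mult R k p q) = \<zero>\<^bsub>L (k + l)\<^esub>"
proof -
  have *: "cl (k + l) (concat_mult R k p r) = \<zero>\<^bsub>L (k + l)\<^esub>" if r: "r \<in> ext_relations R M l" for r
  proof (rule linear_map_kernel[OF cl_concat_linear_left _ p])
    show "r \<in> carrier (FT l)" using r ext_relations_closed by auto
    fix ys assume ys: "ys \<in> T k"
    show "cl (k + l) (concat_mult R k (free_gen R ys) r) = \<zero>\<^bsub>L (k + l)\<^esub>"
    proof (rule ext_relations_vanish[OF module_L cl_concat_linear_right[OF free_gen_closed[OF ys]] _ _ _ r])
      fix xs i x y assume *: "xs \<in> T l" "i < length xs" "x \<in> carrier M" "y \<in> carrier M"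
      show "cl (k + l) (concat_mult R k (free_gen R ys) (free_gen R (xs[i := x \<oplus>\<^bsub>M\<^esub> y]))) =
        cl (k + l) (concat_mult R k (free_gen R ys) (free_gen R (xs[i := x]))) \<oplus>\<^bsub>L (k + l)\<^esub>
        cl (k + l) (concat_mult R k (free_gen R ys) (free_gen R (xs[i := y])))"
        using gen_add_update[OF tuples_append[OF ys *(1)], of "length ys + i" x y] *
        by (simp add: concat_mult_gen[OF ys] list_update_append)
    next
      fix xs i a x assume *: "xs \<in> T l" "i < length xs" "a \<in> carrier R" "x \<in> carrier M"
      show "cl (k + l) (concat_mult R k (free_gen R ys) (free_gen R (xs[i := a \<odot>\<^bsub>M\<^esub> x]))) =
        a \<odot>\<^bsub>L (k + l)\<^esub> cl (k + l) (concat_mult R k (free_gen R ys) (free_gen R (xs[i := x])))"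
        using gen_smult_update[OF tuples_append[OF ys *(1)], of "length ys + i" a x] *
        by (simp add: concat_mult_gen[OF ys] list_update_append)
    next
      fix xs i j assume *: "xs \<in> T l" "i < j" "j < length xs" "xs ! i = xs ! j"
      show "cl (k + l) (concat_mult R k (free_gen R ys) (free_gen R xs)) = \<zero>\<^bsub>L (k + l)\<^esub>"
        using gen_repeated[OF tuples_append[OF ys *(1)], of "length ys + i" "length ys + j"] *
        by (simp add: concat_mult_gen[OF ys] nth_append)
    qed
  qed
  have "cl (k + l) (concat_mult R k p q) \<in> {\<zero>\<^bsub>L (k + l)\<^esub>}"
    using * by (intro E.linear_map_generated[OF module_L cl_concat_linear_right[OF p] submodule_zero[OF module_L] _ q]) simp
  then show ?thesis by simp
qed

lemma cl_memD:
  assumes "p' \<in> cl k p" "p \<in> carrier (FT k)"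
  obtains n where "n \<in> E.N k" "n \<in> carrier (FT k)" "p' = n \<oplus>\<^bsub>FT k\<^esub> p"
  using assms E.Qt.N_sub[of k] unfolding cl_eq presented_class_def E.Qt.coset_eq by blast

text \<open>\<open>ext_wedge\<close> is a union over all representatives. Changing a representative
  adds an element of the relation submodule, which the two preceding vanishing results remove, so
  all members of the union coincide.\<close>

lemma wedge_cl:
  assumes p: "p \<in> carrier (FT k)" and q: "q \<in> carrier (FT l)"
  shows "W k l (cl k p) (cl l q) = cl (k + l) (concat_mult R k p q)"
proof -
  have eq: "cl (k + l) (concat_mult R k p' q') = cl (k + l) (concat_mult R k p q)"
    if p': "p' \<in> cl k p" and q': "q' \<in> cl l q" for p' q'
  proof -
    obtain n where n: "n \<in> E.N k" "n \<in> carrier (FT k)" "p' = n \<oplus>\<^bsub>FT k\<^esub> p" using cl_memD[OF p' p] .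
    obtain m where m: "m \<in> E.N l" "m \<in> carrier (FT l)" "q' = m \<oplus>\<^bsub>FT l\<^esub> q" using cl_memD[OF q' q] .
    have q'c: "q' \<in> carrier (FT l)" using m q by simp
    have "cl (k + l) (concat_mult R k p' q') =
        cl (k + l) (concat_mult R k n q') \<oplus>\<^bsub>L (k + l)\<^esub> cl (k + l) (concat_mult R k p q')"
      using cl_concat_linear_left[OF q'c] n(2) p unfolding n(3) linear_map_def by blast
    also have "\<dots> = cl (k + l) (concat_mult R k p q')"
      using cl_concat_relation_left[OF n(1) q'c] p q'c by (simp add: concat_mult_closed)
    also have "\<dots> = cl (k + l) (concat_mult R k p m) \<oplus>\<^bsub>L (k + l)\<^esub> cl (k + l) (concat_mult R k p q)"
      using cl_concat_linear_right[OF p] m(2) q unfolding m(3) linear_map_def by blast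
    also have "\<dots> = cl (k + l) (concat_mult R k p q)"
      using cl_concat_relation_right[OF p m(1)] p q by (simp add: concat_mult_closed)
    finally show ?thesis .
  qed
  \<comment> \<open>The cosets are nonempty; otherwise the union would be empty instead of the
    common class.\<close>
  have "p \<in> cl k p" "q \<in> cl l q"
    using E.Qt.coset_self p q by (auto simp: cl_eq presented_class_def)
  then show ?thesis unfolding ext_wedge_def using eq by blast
qed

lemma W_closed [simp]: "x \<in> carrier (L k) \<Longrightarrow> y \<in> carrier (L l) \<Longrightarrow> W k l x y \<in> carrier (L (k + l))"
  by (auto simp: L_carrier wedge_cl intro: concat_mult_closed)

lemma W_linear_left:
  assumes "y \<in> carrier (L l)" shows "linear_map R (L k) (L (k + l)) (\<lambda>x. W k l x y)"
proof -
  obtain q where q: "q \<in> carrier (FT l)" "y = cl l q" using assms by (auto simp: L_carrier)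
  note lin = cl_concat_linear_left[OF q(1), of k, unfolded linear_map_def]
  show ?thesis unfolding linear_map_def
  proof (intro conjI ballI)
    show "(\<lambda>x. W k l x y) \<in> carrier (L k) \<rightarrow> carrier (L (k + l))" using assms by simp
    fix x assume "x \<in> carrier (L k)"
    then obtain p where p: "p \<in> carrier (FT k)" "x = cl k p" by (auto simp: L_carrier)
    show "W k l (x \<oplus>\<^bsub>L k\<^esub> x') y = W k l x y \<oplus>\<^bsub>L (k + l)\<^esub> W k l x' y" if x': "x' \<in> carrier (L k)" for x'
    proof -
      obtain p' where p': "p' \<in> carrier (FT k)" "x' = cl k p'" using x' by (auto simp: L_carrier)
      then show ?thesis using p q lin by (simp add: cl_add[symmetric] wedge_cl)
    qed
  next
    fix a x assume a: "a \<in> carrier R" and "x \<in> carrier (L k)"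
    then obtain p where p: "p \<in> carrier (FT k)" "x = cl k p" by (auto simp: L_carrier)
    then show "W k l (a \<odot>\<^bsub>L k\<^esub> x) y = a \<odot>\<^bsub>L (k + l)\<^esub> W k l x y"
      using a q lin by (simp add: cl_smult[symmetric] wedge_cl)
  qed
qed

lemma W_linear_right:
  assumes "x \<in> carrier (L k)" shows "linear_map R (L l) (L (k + l)) (W k l x)"
proof -
  obtain p where p: "p \<in> carrier (FT k)" "x = cl k p" using assms by (auto simp: L_carrier)
  note lin = cl_concat_linear_right[OF p(1), of l, unfolded linear_map_def]
  show ?thesis unfolding linear_map_def
  proof (intro conjI ballI)
    show "W k l x \<in> carrier (L l) \<rightarrow> carrier (L (k + l))" using assms by simp
    fix y assume "y \<in> carrier (L l)"
    then obtain q where q: "q \<in> carrier (FT l)" "y = cl l q" by (auto simp: L_carrier)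
    show "W k l x (y \<oplus>\<^bsub>L l\<^esub> y') = W k l x y \<oplus>\<^bsub>L (k + l)\<^esub> W k l x y'" if y': "y' \<in> carrier (L l)" for y'
    proof -
      obtain q' where q': "q' \<in> carrier (FT l)" "y' = cl l q'" using y' by (auto simp: L_carrier)
      then show ?thesis using p q lin by (simp add: cl_add[symmetric] wedge_cl)
    qed
  next
    fix a y assume a: "a \<in> carrier R" and "y \<in> carrier (L l)"
    then obtain q where q: "q \<in> carrier (FT l)" "y = cl l q" by (auto simp: L_carrier)
    then show "W k l x (a \<odot>\<^bsub>L l\<^esub> y) = a \<odot>\<^bsub>L (k + l)\<^esub> W k l x y"
      using a p lin by (simp add: cl_smult[symmetric] wedge_cl)
  qed
qed

lemma W_add_left: "\<lbrakk>x \<in> carrier (L k); x' \<in> carrier (L k); y \<in> carrier (L l)\<rbrakk> \<Longrightarrow>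
    W k l (x \<oplus>\<^bsub>L k\<^esub> x') y = W k l x y \<oplus>\<^bsub>L (k + l)\<^esub> W k l x' y"
  and W_smult_left: "\<lbrakk>a \<in> carrier R; x \<in> carrier (L k); y \<in> carrier (L l)\<rbrakk> \<Longrightarrow>
    W k l (a \<odot>\<^bsub>L k\<^esub> x) y = a \<odot>\<^bsub>L (k + l)\<^esub> W k l x y"
  using W_linear_left[of y l k] unfolding linear_map_def by auto

lemma W_add_right: "\<lbrakk>x \<in> carrier (L k); y \<in> carrier (L l); y' \<in> carrier (L l)\<rbrakk> \<Longrightarrow>
    W k l x (y \<oplus>\<^bsub>L l\<^esub> y') = W k l x y \<oplus>\<^bsub>L (k + l)\<^esub> W k l x y'"
  and W_smult_right: "\<lbrakk>a \<in> carrier R; x \<in> carrier (L k); y \<in> carrier (L l)\<rbrakk> \<Longrightarrow>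
    W k l x (a \<odot>\<^bsub>L l\<^esub> y) = a \<odot>\<^bsub>L (k + l)\<^esub> W k l x y"
  using W_linear_right[of x k l] unfolding linear_map_def by auto

lemma W_zero_left [simp]: "y \<in> carrier (L l) \<Longrightarrow> W k l \<zero>\<^bsub>L k\<^esub> y = \<zero>\<^bsub>L (k + l)\<^esub>"
  using linear_map_zero[OF module_L module_L W_linear_left] .

lemma W_zero_right [simp]: "x \<in> carrier (L k) \<Longrightarrow> W k l x \<zero>\<^bsub>L l\<^esub> = \<zero>\<^bsub>L (k + l)\<^esub>"
  using linear_map_zero[OF module_L module_L W_linear_right] .

lemma W_uminus_left: "x \<in> carrier (L k) \<Longrightarrow> y \<in> carrier (L l) \<Longrightarrow> W k l (\<ominus>\<^bsub>L k\<^esub> x) y = \<ominus>\<^bsub>L (k + l)\<^esub> W k l x y"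
  using linear_map_minus[OF module_L module_L W_linear_left] .

lemma W_uminus_right: "x \<in> carrier (L k) \<Longrightarrow> y \<in> carrier (L l) \<Longrightarrow> W k l x (\<ominus>\<^bsub>L l\<^esub> y) = \<ominus>\<^bsub>L (k + l)\<^esub> W k l x y"
  using linear_map_minus[OF module_L module_L W_linear_right] .

lemmas W_bilinear = W_add_left W_add_right W_smult_left W_smult_right W_uminus_left W_uminus_right

lemma W_gen: "xs \<in> T k \<Longrightarrow> ys \<in> T l \<Longrightarrow> W k l (gen k xs) (gen l ys) = gen (k + l) (xs @ ys)"
  by (simp add: wedge_cl free_gen_closed concat_mult_gen)

lemma W_assoc:
  assumes "x \<in> carrier (L k)" "y \<in> carrier (L l)" "z \<in> carrier (L m)"
  shows "W (k + l) m (W k l x y) z = W k (l + m) x (W l m y z)"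
proof -
  obtain p q r where *: "p \<in> carrier (FT k)" "x = cl k p" "q \<in> carrier (FT l)" "y = cl l q"
    "r \<in> carrier (FT m)" "z = cl m r" using assms by (auto simp: L_carrier)
  have "concat_mult R (k + l) (concat_mult R k p q) r zs = concat_mult R k p (concat_mult R l q r) zs" for zs
  \<comment> \<open>Concatenation is associative already for representatives, provided
    \<open>nat (k + l)\<close> is \<open>nat k + nat l\<close>. In a negative degree this can fail,
    but there \<open>p\<close> or \<open>q\<close> has no tuples to live on and is zero.\<close>
  proof (cases "k < 0 \<or> l < 0")
    case True
    then have "p = (\<lambda>_. \<zero>\<^bsub>R\<^esub>) \<or> q = (\<lambda>_. \<zero>\<^bsub>R\<^esub>)"
      using free_support[OF *(1)] free_support[OF *(3)] by (auto simp: tuples_def fun_eq_iff)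
    then show ?thesis
      using free_val[OF *(1)] free_val[OF *(3)] free_val[OF *(5)] by (auto simp: concat_mult_def)
  next
    case False
    then show ?thesis
      using free_val[OF *(1)] free_val[OF *(3)] free_val[OF *(5)]
      by (simp add: concat_mult_def nat_add_distrib drop_take min_def R.m_assoc add.commute)
  qed
  then have "concat_mult R (k + l) (concat_mult R k p q) r = concat_mult R k p (concat_mult R l q r)" ..
  then show ?thesis using * by (simp add: wedge_cl concat_mult_closed add.assoc)
qed

lemma nil_tuple [simp]: "[] \<in> T 0" by (simp add: tuples_def)

lemma W_unit_left: "x \<in> carrier (L k) \<Longrightarrow> W 0 k (gen 0 []) x = x"
  by (induction rule: L_induct) (simp_all add: W_bilinear W_gen[of "[]" 0, simplified])

lemma W_unit_right: "x \<in> carrier (L k) \<Longrightarrow> W k 0 x (gen 0 []) = x"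
  by (induction rule: L_induct) (simp_all add: W_bilinear W_gen[of _ _ "[]" 0, simplified])

lemma W_commute:
  assumes x: "x \<in> carrier (L k)" and y: "y \<in> carrier (L l)"
  shows "W k l x y = koszul_sign (k * l) \<odot>\<^bsub>L (k + l)\<^esub> W l k y x"
  using x
proof (induction rule: L_induct)
  case zero
  show ?case using y W_zero_right[of y l k] by (simp add: add.commute[of k l])
next
  case (add x x')
  then show ?case using y W_closed[of y l x k] W_closed[of y l x' k]
    by (simp add: W_bilinear add.commute[of l k] L.smult_r_distr)
next
  case (smult_gen a xs)
  show ?case using y
  proof (induction rule: L_induct)
    case zero
    show ?case using smult_gen W_zero_left[of "a \<odot>\<^bsub>L k\<^esub> gen k xs" k l] by (simp add: add.commute[of k l])
  next
    case (add y y')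
    then show ?case using smult_gen W_closed[of y l "a \<odot>\<^bsub>L k\<^esub> gen k xs" k] W_closed[of y' l "a \<odot>\<^bsub>L k\<^esub> gen k xs" k]
      by (simp add: W_add_left W_add_right add.commute[of l k] L.smult_r_distr)
  next
    case (smult_gen b ys)
    have l: "int (length xs) = k" "int (length ys) = l" 
      using \<open>xs \<in> T k\<close> \<open>ys \<in> T l\<close> by (auto simp: tuples_def)
    have T: "xs @ ys \<in> T (k + l)" "ys @ xs \<in> T (k + l)"
      using \<open>xs \<in> T k\<close> \<open>ys \<in> T l\<close> by (auto simp: tuples_def)
    have "b \<odot>\<^bsub>L (k + l)\<^esub> (a \<odot>\<^bsub>L (k + l)\<^esub> gen (k + l) (xs @ ys)) =
       koszul_sign (k * l) \<odot>\<^bsub>L (k + l)\<^esub> (a \<odot>\<^bsub>L (k + l)\<^esub> (b \<odot>\<^bsub>L (k + l)\<^esub> gen (k + l) (ys @ xs)))"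
      unfolding gen_append_commute[OF T(1)] l
      using T \<open>a \<in> carrier R\<close> \<open>b \<in> carrier R\<close>
      by (simp add: L.smult_assoc1[symmetric] R.m_ac)
    then show ?case using \<open>xs \<in> T k\<close> smult_gen \<open>a \<in> carrier R\<close>
      by (simp add: W_bilinear W_gen add.commute[of l k])
  qed
qed


section \<open>Degrees zero and one, and induction over products of one-forms\<close>

abbreviation incl1 where "incl1 \<equiv> ext_incl1 R M"
abbreviation incl0 where "incl0 \<equiv> ext_incl0 R M"
abbreviation unit where "unit \<equiv> ext_class R M 0 (free_gen R [])"

lemma incl0_closed [simp]: "a \<in> carrier R \<Longrightarrow> incl0 a \<in> carrier (L 0)"
  by (simp add: ext_incl0_def)

lemma incl1_closed [simp]: "x \<in> carrier M \<Longrightarrow> incl1 x \<in> carrier (L 1)"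
  by (simp add: ext_incl1_def tuples_def)

lemma incl1_linear: "linear_map R M (L 1) incl1"
  unfolding linear_map_def
  using gen_add[of "[]" _ "[]" 1] gen_smult[of "[]" _ "[]" 1]
  by (auto simp: ext_incl1_def tuples_def)

lemma incl1_add: "x \<in> carrier M \<Longrightarrow> y \<in> carrier M \<Longrightarrow> incl1 (x \<oplus>\<^bsub>M\<^esub> y) = incl1 x \<oplus>\<^bsub>L 1\<^esub> incl1 y"
  and incl1_smult: "a \<in> carrier R \<Longrightarrow> x \<in> carrier M \<Longrightarrow> incl1 (a \<odot>\<^bsub>M\<^esub> x) = a \<odot>\<^bsub>L 1\<^esub> incl1 x"
  using incl1_linear unfolding linear_map_def by auto

text \<open>Scalars become wedge factors of degree zero, which brings scalar multiplication under
  the graded Leibniz rule.\<close>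

lemma W_incl0: "a \<in> carrier R \<Longrightarrow> x \<in> carrier (L k) \<Longrightarrow> W 0 k (incl0 a) x = a \<odot>\<^bsub>L k\<^esub> x"
  using W_smult_left[of a unit 0 x k] by (simp add: ext_incl0_def W_unit_left)

lemma tuples_Cons: "x \<in> carrier M \<Longrightarrow> xs \<in> T k \<Longrightarrow> x # xs \<in> T (1 + k)"
  by (simp add: tuples_def)

lemma W_incl1_gen: "x \<in> carrier M \<Longrightarrow> xs \<in> T k \<Longrightarrow> W 1 k (incl1 x) (gen k xs) = gen (1 + k) (x # xs)"
  using W_gen[of "[x]" 1 xs k] by (simp add: ext_incl1_def tuples_def)

lemma wedge_list_gen: "set xs \<subseteq> carrier M \<Longrightarrow> wedge_list R M xs = gen (int (length xs)) xs"
  by (induction xs) (auto simp: ext_incl0_def W_incl1_gen tuples_def)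

lemma W_incl1_square:
  assumes "x \<in> carrier M" "\<omega> \<in> carrier (L k)"
  shows "W 1 (1 + k) (incl1 x) (W 1 k (incl1 x) \<omega>) = \<zero>\<^bsub>L (1 + (1 + k))\<^esub>"
proof -
  have "W 1 1 (incl1 x) (incl1 x) = \<zero>\<^bsub>L (1 + 1)\<^esub>"
    using assms gen_repeated[of "[x, x]" "1 + 1" 0 1] W_incl1_gen[of x "[x]" 1]
    by (simp add: tuples_def ext_incl1_def)
  then show ?thesis
    using assms W_assoc[of "incl1 x" 1 "incl1 x" 1 \<omega> k] W_zero_left[of \<omega> k "1 + 1"] by (simp add: add.assoc)
qed

text \<open>Tuples are built by prepending one-forms to the unit. The degree changes along the way,
  so \<open>Q\<close> takes it as an argument, and scalars form a separate case because a
  differential is not \<open>R\<close>-linear.\<close>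

lemma exterior_induct [consumes 1, case_names zero add smult unit wedge]:
  assumes A: "A \<in> carrier (L k)"
    and zero: "\<And>k. Q k \<zero>\<^bsub>L k\<^esub>"
    and add: "\<And>k A B. \<lbrakk>A \<in> carrier (L k); B \<in> carrier (L k); Q k A; Q k B\<rbrakk> \<Longrightarrow> Q k (A \<oplus>\<^bsub>L k\<^esub> B)"
    and smult: "\<And>k a A. \<lbrakk>a \<in> carrier R; A \<in> carrier (L k); Q k A\<rbrakk> \<Longrightarrow> Q k (a \<odot>\<^bsub>L k\<^esub> A)"
    and unit: "Q 0 unit"
    and wedge: "\<And>k x A. \<lbrakk>x \<in> carrier M; A \<in> carrier (L k); Q k A\<rbrakk> \<Longrightarrow> Q (1 + k) (W 1 k (incl1 x) A)"
  shows "Q k A"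
proof -
  have "Q (int (length xs)) (gen (int (length xs)) xs)" if "set xs \<subseteq> carrier M" for xs
    using that
  proof (induction xs)
    case (Cons x xs)
    then have "xs \<in> T (int (length xs))" "x \<in> carrier M" by (auto simp: tuples_def)
    then show ?case using wedge[of x "gen (int (length xs)) xs" "int (length xs)"] Cons by (simp add: W_incl1_gen)
  qed (simp add: unit)
  then have gen: "Q k (gen k xs)" if "xs \<in> T k" for xs k using that by (auto simp: tuples_def)
  show ?thesis using A by (induction rule: L_induct) (auto intro: zero add smult gen)
qed

end

section \<open>Linear maps out of exterior powers\<close>

text \<open>In effect a graded left module over the exterior algebra of \<open>M\<close>, given by
  the action of one-forms, together with a chosen element \<open>u\<close> of degree zero. The map
  constructed from it lets a form act on \<open>u\<close>.\<close>

locale alternating_action = exterior R M for R :: "('c, 'r) ring_scheme" and M :: "('c, 'm) module" +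
  fixes J :: "int \<Rightarrow> ('c, 'j) module" and e :: "int \<Rightarrow> 'm \<Rightarrow> 'j \<Rightarrow> 'j" and u :: 'j
  assumes module_J: "Module.module R (J k)"
    and e_closed: "\<lbrakk>x \<in> carrier M; y \<in> carrier (J k)\<rbrakk> \<Longrightarrow> e k x y \<in> carrier (J (1 + k))"
    and e_add_left: "\<lbrakk>x \<in> carrier M; x' \<in> carrier M; y \<in> carrier (J k)\<rbrakk> \<Longrightarrow>
      e k (x \<oplus>\<^bsub>M\<^esub> x') y = e k x y \<oplus>\<^bsub>J (1 + k)\<^esub> e k x' y"
    and e_add_right: "\<lbrakk>x \<in> carrier M; y \<in> carrier (J k); y' \<in> carrier (J k)\<rbrakk> \<Longrightarrow>
      e k x (y \<oplus>\<^bsub>J k\<^esub> y') = e k x y \<oplus>\<^bsub>J (1 + k)\<^esub> e k x y'"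
    and e_smult_left: "\<lbrakk>a \<in> carrier R; x \<in> carrier M; y \<in> carrier (J k)\<rbrakk> \<Longrightarrow>
      e k (a \<odot>\<^bsub>M\<^esub> x) y = a \<odot>\<^bsub>J (1 + k)\<^esub> e k x y"
    and e_smult_right: "\<lbrakk>a \<in> carrier R; x \<in> carrier M; y \<in> carrier (J k)\<rbrakk> \<Longrightarrow>
      e k x (a \<odot>\<^bsub>J k\<^esub> y) = a \<odot>\<^bsub>J (1 + k)\<^esub> e k x y"
    and e_square: "\<lbrakk>x \<in> carrier M; y \<in> carrier (J k)\<rbrakk> \<Longrightarrow> e (1 + k) x (e k x y) = \<zero>\<^bsub>J (1 + (1 + k))\<^esub>"
    and u: "u \<in> carrier (J 0)"
begin

sublocale J: module R "J k" for k by (rule module_J)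

primrec act where
  "act [] = u"
| "act (x # xs) = e (int (length xs)) x (act xs)"

lemma act_closed: "set xs \<subseteq> carrier M \<Longrightarrow> act xs \<in> carrier (J (int (length xs)))"
  by (induction xs) (auto simp: u e_closed)

lemma e_zero: "x \<in> carrier M \<Longrightarrow> e k x \<zero>\<^bsub>J k\<^esub> = \<zero>\<^bsub>J (1 + k)\<^esub>"
  using e_smult_right[of "\<zero>\<^bsub>R\<^esub>" x "\<zero>\<^bsub>J k\<^esub>" k] e_closed[of x "\<zero>\<^bsub>J k\<^esub>" k] by simp

text \<open>Polarization of \<open>e_square\<close>, as for adjacent entries of a tuple.\<close>

lemma e_anticommute:
  assumes x: "x \<in> carrier M" "x' \<in> carrier M" and y: "y \<in> carrier (J k)"
  shows "e (1 + k) x (e k x' y) = \<ominus>\<^bsub>J (1 + (1 + k))\<^esub> e (1 + k) x' (e k x y)"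
proof -
  have c: "e (1 + k) x (e k x' y) \<in> carrier (J (1 + (1 + k)))" "e (1 + k) x' (e k x y) \<in> carrier (J (1 + (1 + k)))"
    by (intro e_closed x y)+
  have "\<zero>\<^bsub>J (1 + (1 + k))\<^esub> = e (1 + k) (x \<oplus>\<^bsub>M\<^esub> x') (e k (x \<oplus>\<^bsub>M\<^esub> x') y)"
    using x y by (simp add: e_square)
  also have "\<dots> = e (1 + k) x (e k x' y) \<oplus>\<^bsub>J (1 + (1 + k))\<^esub> e (1 + k) x' (e k x y)"
    using x y c e_square[of x y k] e_square[of x' y k]
    by (simp add: e_add_left e_add_right e_closed J.M.a_comm)
  finally show ?thesis using c by (intro J.M.minus_equality[symmetric]) simp_all
qed

text \<open>The operator of \<open>x\<close> anticommutes past the entries of \<open>xs\<close>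
  until it meets its own copy, where the square vanishes.\<close>

lemma e_act_zero: "set xs \<subseteq> carrier M \<Longrightarrow> x \<in> set xs \<Longrightarrow> e (int (length xs)) x (act xs) = \<zero>\<^bsub>J (1 + int (length xs))\<^esub>"
proof (induction xs)
  case (Cons y ys)
  have c: "act ys \<in> carrier (J (int (length ys)))" "x \<in> carrier M" "y \<in> carrier M"
    using Cons.prems by (auto intro: act_closed)
  show ?case
  proof (cases "x = y")
    case True
    then show ?thesis using c by (simp add: e_square)
  next
    case False
    then show ?thesis using Cons c by (simp add: e_anticommute[of x y] e_zero)
  qed
qed simp

lemma act_repeated:
  "set xs \<subseteq> carrier M \<Longrightarrow> \<not> distinct xs \<Longrightarrow> act xs = \<zero>\<^bsub>J (int (length xs))\<^esub>"
  by (induction xs) (auto simp: e_act_zero e_zero)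

lemma set_update_closed: "set xs \<subseteq> carrier M \<Longrightarrow> x \<in> carrier M \<Longrightarrow> set (xs[i := x]) \<subseteq> carrier M"
  using set_update_subset_insert[of xs i x] by auto

lemma act_add: "\<lbrakk>set xs \<subseteq> carrier M; i < length xs; x \<in> carrier M; y \<in> carrier M\<rbrakk> \<Longrightarrow>
  act (xs[i := x \<oplus>\<^bsub>M\<^esub> y]) = act (xs[i := x]) \<oplus>\<^bsub>J (int (length xs))\<^esub> act (xs[i := y])"
proof (induction xs arbitrary: i)
  case (Cons z zs)
  show ?case
  proof (cases i)
    case 0
    then show ?thesis using Cons.prems act_closed[of zs] by (simp add: e_add_left)
  next
    case (Suc j)
    then show ?thesis using Cons.prems Cons.IH[of j]
        act_closed[of "zs[j := x]"] act_closed[of "zs[j := y]"]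
      by (simp add: e_add_right set_update_closed)
  qed
qed simp

lemma act_smult: "\<lbrakk>set xs \<subseteq> carrier M; i < length xs; a \<in> carrier R; x \<in> carrier M\<rbrakk> \<Longrightarrow>
  act (xs[i := a \<odot>\<^bsub>M\<^esub> x]) = a \<odot>\<^bsub>J (int (length xs))\<^esub> act (xs[i := x])"
proof (induction xs arbitrary: i)
  case (Cons z zs)
  show ?case
  proof (cases i)
    case 0
    then show ?thesis using Cons.prems act_closed[of zs] by (simp add: e_smult_left)
  next
    case (Suc j)
    then show ?thesis using Cons.prems Cons.IH[of j] act_closed[of "zs[j := x]"]
      by (simp add: e_smult_right set_update_closed)
  qed
qed simp

lemma act_extends_degree:
  "\<exists>\<phi>. linear_map R (L k) (J k) \<phi> \<and> (\<forall>xs\<in>T k. \<phi> (gen k xs) = act xs)"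
proof -
  have actJ: "act \<in> T k \<rightarrow> carrier (J k)" using act_closed by (auto simp: tuples_def)
  have "\<psi> r = \<zero>\<^bsub>J k\<^esub>"
    if r: "r \<in> ext_relations R M k" and \<psi>: "linear_map R (FT k) (J k) \<psi>" "\<forall>s\<in>T k. \<psi> (free_gen R s) = act s" for r \<psi>
  proof (rule ext_relations_vanish[OF module_J \<psi>(1) _ _ _ r])
    fix xs i j assume *: "xs \<in> T k" "i < j" "j < length xs" "xs ! i = xs ! j"
    then have "\<not> distinct xs" by (auto simp: distinct_conv_nth) (metis less_trans nat_neq_iff)
    with * \<psi>(2) act_repeated[of xs] show "\<psi> (free_gen R xs) = \<zero>\<^bsub>J k\<^esub>" by (auto simp: tuples_def)
  next
    fix xs i x y assume *: "xs \<in> T k" "i < length xs" "x \<in> carrier M" "y \<in> carrier M"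
    then show "\<psi> (free_gen R (xs[i := x \<oplus>\<^bsub>M\<^esub> y])) = \<psi> (free_gen R (xs[i := x])) \<oplus>\<^bsub>J k\<^esub> \<psi> (free_gen R (xs[i := y]))"
      using \<psi>(2) act_add[of xs i x y] by (simp add: tuples_update) (auto simp: tuples_def)
  next
    fix xs i a x assume *: "xs \<in> T k" "i < length xs" "a \<in> carrier R" "x \<in> carrier M"
    then show "\<psi> (free_gen R (xs[i := a \<odot>\<^bsub>M\<^esub> x])) = a \<odot>\<^bsub>J k\<^esub> \<psi> (free_gen R (xs[i := x]))"
      using \<psi>(2) act_smult[of xs i a x] by (simp add: tuples_update) (auto simp: tuples_def)
  qed
  then have "\<exists>!\<phi>. \<phi> \<in> extensional (carrier (E.P k)) \<and> linear_map R (E.P k) (J k) \<phi> \<and>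
      (\<forall>s\<in>T k. \<phi> (E.cl k (free_gen R s)) = act s)"
    by (intro E.universal module_J actJ)
  then show ?thesis unfolding L_eq cl_eq by blast
qed

text \<open>The values on tuples are restated as compatibility with wedging by one-forms, which
  frees the later arguments from lists.\<close>

theorem act_extends:
  "\<exists>\<phi>. (\<forall>k. linear_map R (L k) (J k) (\<phi> k)) \<and> \<phi> 0 unit = u \<and>
    (\<forall>k. \<forall>x\<in>carrier M. \<forall>\<omega>\<in>carrier (L k). \<phi> (1 + k) (W 1 k (incl1 x) \<omega>) = e k x (\<phi> k \<omega>))"
proof -
  obtain \<phi> where lin: "\<And>k. linear_map R (L k) (J k) (\<phi> k)"
    and act: "\<And>k xs. xs \<in> T k \<Longrightarrow> \<phi> k (gen k xs) = act xs"
    using act_extends_degree by metis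
  have \<phi>: "\<omega> \<in> carrier (L k) \<Longrightarrow> \<phi> k \<omega> \<in> carrier (J k)"
    "\<omega> \<in> carrier (L k) \<Longrightarrow> \<omega>' \<in> carrier (L k) \<Longrightarrow> \<phi> k (\<omega> \<oplus>\<^bsub>L k\<^esub> \<omega>') = \<phi> k \<omega> \<oplus>\<^bsub>J k\<^esub> \<phi> k \<omega>'"
    "a \<in> carrier R \<Longrightarrow> \<omega> \<in> carrier (L k) \<Longrightarrow> \<phi> k (a \<odot>\<^bsub>L k\<^esub> \<omega>) = a \<odot>\<^bsub>J k\<^esub> \<phi> k \<omega>" for k \<omega> \<omega>' a
    using lin[of k] unfolding linear_map_def by auto
  have \<phi>0: "\<phi> k \<zero>\<^bsub>L k\<^esub> = \<zero>\<^bsub>J k\<^esub>" for k by (rule linear_map_zero[OF module_L module_J lin])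
  have "\<phi> (1 + k) (W 1 k (incl1 x) \<omega>) = e k x (\<phi> k \<omega>)" if x: "x \<in> carrier M" and \<omega>: "\<omega> \<in> carrier (L k)" for k x \<omega>
    using \<omega>
  proof (induction rule: L_induct)
    case zero
    show ?case using x by (simp add: \<phi>0 e_zero)
  next
    case (add A B)
    then show ?case using x by (simp add: W_add_right \<phi> e_add_right)
  next
    case (smult_gen a xs)
    have k: "k = int (length xs)" using smult_gen by (auto simp: tuples_def)
    show ?case using x smult_gen tuples_Cons[OF x smult_gen(2)] \<phi>(1)[of "gen k xs" k]
      by (simp add: W_smult_right \<phi> e_smult_right act W_incl1_gen) (simp add: k)
  qed
  with lin act[OF nil_tuple] show ?thesis by (intro exI[of _ \<phi>]) auto
qed

end

section \<open>The exterior differential of a derivation\<close>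

text \<open>Degrees such as \<open>1 + (1 + k)\<close> and \<open>2 + k\<close> agree only by
  arithmetic; as a premise, the equation is discharged during simplification.\<close>

lemma (in exterior) W_closed_eq [simp]:
  "x \<in> carrier (L k) \<Longrightarrow> y \<in> carrier (L l) \<Longrightarrow> k + l = m \<Longrightarrow> W k l x y \<in> carrier (L m)"
  using W_closed by blast

lemma (in exterior) L_minus_zero [simp]: "\<ominus>\<^bsub>L k\<^esub> \<zero>\<^bsub>L k\<^esub> = \<zero>\<^bsub>L k\<^esub>"
  by (rule L.M.minus_equality) simp_all

lemma (in exterior) W_one_anticommute:
  assumes "x \<in> carrier (L 1)" "y \<in> carrier (L 1)" "\<omega> \<in> carrier (L k)"
  shows "W 1 (1 + k) x (W 1 k y \<omega>) = \<ominus>\<^bsub>L (2 + k)\<^esub> W 1 (1 + k) y (W 1 k x \<omega>)"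
proof -
  have "W 1 1 x y = \<ominus>\<^bsub>L 2\<^esub> W 1 1 y x"
    using W_commute[OF assms(1,2)] assms by (simp add: koszul_sign_smult)
  then show ?thesis
    using assms W_assoc[of x 1 y 1 \<omega> k] W_assoc[of y 1 x 1 \<omega> k] by (simp add: W_uminus_left)
qed

lemma (in exterior) W_one_two_commute:
  assumes "x \<in> carrier (L 1)" "y \<in> carrier (L 2)" "\<omega> \<in> carrier (L k)"
  shows "W 2 (1 + k) y (W 1 k x \<omega>) = W 1 (2 + k) x (W 2 k y \<omega>)"
  using assms W_commute[OF assms(1,2)] W_assoc[of x 1 y 2 \<omega> k] W_assoc[of y 2 x 1 \<omega> k] by (simp add: koszul_sign_smult)

locale exterior_derivation = exterior R M for R :: "('c, 'r) ring_scheme" and M :: "('c, 'm) module" +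
  fixes d :: "'c \<Rightarrow> 'm"
  assumes d_closed [simp]: "a \<in> carrier R \<Longrightarrow> d a \<in> carrier M"
    and d_add: "\<lbrakk>a \<in> carrier R; b \<in> carrier R\<rbrakk> \<Longrightarrow> d (a \<oplus>\<^bsub>R\<^esub> b) = d a \<oplus>\<^bsub>M\<^esub> d b"
    and d_mult: "\<lbrakk>a \<in> carrier R; b \<in> carrier R\<rbrakk> \<Longrightarrow> d (a \<otimes>\<^bsub>R\<^esub> b) = a \<odot>\<^bsub>M\<^esub> d b \<oplus>\<^bsub>M\<^esub> b \<odot>\<^bsub>M\<^esub> d a"
begin

lemma d_one: "d \<one>\<^bsub>R\<^esub> = \<zero>\<^bsub>M\<^esub>"
  using d_mult[of "\<one>\<^bsub>R\<^esub>" "\<one>\<^bsub>R\<^esub>"] by simp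

lemma incl1_zero: "incl1 \<zero>\<^bsub>M\<^esub> = \<zero>\<^bsub>L 1\<^esub>"
  by (rule linear_map_zero[OF _ module_L incl1_linear]) (rule module_axioms)

text \<open>
  Pairs \<open>(\<omega>, \<eta>)\<close> with this scalar multiplication behave like \<open>(\<omega>, D \<omega>)\<close> for a derivation \<open>D\<close>
  extending \<open>d\<close>; so the derivations extending \<open>d\<close> become R-linear maps into \<open>jet\<close>.
\<close>
definition jet :: "int \<Rightarrow> ('c, ('m list \<Rightarrow> 'c) set \<times> ('m list \<Rightarrow> 'c) set) module" where
  "jet k = \<lparr>carrier = carrier (L k) \<times> carrier (L (1 + k)), mult = undefined, one = undefined,
     zero = (\<zero>\<^bsub>L k\<^esub>, \<zero>\<^bsub>L (1 + k)\<^esub>),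
     add = (\<lambda>p q. (fst p \<oplus>\<^bsub>L k\<^esub> fst q, snd p \<oplus>\<^bsub>L (1 + k)\<^esub> snd q)),
     smult = (\<lambda>a p. (a \<odot>\<^bsub>L k\<^esub> fst p, a \<odot>\<^bsub>L (1 + k)\<^esub> snd p \<oplus>\<^bsub>L (1 + k)\<^esub> W 1 k (incl1 (d a)) (fst p)))\<rparr>"

lemma jet_simps:
  "carrier (jet k) = carrier (L k) \<times> carrier (L (1 + k))"
  "\<zero>\<^bsub>jet k\<^esub> = (\<zero>\<^bsub>L k\<^esub>, \<zero>\<^bsub>L (1 + k)\<^esub>)"
  "p \<oplus>\<^bsub>jet k\<^esub> q = (fst p \<oplus>\<^bsub>L k\<^esub> fst q, snd p \<oplus>\<^bsub>L (1 + k)\<^esub> snd q)"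
  "a \<odot>\<^bsub>jet k\<^esub> p = (a \<odot>\<^bsub>L k\<^esub> fst p, a \<odot>\<^bsub>L (1 + k)\<^esub> snd p \<oplus>\<^bsub>L (1 + k)\<^esub> W 1 k (incl1 (d a)) (fst p))"
  by (simp_all add: jet_def)

text \<open>The second component of \<open>a (b (\<omega>, \<eta>))\<close> is
  \<open>ab \<eta> + a db \<and> \<omega> + da \<and> b \<omega>\<close>, so associativity of the
  action is the Leibniz rule for \<open>d\<close>. Distributivity over sums of scalars is its
  additivity, and the unit law is \<open>d 1 = 0\<close>.\<close>

lemma module_jet: "Module.module R (jet k)"
proof (rule moduleI)
  show "cring R" by (rule R.is_cring)
  show "abelian_group (jet k)"
  proof (rule abelian_groupI)
    fix p assume "p \<in> carrier (jet k)"
    then show "\<exists>q\<in>carrier (jet k). q \<oplus>\<^bsub>jet k\<^esub> p = \<zero>\<^bsub>jet k\<^esub>"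
      by (intro bexI[of _ "(\<ominus>\<^bsub>L k\<^esub> fst p, \<ominus>\<^bsub>L (1 + k)\<^esub> snd p)"]) (auto simp: jet_simps L.M.l_neg)
  qed (auto simp: jet_simps L.M.a_ac)
qed (auto simp: jet_simps d_one d_add d_mult incl1_zero incl1_add incl1_smult L.smult_r_distr L.smult_l_distr
      L.smult_assoc1 W_bilinear L.M.a_ac)

lemma incl1_d_wedge_swap:
  assumes "a \<in> carrier R" "x \<in> carrier M" "\<omega> \<in> carrier (L k)"
  shows "W 1 (1 + k) (incl1 (d a)) (W 1 k (incl1 x) \<omega>) = \<ominus>\<^bsub>L (2 + k)\<^esub> W 1 (1 + k) (incl1 x) (W 1 k (incl1 (d a)) \<omega>)"
  using assms by (intro W_one_anticommute) simp_all

end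

text \<open>\<open>\<delta>\<close> is the differential on one-forms; its rules are what the Leibniz
  rule and \<open>D (d a) = 0\<close> impose in that degree. Spanning by exact one-forms allows
  statements about \<open>\<delta>\<close> to be checked on the elements \<open>d b\<close>.\<close>

locale exterior_differential = exterior_derivation R M d
  for R :: "('c, 'r) ring_scheme" and M :: "('c, 'm) module" and d +
  fixes \<delta> :: "'m \<Rightarrow> ('m list \<Rightarrow> 'c) set"
  assumes \<delta>_closed [simp]: "x \<in> carrier M \<Longrightarrow> \<delta> x \<in> carrier (L 2)"
    and \<delta>_add: "\<lbrakk>x \<in> carrier M; y \<in> carrier M\<rbrakk> \<Longrightarrow> \<delta> (x \<oplus>\<^bsub>M\<^esub> y) = \<delta> x \<oplus>\<^bsub>L 2\<^esub> \<delta> y"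
    and \<delta>_smult: "\<lbrakk>a \<in> carrier R; x \<in> carrier M\<rbrakk> \<Longrightarrow>
      \<delta> (a \<odot>\<^bsub>M\<^esub> x) = a \<odot>\<^bsub>L 2\<^esub> \<delta> x \<oplus>\<^bsub>L 2\<^esub> W 1 1 (incl1 (d a)) (incl1 x)"
    and \<delta>_d: "a \<in> carrier R \<Longrightarrow> \<delta> (d a) = \<zero>\<^bsub>L 2\<^esub>"
    and span: "carrier M \<subseteq> submodule_generated R M (d ` carrier R)"
begin

text \<open>The Leibniz rule for the product of \<open>x\<close> with a form, with the second
  component of the pair standing for the derivative of the first.\<close>

definition jet_wedge where
  "jet_wedge k x p = (W 1 k (incl1 x) (fst p), W 2 k (\<delta> x) (fst p) \<ominus>\<^bsub>L (2 + k)\<^esub> W 1 (1 + k) (incl1 x) (snd p))"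

text \<open>The second component is \<open>\<delta> x \<and> x \<and> \<omega> - x \<and> \<delta> x
  \<and> \<omega> + x \<and> x \<and> \<eta>\<close>. The two-form \<open>\<delta> x\<close>
  commutes with \<open>x\<close>, so the first two terms cancel; the third contains \<open>x\<close>
  twice.\<close>

lemma jet_wedge_square:
  assumes x: "x \<in> carrier M" and p: "p \<in> carrier (jet k)"
  shows "jet_wedge (1 + k) x (jet_wedge k x p) = \<zero>\<^bsub>jet (1 + (1 + k))\<^esub>"
proof -
  obtain \<omega> \<eta> where p': "p = (\<omega>, \<eta>)" "\<omega> \<in> carrier (L k)" "\<eta> \<in> carrier (L (1 + k))"
    using p by (auto simp: jet_simps)
  have sq: "W 1 (1 + k) (incl1 x) (W 1 k (incl1 x) \<omega>) = \<zero>\<^bsub>L (2 + k)\<^esub>"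
    "W 1 (2 + k) (incl1 x) (W 1 (1 + k) (incl1 x) \<eta>) = \<zero>\<^bsub>L (3 + k)\<^esub>"
    using W_incl1_square[OF x p'(2)] W_incl1_square[OF x p'(3)] by simp_all
  have c: "W 2 (1 + k) (\<delta> x) (W 1 k (incl1 x) \<omega>) = W 1 (2 + k) (incl1 x) (W 2 k (\<delta> x) \<omega>)"
    using x p' by (intro W_one_two_commute) simp_all
  have "W 1 (2 + k) (incl1 x) (W 2 k (\<delta> x) \<omega> \<oplus>\<^bsub>L (2 + k)\<^esub> \<ominus>\<^bsub>L (2 + k)\<^esub> W 1 (1 + k) (incl1 x) \<eta>) =
    W 1 (2 + k) (incl1 x) (W 2 k (\<delta> x) \<omega>) \<oplus>\<^bsub>L (3 + k)\<^esub> \<ominus>\<^bsub>L (3 + k)\<^esub> W 1 (2 + k) (incl1 x) (W 1 (1 + k) (incl1 x) \<eta>)"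
    using x p' by (simp add: W_bilinear)
  then show ?thesis using x p' by (simp add: jet_wedge_def jet_simps sq c a_minus_def L.M.r_neg)
qed

text \<open>The zero in the initial pair encodes \<open>D 1 = 0\<close>.\<close>

sublocale J: alternating_action R M jet jet_wedge "(unit, \<zero>\<^bsub>L 1\<^esub>)"
proof (rule alternating_action.intro[OF exterior_axioms alternating_action_axioms.intro])
  show "Module.module R (jet k)" for k by (rule module_jet)
  show "(unit, \<zero>\<^bsub>L 1\<^esub>) \<in> carrier (jet 0)" by (simp add: jet_simps)
  fix x p k assume x: "x \<in> carrier M" and "p \<in> carrier (jet k)"
  then obtain \<omega> \<eta> where p: "p = (\<omega>, \<eta>)" "\<omega> \<in> carrier (L k)" "\<eta> \<in> carrier (L (1 + k))"
    by (auto simp: jet_simps)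
  show "jet_wedge k x p \<in> carrier (jet (1 + k))"
    using x p by (simp add: jet_simps jet_wedge_def L.M.minus_closed)
  show "jet_wedge k (x \<oplus>\<^bsub>M\<^esub> x') p = jet_wedge k x p \<oplus>\<^bsub>jet (1 + k)\<^esub> jet_wedge k x' p" if "x' \<in> carrier M" for x'
    using x p that
    by (simp add: jet_simps jet_wedge_def a_minus_def incl1_add \<delta>_add W_bilinear L.M.minus_add L.M.a_ac)
  show "jet_wedge k x (p \<oplus>\<^bsub>jet k\<^esub> q) = jet_wedge k x p \<oplus>\<^bsub>jet (1 + k)\<^esub> jet_wedge k x q" if "q \<in> carrier (jet k)" for q
    using x p that
    by (auto simp: jet_simps jet_wedge_def a_minus_def W_bilinear L.M.minus_add L.M.a_ac)
  fix a assume a: "a \<in> carrier R"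
  \<comment> \<open>The extra term \<open>da \<and> x\<close> in \<open>\<delta> (a x)\<close> is
    the twist of the scalar action on \<open>x \<and> \<omega>\<close>.\<close>
  show "jet_wedge k (a \<odot>\<^bsub>M\<^esub> x) p = a \<odot>\<^bsub>jet (1 + k)\<^esub> jet_wedge k x p"
    using a x p W_assoc[of "incl1 (d a)" 1 "incl1 x" 1 \<omega> k]
    by (simp add: jet_simps jet_wedge_def a_minus_def incl1_smult \<delta>_smult W_bilinear
        L.smult_r_distr L.smult_r_minus L.M.a_ac)
  \<comment> \<open>Here the twist arises inside as \<open>- x \<and> da \<and> \<omega>\<close>,
    which equals the required \<open>da \<and> x \<and> \<omega>\<close>.\<close>
  show "jet_wedge k x (a \<odot>\<^bsub>jet k\<^esub> p) = a \<odot>\<^bsub>jet (1 + k)\<^esub> jet_wedge k x p"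
    using a x p
    by (simp add: jet_simps jet_wedge_def a_minus_def W_bilinear incl1_d_wedge_swap[OF a x]
        L.smult_r_distr L.smult_r_minus L.M.minus_add L.M.a_ac)
qed (rule jet_wedge_square)

definition is_differential where
  "is_differential D \<longleftrightarrow> (\<forall>k. \<forall>\<omega>\<in>carrier (L k). D k \<omega> \<in> carrier (L (1 + k))) \<and>
    (\<forall>k. \<forall>\<omega>\<in>carrier (L k). \<forall>\<omega>'\<in>carrier (L k). D k (\<omega> \<oplus>\<^bsub>L k\<^esub> \<omega>') = D k \<omega> \<oplus>\<^bsub>L (1 + k)\<^esub> D k \<omega>') \<and>
    (\<forall>k. \<forall>a\<in>carrier R. \<forall>\<omega>\<in>carrier (L k).
      D k (a \<odot>\<^bsub>L k\<^esub> \<omega>) = a \<odot>\<^bsub>L (1 + k)\<^esub> D k \<omega> \<oplus>\<^bsub>L (1 + k)\<^esub> W 1 k (incl1 (d a)) \<omega>) \<and>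
    D 0 unit = \<zero>\<^bsub>L 1\<^esub> \<and>
    (\<forall>k. \<forall>x\<in>carrier M. \<forall>\<omega>\<in>carrier (L k).
      D (1 + k) (W 1 k (incl1 x) \<omega>) = W 2 k (\<delta> x) \<omega> \<ominus>\<^bsub>L (2 + k)\<^esub> W 1 (1 + k) (incl1 x) (D k \<omega>))"

lemma ex_differential: "\<exists>D. is_differential D"
proof -
  obtain \<phi> where lin: "\<And>k. linear_map R (L k) (jet k) (\<phi> k)" and unit: "\<phi> 0 unit = (unit, \<zero>\<^bsub>L 1\<^esub>)"
    and wedge: "\<And>k x \<omega>. x \<in> carrier M \<Longrightarrow> \<omega> \<in> carrier (L k) \<Longrightarrow> \<phi> (1 + k) (W 1 k (incl1 x) \<omega>) = jet_wedge k x (\<phi> k \<omega>)"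
    using J.act_extends by blast
  have closed: "\<omega> \<in> carrier (L k) \<Longrightarrow> \<phi> k \<omega> \<in> carrier (jet k)"
    and add: "\<omega> \<in> carrier (L k) \<Longrightarrow> \<omega>' \<in> carrier (L k) \<Longrightarrow> \<phi> k (\<omega> \<oplus>\<^bsub>L k\<^esub> \<omega>') = \<phi> k \<omega> \<oplus>\<^bsub>jet k\<^esub> \<phi> k \<omega>'"
    and smult: "a \<in> carrier R \<Longrightarrow> \<omega> \<in> carrier (L k) \<Longrightarrow> \<phi> k (a \<odot>\<^bsub>L k\<^esub> \<omega>) = a \<odot>\<^bsub>jet k\<^esub> \<phi> k \<omega>" for k \<omega> \<omega>' a
    using lin[of k] unfolding linear_map_def by auto
  have zero: "\<phi> k \<zero>\<^bsub>L k\<^esub> = \<zero>\<^bsub>jet k\<^esub>" for k by (rule linear_map_zero[OF module_L module_jet lin])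
  \<comment> \<open>With the identity as first component, the second component of linearity into
    \<open>jet\<close> is the Leibniz rule for scalars, and that of compatibility with
    \<open>jet_wedge\<close> is the Leibniz rule for one-forms.\<close>
  have fst: "fst (\<phi> k \<omega>) = \<omega>" if "\<omega> \<in> carrier (L k)" for k \<omega>
    using that by (induction rule: exterior_induct) (simp_all add: zero add smult unit wedge jet_simps jet_wedge_def)
  show ?thesis
    unfolding is_differential_def
  proof (intro exI[of _ "\<lambda>k \<omega>. snd (\<phi> k \<omega>)"] conjI allI ballI)
    fix k \<omega> assume "\<omega> \<in> carrier (L k)"
    from closed[OF this] show "snd (\<phi> k \<omega>) \<in> carrier (L (1 + k))" by (auto simp: jet_simps)
  qed (simp_all add: fst add smult unit wedge jet_simps jet_wedge_def)
qed

section \<open>Leibniz rule, square zero and uniqueness of the differential\<close>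

definition D where "D = (SOME D. is_differential D)"

lemma is_differential_D: "is_differential D"
  unfolding D_def by (rule someI_ex[OF ex_differential])

lemma D_closed [simp]: "\<omega> \<in> carrier (L k) \<Longrightarrow> D k \<omega> \<in> carrier (L (1 + k))"
  and D_add: "\<lbrakk>\<omega> \<in> carrier (L k); \<omega>' \<in> carrier (L k)\<rbrakk> \<Longrightarrow> D k (\<omega> \<oplus>\<^bsub>L k\<^esub> \<omega>') = D k \<omega> \<oplus>\<^bsub>L (1 + k)\<^esub> D k \<omega>'"
  and D_smult: "\<lbrakk>a \<in> carrier R; \<omega> \<in> carrier (L k)\<rbrakk> \<Longrightarrow>
      D k (a \<odot>\<^bsub>L k\<^esub> \<omega>) = a \<odot>\<^bsub>L (1 + k)\<^esub> D k \<omega> \<oplus>\<^bsub>L (1 + k)\<^esub> W 1 k (incl1 (d a)) \<omega>"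
  and D_unit: "D 0 unit = \<zero>\<^bsub>L 1\<^esub>"
  and D_wedge: "\<lbrakk>x \<in> carrier M; \<omega> \<in> carrier (L k)\<rbrakk> \<Longrightarrow>
      D (1 + k) (W 1 k (incl1 x) \<omega>) = W 2 k (\<delta> x) \<omega> \<ominus>\<^bsub>L (2 + k)\<^esub> W 1 (1 + k) (incl1 x) (D k \<omega>)"
  using is_differential_D unfolding is_differential_def by blast+

lemma D_zero [simp]: "D k \<zero>\<^bsub>L k\<^esub> = \<zero>\<^bsub>L (1 + k)\<^esub>"
  using D_add[of "\<zero>\<^bsub>L k\<^esub>" k "\<zero>\<^bsub>L k\<^esub>"] D_closed[of "\<zero>\<^bsub>L k\<^esub>" k] by simp

lemma D_uminus:
  assumes "\<omega> \<in> carrier (L k)" shows "D k (\<ominus>\<^bsub>L k\<^esub> \<omega>) = \<ominus>\<^bsub>L (1 + k)\<^esub> D k \<omega>"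
proof -
  have "D k (\<ominus>\<^bsub>L k\<^esub> \<omega>) \<oplus>\<^bsub>L (1 + k)\<^esub> D k \<omega> = \<zero>\<^bsub>L (1 + k)\<^esub>"
    using D_add[of "\<ominus>\<^bsub>L k\<^esub> \<omega>" k \<omega>] assms by (simp add: L.M.l_neg)
  then show ?thesis using assms by (intro L.M.minus_equality[symmetric]) simp_all
qed

text \<open>Induction on the left factor alone: the scalar and one-form cases already have their
  Leibniz rules, and each further one-form flips the sign in front of
  \<open>D l \<theta>\<close>.\<close>

lemma D_leibniz:
  assumes \<omega>: "\<omega> \<in> carrier (L k)" and \<theta>: "\<theta> \<in> carrier (L l)"
  shows "D (k + l) (W k l \<omega> \<theta>) = W (1 + k) l (D k \<omega>) \<theta> \<oplus>\<^bsub>L (1 + (k + l))\<^esub>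
    koszul_sign k \<odot>\<^bsub>L (1 + (k + l))\<^esub> W k (1 + l) \<omega> (D l \<theta>)"
  using \<omega>
proof (induction rule: exterior_induct)
  case (zero k)
  then show ?case using \<theta> W_zero_left[of "D l \<theta>" "1 + l" k] by (simp add: add_ac)
next
  case (add k A B)
  then show ?case using \<theta> by (simp add: D_add W_bilinear L.smult_r_distr L.M.a_ac add_ac)
next
  case (smult k a A)
  have "W (1 + k) l (W 1 k (incl1 (d a)) A) \<theta> = W 1 (k + l) (incl1 (d a)) (W k l A \<theta>)"
    using smult \<theta> by (intro W_assoc) simp_all
  then show ?case using smult \<theta>
    by (simp add: D_smult W_bilinear L.smult_r_distr L.M.a_ac L.smult_assoc1[symmetric] R.m_comm add_ac)
next
  case unit
  then show ?case using \<theta> by (simp add: D_unit W_unit_left koszul_sign_def)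
next
  case (wedge k x A)
  \<comment> \<open>Reassociation brings \<open>x\<close> or \<open>\<delta> x\<close> to the front,
    so that \<open>D_wedge\<close> applies to \<open>x\<close> and the product of \<open>A\<close>
    with \<open>\<theta>\<close>.\<close>
  have 1: "W (1 + k) l (W 1 k (incl1 x) A) \<theta> = W 1 (k + l) (incl1 x) (W k l A \<theta>)"
    "W (2 + k) l (W 2 k (\<delta> x) A) \<theta> = W 2 (k + l) (\<delta> x) (W k l A \<theta>)"
    "W (1 + (1 + k)) l (W 1 (1 + k) (incl1 x) (D k A)) \<theta> = W 1 (1 + k + l) (incl1 x) (W (1 + k) l (D k A) \<theta>)"
    "W (1 + k) (1 + l) (W 1 k (incl1 x) A) (D l \<theta>) = W 1 (k + (1 + l)) (incl1 x) (W k (1 + l) A (D l \<theta>))"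
    using wedge \<theta> by (intro W_assoc; simp)+
  show ?case
  proof (cases "even k")
    case True
    then show ?thesis using 1 wedge \<theta> D_wedge[of x "W k l A \<theta>" "k + l"]
      by (simp add: D_wedge W_bilinear a_minus_def koszul_sign_smult L.M.minus_add L.M.a_ac add_ac)
  next
    case False
    then show ?thesis using 1 wedge \<theta> D_wedge[of x "W k l A \<theta>" "k + l"]
      by (simp add: D_wedge W_bilinear a_minus_def koszul_sign_smult L.M.minus_add L.M.a_ac add_ac)
  qed
qed

lemma D_incl1: "x \<in> carrier M \<Longrightarrow> D 1 (incl1 x) = \<delta> x"
  using D_wedge[of x unit 0] by (simp add: W_unit_right D_unit a_minus_def)

lemma D_incl0: "a \<in> carrier R \<Longrightarrow> D 0 (incl0 a) = incl1 (d a)"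
  using D_smult[of a unit 0] by (simp add: ext_incl0_def W_unit_right D_unit)

lemma M_induct [consumes 1, case_names zero add smult d]:
  assumes x: "x \<in> carrier M" and zero: "Q \<zero>\<^bsub>M\<^esub>"
    and add: "\<And>x y. \<lbrakk>x \<in> carrier M; y \<in> carrier M; Q x; Q y\<rbrakk> \<Longrightarrow> Q (x \<oplus>\<^bsub>M\<^esub> y)"
    and smult: "\<And>a x. \<lbrakk>a \<in> carrier R; x \<in> carrier M; Q x\<rbrakk> \<Longrightarrow> Q (a \<odot>\<^bsub>M\<^esub> x)"
    and d: "\<And>b. b \<in> carrier R \<Longrightarrow> Q (d b)"
  shows "Q x"
proof -
  have "submodule {x \<in> carrier M. Q x} R M"
  proof (rule submoduleI)
    fix x assume "x \<in> {x \<in> carrier M. Q x}"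
    then show "\<ominus>\<^bsub>M\<^esub> x \<in> {x \<in> carrier M. Q x}"
      using smult[of "\<ominus>\<^bsub>R\<^esub> \<one>\<^bsub>R\<^esub>" x] by (simp add: smult_l_minus)
  qed (use assms in auto)
  then have "submodule_generated R M (d ` carrier R) \<subseteq> {x \<in> carrier M. Q x}"
    by (rule submodule_generated_least) (auto simp: d)
  then show ?thesis using x span by blast
qed

lemma D_\<delta>: "x \<in> carrier M \<Longrightarrow> D 2 (\<delta> x) = \<zero>\<^bsub>L 3\<^esub>"
proof (induction rule: M_induct)
  case zero
  \<comment> \<open>Zero is the exact form \<open>d 1\<close>.\<close>
  have "\<delta> \<zero>\<^bsub>M\<^esub> = \<zero>\<^bsub>L 2\<^esub>" using \<delta>_d[of "\<one>\<^bsub>R\<^esub>"] by (simp add: d_one)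
  then show ?case using D_zero[of 2] by simp
next
  case (add x y)
  then show ?case by (simp add: \<delta>_add D_add)
next
  case (smult a x)
  \<comment> \<open>As \<open>\<delta> (d a) = 0\<close>, only this term is left; it cancels the
    \<open>da \<and> \<delta> x\<close> produced by applying \<open>D\<close> to
    \<open>a \<delta> x\<close>.\<close>
  have "D 2 (W 1 1 (incl1 (d a)) (incl1 x)) = \<ominus>\<^bsub>L 3\<^esub> W 1 2 (incl1 (d a)) (\<delta> x)"
    using smult D_wedge[of "d a" "incl1 x" 1] by (simp add: \<delta>_d D_incl1 a_minus_def)
  then show ?case using smult by (simp add: \<delta>_smult D_add D_smult L.M.r_neg)
next
  case (d b)
  then show ?case using D_zero[of 2] by (simp add: \<delta>_d)
qed

text \<open>For a scalar, the two terms \<open>da \<and> D A\<close> have opposite signs. For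
  \<open>x \<and> A\<close>, both \<open>D (\<delta> x \<and> A)\<close> and
  \<open>D (x \<and> D A)\<close> equal \<open>\<delta> x \<and> D A\<close>, because
  \<open>D (\<delta> x) = 0\<close> and \<open>D (D A) = 0\<close>, and they are subtracted.\<close>

lemma D_square: "\<omega> \<in> carrier (L k) \<Longrightarrow> D (1 + k) (D k \<omega>) = \<zero>\<^bsub>L (2 + k)\<^esub>"
proof (induction rule: exterior_induct)
  case (zero k)
  then show ?case using D_zero[of "1 + k"] by simp
next
  case (add k A B)
  then show ?case by (simp add: D_add)
next
  case (smult k a A)
  then show ?case using D_wedge[of "d a" A k]
    by (simp add: D_add D_smult \<delta>_d a_minus_def L.M.r_neg)
next
  case unit
  then show ?case using D_zero[of 1] by (simp add: D_unit)
next
  case (wedge k x A)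
  have "D (2 + k) (W 2 k (\<delta> x) A) = W 2 (1 + k) (\<delta> x) (D k A)"
    using wedge D_leibniz[of "\<delta> x" 2 A k] by (simp add: D_\<delta> koszul_sign_smult add_ac)
  moreover have "D (2 + k) (W 1 (1 + k) (incl1 x) (D k A)) = W 2 (1 + k) (\<delta> x) (D k A)"
    using wedge D_wedge[of x "D k A" "1 + k"] by (simp add: a_minus_def)
  ultimately show ?case using wedge
    by (simp add: D_wedge a_minus_def D_add D_uminus L.M.r_neg)
qed

text \<open>Square zero at functions gives \<open>D' (d b) = 0\<close>. As exact forms span the
  one-forms, the Leibniz rule then determines \<open>D'\<close> on one-forms, and after that on all
  their products.\<close>

lemma differential_unique:
  assumes closed: "\<And>k \<omega>. \<omega> \<in> carrier (L k) \<Longrightarrow> D' k \<omega> \<in> carrier (L (1 + k))"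
    and add: "\<And>k \<omega> \<omega>'. \<lbrakk>\<omega> \<in> carrier (L k); \<omega>' \<in> carrier (L k)\<rbrakk> \<Longrightarrow>
      D' k (\<omega> \<oplus>\<^bsub>L k\<^esub> \<omega>') = D' k \<omega> \<oplus>\<^bsub>L (1 + k)\<^esub> D' k \<omega>'"
    and leibniz: "\<And>k l \<omega> \<theta>. \<lbrakk>\<omega> \<in> carrier (L k); \<theta> \<in> carrier (L l)\<rbrakk> \<Longrightarrow>
      D' (k + l) (W k l \<omega> \<theta>) = W (1 + k) l (D' k \<omega>) \<theta> \<oplus>\<^bsub>L (1 + (k + l))\<^esub>
        koszul_sign k \<odot>\<^bsub>L (1 + (k + l))\<^esub> W k (1 + l) \<omega> (D' l \<theta>)"
    and ext: "\<And>a. a \<in> carrier R \<Longrightarrow> D' 0 (incl0 a) = incl1 (d a)"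
    and square: "\<And>a. a \<in> carrier R \<Longrightarrow> D' 1 (D' 0 (incl0 a)) = \<zero>\<^bsub>L 2\<^esub>"
    and \<omega>: "\<omega> \<in> carrier (L k)"
  shows "D' k \<omega> = D k \<omega>"
proof -
  have D'_zero: "D' k \<zero>\<^bsub>L k\<^esub> = \<zero>\<^bsub>L (1 + k)\<^esub>" for k
    using add[of "\<zero>\<^bsub>L k\<^esub>" k "\<zero>\<^bsub>L k\<^esub>"] closed[of "\<zero>\<^bsub>L k\<^esub>" k] by simp
  \<comment> \<open>Leibniz rule for the degree-zero factor \<open>incl0 a\<close>, where the sign
    is trivial.\<close>
  have D'_smult: "D' k (a \<odot>\<^bsub>L k\<^esub> \<omega>) = a \<odot>\<^bsub>L (1 + k)\<^esub> D' k \<omega> \<oplus>\<^bsub>L (1 + k)\<^esub> W 1 k (incl1 (d a)) \<omega>"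
    if "a \<in> carrier R" "\<omega> \<in> carrier (L k)" for a k \<omega>
    using that leibniz[of "incl0 a" 0 \<omega> k] closed[of \<omega> k]
    by (simp add: W_incl0 ext koszul_sign_def L.M.a_comm)
  have \<delta>': "D' 1 (incl1 x) = \<delta> x" if "x \<in> carrier M" for x
    using that
  proof (induction rule: M_induct)
    case zero
    have "\<delta> \<zero>\<^bsub>M\<^esub> = \<zero>\<^bsub>L 2\<^esub>" using \<delta>_d[of "\<one>\<^bsub>R\<^esub>"] by (simp add: d_one)
    then show ?case using D'_zero[of 1] by (simp add: incl1_zero)
  next
    case (add x y)
    then show ?case using assms(2)[of "incl1 x" 1 "incl1 y"] by (simp add: incl1_add \<delta>_add)
  next
    case (smult a x)
    then show ?case
      using D'_smult[of a "incl1 x" 1]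
      by (simp add: incl1_smult \<delta>_smult)
  next
    case (d b)
    then show ?case using square[of b] by (simp add: ext \<delta>_d)
  qed
  show ?thesis using \<omega>
  proof (induction rule: exterior_induct)
    case unit
    \<comment> \<open>The unit is the form of the function 1, so \<open>D'\<close> sends it to
      \<open>d 1 = 0\<close>.\<close>
    show ?case using ext[of "\<one>\<^bsub>R\<^esub>"] by (simp add: ext_incl0_def D_unit d_one incl1_zero)
  next
    case (wedge k x A)
    then show ?case using leibniz[of "incl1 x" 1 A k] closed[of A k]
      by (simp add: D_wedge \<delta>' koszul_sign_smult a_minus_def)
  qed (simp_all add: D'_zero assms(2) D'_smult D_add D_smult)
qed

end

section \<open>Forms on a C-infinity-ring\<close>

text \<open>Induction peels off the last row and the last column, which cancel entry by entry. The
  diagonal has its own hypothesis because antisymmetry alone only makes its entries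
  2-torsion.\<close>

lemma (in abelian_group) double_sum_antisymmetric:
  fixes n :: nat
  assumes closed: "\<And>i j. i < n \<Longrightarrow> j < n \<Longrightarrow> t i j \<in> carrier G"
    and diag: "\<And>i. i < n \<Longrightarrow> t i i = \<zero>" and anti: "\<And>i j. i < n \<Longrightarrow> j < n \<Longrightarrow> t i j = \<ominus> t j i"
  shows "(\<Oplus>i\<in>{..<n}. \<Oplus>j\<in>{..<n}. t i j) = \<zero>"
  using assms
proof (induction n)
  case 0
  show ?case by simp
next
  case (Suc n)
  have inner: "(\<Oplus>j\<in>{..<Suc n}. t i j) = t i n \<oplus> (\<Oplus>j\<in>{..<n}. t i j)" if "i < Suc n" for i
    unfolding lessThan_Suc using Suc.prems(1) that by (intro finsum_insert) auto
  have c: "(\<Oplus>j\<in>{..<n}. t i j) \<in> carrier G" if "i < Suc n" for i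
    using Suc.prems(1) that by (intro finsum_closed) auto
  define Row where "Row = (\<Oplus>j\<in>{..<n}. t n j)"
  define Col where "Col = (\<Oplus>i\<in>{..<n}. t i n)"
  have rc: "Row \<in> carrier G" "Col \<in> carrier G"
    unfolding Row_def Col_def using Suc.prems(1) by (auto intro!: finsum_closed)
  have zero: "(\<Oplus>i\<in>{..<n}. \<Oplus>j\<in>{..<n}. t i j) = \<zero>"
    by (rule Suc.IH) (rule Suc.prems, simp_all)+
  have "(\<Oplus>i\<in>{..<n}. t i n \<oplus> (\<Oplus>j\<in>{..<n}. t i j)) = Col \<oplus> (\<Oplus>i\<in>{..<n}. \<Oplus>j\<in>{..<n}. t i j)"
    unfolding Col_def using Suc.prems(1) c by (intro finsum_addf) auto
  then have rest: "(\<Oplus>i\<in>{..<n}. t i n \<oplus> (\<Oplus>j\<in>{..<n}. t i j)) = Col" using rc by (simp add: zero)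
  have "Row \<oplus> Col = (\<Oplus>j\<in>{..<n}. t n j \<oplus> t j n)"
    unfolding Row_def Col_def using Suc.prems(1) by (intro finsum_addf[symmetric]) auto
  also have "\<dots> = (\<Oplus>j\<in>{..<n}. \<zero>)"
  proof (rule finsum_cong'[OF refl])
    fix j assume "j \<in> {..<n}"
    then have "t j n \<in> carrier G" "t n j = \<ominus> t j n" using Suc.prems(1)[of j n] Suc.prems(3)[of n j] by auto
    then show "t n j \<oplus> t j n = \<zero>" by (simp only: l_neg)
  qed simp
  finally have RC: "Row \<oplus> Col = \<zero>" by simp
  have "(\<Oplus>i\<in>{..<Suc n}. \<Oplus>j\<in>{..<Suc n}. t i j) = (\<Oplus>i\<in>{..<Suc n}. t i n \<oplus> (\<Oplus>j\<in>{..<n}. t i j))"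
    using Suc.prems(1) c by (intro finsum_cong') (auto simp: inner)
  also have "\<dots> = (t n n \<oplus> Row) \<oplus> (\<Oplus>i\<in>{..<n}. t i n \<oplus> (\<Oplus>j\<in>{..<n}. t i j))"
    unfolding lessThan_Suc[of n] Row_def using Suc.prems(1) c by (intro finsum_insert) auto
  also have "\<dots> = \<zero>" unfolding rest using Suc.prems(2)[of n] rc RC by simp
  finally show ?case .
qed

text \<open>Only the scalar action of \<open>jet\<close> is twisted; its addition is
  componentwise.\<close>

lemma (in exterior_derivation) finsum_jet:
  assumes "finite A" "g \<in> A \<rightarrow> carrier (jet k)"
  shows "finsum (jet k) g A = (finsum (L k) (\<lambda>i. fst (g i)) A, finsum (L (1 + k)) (\<lambda>i. snd (g i)) A)"
proof -
  interpret J: module R "jet k" by (rule module_jet)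
  show ?thesis using assms
  proof (induction A)
    case empty
    then show ?case by (simp add: jet_simps)
  next
    case (insert a A)
    have g: "fst (g i) \<in> carrier (L k)" "snd (g i) \<in> carrier (L (1 + k))" if "i \<in> insert a A" for i
      using insert.prems that by (auto simp: jet_simps Pi_iff mem_Times_iff)
    have "finsum (jet k) g (insert a A) = g a \<oplus>\<^bsub>jet k\<^esub> finsum (jet k) g A"
      using insert by (intro J.finsum_insert) auto
    also have "finsum (jet k) g A = (finsum (L k) (\<lambda>i. fst (g i)) A, finsum (L (1 + k)) (\<lambda>i. snd (g i)) A)"
      using insert by auto
    finally show ?case using insert.hyps g
      by (simp add: jet_simps L.M.finsum_insert Pi_iff)
  qed
qed

section \<open>The chain rule and the differential on Kaehler one-forms\<close>

context cinfty_ring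
begin

abbreviation A where "A \<equiv> cinfty_alg C"
abbreviation \<Omega> where "\<Omega> \<equiv> kaehler C"
abbreviation d where "d \<equiv> kaehler_d C"

lemma kaehler_d_closed: "a \<in> carrier C \<Longrightarrow> d a \<in> carrier \<Omega>"
  using kaehler_d_derivation[unfolded cinfty_derivation_def, THEN conjunct1] by (rule funcset_mem)

lemma kaehler_d_cop:
  "\<lbrakk>as \<noteq> []; set as \<subseteq> carrier C; f \<in> C_infinity (length as)\<rbrakk> \<Longrightarrow>
    d (cop C f as) = (\<Oplus>\<^bsub>\<Omega>\<^esub>i\<in>{..<length as}. cop C (partial_deriv i f) as \<odot>\<^bsub>\<Omega>\<^esub> d (as ! i))"
  using kaehler_d_derivation[unfolded cinfty_derivation_def, THEN conjunct2] by simp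

sublocale X: exterior A \<Omega>
  by (simp add: exterior_def record_module_def kaehler_module)

lemma kaehler_induct [consumes 1, case_names zero add smult_d]:
  assumes "x \<in> carrier \<Omega>" "Q \<zero>\<^bsub>\<Omega>\<^esub>"
    and "\<And>x y. \<lbrakk>x \<in> carrier \<Omega>; y \<in> carrier \<Omega>; Q x; Q y\<rbrakk> \<Longrightarrow> Q (x \<oplus>\<^bsub>\<Omega>\<^esub> y)"
    and "\<And>a b. \<lbrakk>a \<in> carrier C; b \<in> carrier C\<rbrakk> \<Longrightarrow> Q (a \<odot>\<^bsub>\<Omega>\<^esub> d b)"
  shows "Q x"
proof (rule K.presented_induct[where Q = Q])
  show "x \<in> carrier K.P" using assms(1) unfolding kaehler_def .
  show "Q \<zero>\<^bsub>K.P\<^esub>" using assms(2) unfolding kaehler_def .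
  show "Q (x \<oplus>\<^bsub>K.P\<^esub> y)" if "x \<in> carrier K.P" "y \<in> carrier K.P" "Q x" "Q y" for x y
    using assms(3)[unfolded kaehler_def, OF that] .
  show "Q (a \<odot>\<^bsub>K.P\<^esub> K.cl (free_gen A b))" if "a \<in> carrier A" "b \<in> carrier C" for a b
    using assms(4)[unfolded kaehler_def kaehler_d_def] that by simp
qed

lemma partial_deriv_plus: "partial_deriv 0 (\<lambda>x. x 0 + x 1) = (\<lambda>_. 1)" "partial_deriv 1 (\<lambda>x. x 0 + x 1) = (\<lambda>_. 1)"
  unfolding partial_deriv_def by (auto intro!: ext DERIV_imp_deriv derivative_eq_intros)

lemma partial_deriv_times: "partial_deriv 0 (\<lambda>x. x 0 * x 1) = (\<lambda>x. x 1)" "partial_deriv 1 (\<lambda>x. x 0 * x 1) = (\<lambda>x. x 0)"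
  unfolding partial_deriv_def by (auto intro!: ext DERIV_imp_deriv derivative_eq_intros)

text \<open>The chain rule in arity two; addition and multiplication of the ring are such
  operations, so it yields additivity and the Leibniz rule.\<close>

lemma kaehler_d_binary:
  assumes "a \<in> carrier C" "b \<in> carrier C" "f \<in> C_infinity 2"
  shows "d (cop C f [a, b]) = cop C (partial_deriv 0 f) [a, b] \<odot>\<^bsub>\<Omega>\<^esub> d a \<oplus>\<^bsub>\<Omega>\<^esub> cop C (partial_deriv 1 f) [a, b] \<odot>\<^bsub>\<Omega>\<^esub> d b"
proof -
  have c: "cop C (partial_deriv i f) [a, b] \<in> carrier C" if "i < 2" for i
    using assms that C_infinity_partial_deriv[of f 2 i] by (intro cop_closed) (simp_all add: numeral_2_eq_2)
  have s: "{..<length [a, b]} = {0, 1}" by auto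
  have "d (cop C f [a, b]) = (\<Oplus>\<^bsub>\<Omega>\<^esub>i\<in>{0, 1}. cop C (partial_deriv i f) [a, b] \<odot>\<^bsub>\<Omega>\<^esub> d ([a, b] ! i))"
    unfolding s[symmetric] using assms by (intro kaehler_d_cop) (simp_all add: numeral_2_eq_2)
  then show ?thesis using assms c[of 0] c[of 1] by (simp add: kaehler_d_closed)
qed

lemma kaehler_d_const: "d (cinfty_const C r) = \<zero>\<^bsub>\<Omega>\<^esub>"
proof -
  \<comment> \<open>A constant is a nullary operation, but the chain rule asks for at least one
    argument, so the constant is read as a unary operation at an arbitrary element.\<close>
  obtain a where a: "a \<in> carrier C" using nonempty by blast
  have pd: "partial_deriv 0 (\<lambda>_. r) = (\<lambda>_. 0)" by (auto simp: partial_deriv_def)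
  have z: "cop C (\<lambda>_. 0) [a] = \<zero>\<^bsub>A\<^esub>" using a cop_const[of "[a]" 0] by (simp add: zero_alg)
  have "d (cop C (\<lambda>_. r) [a]) = (\<Oplus>\<^bsub>\<Omega>\<^esub>i\<in>{..<length [a]}. cop C (partial_deriv i (\<lambda>_. r)) [a] \<odot>\<^bsub>\<Omega>\<^esub> d ([a] ! i))"
    using a by (intro kaehler_d_cop) (simp_all add: C_infinity_const)
  also have "\<dots> = \<zero>\<^bsub>A\<^esub> \<odot>\<^bsub>\<Omega>\<^esub> d a \<oplus>\<^bsub>\<Omega>\<^esub> \<zero>\<^bsub>\<Omega>\<^esub>"
    using a by (simp add: lessThan_Suc pd kaehler_d_closed z)
  finally show ?thesis using a cop_const[of "[a]" r] by (simp add: kaehler_d_closed)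
qed

sublocale X: exterior_derivation A \<Omega> d
proof
  fix a b assume "a \<in> carrier A"
  then have a: "a \<in> carrier C" by simp
  show "d a \<in> carrier \<Omega>" using a by (rule kaehler_d_closed)
  assume "b \<in> carrier A"
  then have b: "b \<in> carrier C" by simp
  have one: "cop C (\<lambda>_. 1) [a, b] = \<one>\<^bsub>A\<^esub>" using a b cop_const[of "[a, b]" 1] by (simp add: one_alg)
  have "d (cop C (\<lambda>x. x 0 + x 1) [a, b]) = d a \<oplus>\<^bsub>\<Omega>\<^esub> d b"
    unfolding kaehler_d_binary[OF a b smooth_plus] partial_deriv_plus one
    using a b by (simp add: kaehler_d_closed)
  then show "d (a \<oplus>\<^bsub>A\<^esub> b) = d a \<oplus>\<^bsub>\<Omega>\<^esub> d b" by (simp add: cinfty_alg_def)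
  have "d (cop C (\<lambda>x. x 0 * x 1) [a, b]) = b \<odot>\<^bsub>\<Omega>\<^esub> d a \<oplus>\<^bsub>\<Omega>\<^esub> a \<odot>\<^bsub>\<Omega>\<^esub> d b"
    unfolding kaehler_d_binary[OF a b smooth_times] partial_deriv_times
    using a b by (simp add: cop_coordinate)
  then show "d (a \<otimes>\<^bsub>A\<^esub> b) = a \<odot>\<^bsub>\<Omega>\<^esub> d b \<oplus>\<^bsub>\<Omega>\<^esub> b \<odot>\<^bsub>\<Omega>\<^esub> d a"
    using a b by (simp add: cinfty_alg_def[of C] X.M.a_comm kaehler_d_closed)
qed

lemma kaehler_span: "carrier \<Omega> \<subseteq> submodule_generated A \<Omega> (d ` carrier A)"
proof
  have sub: "submodule (submodule_generated A \<Omega> (d ` carrier A)) A \<Omega>"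
    by (rule X.submodule_generated_submodule) (auto simp: kaehler_d_closed)
  note E = X.submoduleE[OF sub]
  fix x assume "x \<in> carrier \<Omega>"
  then show "x \<in> submodule_generated A \<Omega> (d ` carrier A)"
  proof (induction rule: kaehler_induct)
    case zero
    show ?case using subgroup.one_closed[OF submodule.axioms(1)[OF sub]] by simp
  next
    case (add x y)
    then show ?case by (intro E(5))
  next
    case (smult_d a b)
    then show ?case using X.submodule_generated_incl[of "d ` carrier A"] by (intro E(4)) auto
  qed
qed

text \<open>
  The second component of the chain rule in the jet module is the sum of
  \<open>(\<partial>\<^sub>j \<partial>\<^sub>i f) d a\<^sub>j \<and> d a\<^sub>i\<close>, which vanishes since the second derivatives commute.
\<close>
lemma jet_derivation: "cinfty_derivation C (X.jet 1) (\<lambda>b. (X.incl1 (d b), \<zero>\<^bsub>X.L 2\<^esub>))"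
  unfolding cinfty_derivation_def
proof (intro conjI allI impI)
  let ?X = "\<lambda>b. (X.incl1 (d b), \<zero>\<^bsub>X.L 2\<^esub>)"
  show "?X \<in> carrier C \<rightarrow> carrier (X.jet 1)" by (auto simp: X.jet_simps kaehler_d_closed)
  fix as f assume *: "as \<noteq> [] \<and> set as \<subseteq> carrier C \<and> f \<in> C_infinity (length as)"
  define n where "n = length as"
  define c where "c i = cop C (partial_deriv i f) as" for i
  define h where "h i j = cop C (partial_deriv j (partial_deriv i f)) as" for i j
  define w where "w i = X.incl1 (d (as ! i))" for i
  have a: "as ! i \<in> carrier C" "d (as ! i) \<in> carrier \<Omega>" "w i \<in> carrier (X.L 1)" if "i < n" for i
    using * that by (auto simp: n_def w_def subset_iff intro!: kaehler_d_closed X.incl1_closed)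
  have c: "c i \<in> carrier C" if "i < n" for i
    using * that unfolding c_def by (intro cop_closed) (auto simp: n_def C_infinity_partial_deriv)
  have h: "h i j \<in> carrier C" if "i < n" "j < n" for i j
    using * that unfolding h_def by (intro cop_closed) (auto simp: n_def C_infinity_partial_deriv)
  have h_sym: "h i j = h j i" if "i < n" "j < n" for i j
    using * that partial_deriv_commute[of f n i j] by (simp add: h_def n_def)
  have df: "d (cop C f as) = (\<Oplus>\<^bsub>\<Omega>\<^esub>i\<in>{..<n}. c i \<odot>\<^bsub>\<Omega>\<^esub> d (as ! i))"
    using * unfolding n_def c_def by (intro kaehler_d_cop) auto
  have dc: "d (c i) = (\<Oplus>\<^bsub>\<Omega>\<^esub>j\<in>{..<n}. h i j \<odot>\<^bsub>\<Omega>\<^esub> d (as ! j))" if "i < n" for i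
    using * that unfolding n_def c_def h_def by (intro kaehler_d_cop) (auto simp: C_infinity_partial_deriv)
  define t where "t i j = h i j \<odot>\<^bsub>X.L 2\<^esub> X.W 1 1 (w j) (w i)" for i j
  have ww: "X.W 1 1 (w j) (w i) = \<ominus>\<^bsub>X.L 2\<^esub> X.W 1 1 (w i) (w j)" if "i < n" "j < n" for i j
    using X.W_commute[OF a(3)[OF that(2)] a(3)[OF that(1)]] a(3) that by (simp add: X.koszul_sign_smult)
  have wedge: "X.W 1 1 (X.incl1 (d (c i))) (w i) = (\<Oplus>\<^bsub>X.L 2\<^esub>j\<in>{..<n}. t i j)" if i: "i < n" for i
  proof -
    have lin: "linear_map A \<Omega> (X.L 2) (\<lambda>x. X.W 1 1 (X.incl1 x) (w i))"
      using X.linear_map_comp[OF X.incl1_linear X.W_linear_left[OF a(3)[OF i], of 1]] by simp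
    have "X.W 1 1 (X.incl1 (d (c i))) (w i) =
        (\<Oplus>\<^bsub>X.L 2\<^esub>j\<in>{..<n}. X.W 1 1 (X.incl1 (h i j \<odot>\<^bsub>\<Omega>\<^esub> d (as ! j))) (w i))"
      unfolding dc[OF i] using a h i
      by (intro linear_map_finsum[OF kaehler_module X.module_L lin]) auto
    also have "\<dots> = (\<Oplus>\<^bsub>X.L 2\<^esub>j\<in>{..<n}. t i j)"
      using a h i by (intro X.L.M.finsum_cong')
        (auto simp: t_def X.incl1_smult X.W_smult_left w_def)
    finally show ?thesis .
  qed
  have tc: "t i j \<in> carrier (X.L 2)" if "i < n" "j < n" for i j
    using a h that by (simp add: t_def)
  have sum0: "(\<Oplus>\<^bsub>X.L 2\<^esub>i\<in>{..<n}. \<Oplus>\<^bsub>X.L 2\<^esub>j\<in>{..<n}. t i j) = \<zero>\<^bsub>X.L 2\<^esub>"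
  proof (rule X.L.M.double_sum_antisymmetric[OF tc])
    fix i assume i: "i < n"
    \<comment> \<open>The square-zero law is applied to the unit form.\<close>
    have "X.W 1 1 (w i) (w i) = \<zero>\<^bsub>X.L 2\<^esub>"
      using X.W_incl1_square[OF a(2)[OF i] X.gen_closed[OF X.nil_tuple]] a(3)[OF i]
      by (simp add: X.W_unit_right w_def)
    then show "t i i = \<zero>\<^bsub>X.L 2\<^esub>" using h i by (simp add: t_def)
    fix j assume j: "j < n"
    show "t i j = \<ominus>\<^bsub>X.L 2\<^esub> t j i"
      unfolding t_def ww[OF i j] h_sym[OF i j] using a h i j by (simp add: X.L.smult_r_minus)
  qed
  have s: "(\<Oplus>\<^bsub>X.L 2\<^esub>j\<in>{..<n}. t i j) \<in> carrier (X.L 2)" if "i < n" for i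
    using tc that by (intro X.L.M.finsum_closed) auto
  \<comment> \<open>The twisted scalar adds \<open>d (c i) \<and> w i\<close> to a zero second
    component; this is where second derivatives appear.\<close>
  have smult_X: "c i \<odot>\<^bsub>X.jet 1\<^esub> ?X (as ! i) = (c i \<odot>\<^bsub>X.L 1\<^esub> w i, \<Oplus>\<^bsub>X.L 2\<^esub>j\<in>{..<n}. t i j)" if "i < n" for i
    using a[OF that] c[OF that] wedge[OF that] s[OF that] by (simp add: X.jet_simps w_def[symmetric] kaehler_d_closed)
  interpret J: module A "X.jet 1" by (rule X.module_jet)
  have "(\<Oplus>\<^bsub>X.jet 1\<^esub>i\<in>{..<n}. c i \<odot>\<^bsub>X.jet 1\<^esub> ?X (as ! i)) =
      (\<Oplus>\<^bsub>X.jet 1\<^esub>i\<in>{..<n}. (c i \<odot>\<^bsub>X.L 1\<^esub> w i, \<Oplus>\<^bsub>X.L 2\<^esub>j\<in>{..<n}. t i j))"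
    using a c s by (intro J.M.finsum_cong') (auto simp: smult_X, auto simp: X.jet_simps)
  also have "\<dots> = (\<Oplus>\<^bsub>X.L 1\<^esub>i\<in>{..<n}. c i \<odot>\<^bsub>X.L 1\<^esub> w i, \<Oplus>\<^bsub>X.L 2\<^esub>i\<in>{..<n}. \<Oplus>\<^bsub>X.L 2\<^esub>j\<in>{..<n}. t i j)"
    using a c s by (subst X.finsum_jet) (auto simp: X.jet_simps)
  also have "(\<Oplus>\<^bsub>X.L 1\<^esub>i\<in>{..<n}. c i \<odot>\<^bsub>X.L 1\<^esub> w i) = (\<Oplus>\<^bsub>X.L 1\<^esub>i\<in>{..<n}. X.incl1 (c i \<odot>\<^bsub>\<Omega>\<^esub> d (as ! i)))"
    using a c by (intro X.L.M.finsum_cong') (auto simp: X.incl1_smult w_def)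
  also have "\<dots> = X.incl1 (d (cop C f as))"
    unfolding df using a c
    by (intro linear_map_finsum[OF kaehler_module X.module_L X.incl1_linear, symmetric]) auto
  finally show "?X (cop C f as) =
      (\<Oplus>\<^bsub>X.jet 1\<^esub>i\<in>{..<length as}. cop C (partial_deriv i f) as \<odot>\<^bsub>X.jet 1\<^esub> ?X (as ! i))"
    unfolding sum0 by (simp add: n_def c_def)
qed

theorem ex_exterior_differential: "\<exists>\<delta>. exterior_differential A \<Omega> d \<delta>"
proof -
  obtain \<phi> where lin: "linear_map A \<Omega> (X.jet 1) \<phi>"
    and d: "\<And>b. b \<in> carrier C \<Longrightarrow> \<phi> (d b) = (X.incl1 (d b), \<zero>\<^bsub>X.L 2\<^esub>)"
    using kaehler_universal[OF X.module_jet jet_derivation] by blast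
  have closed: "x \<in> carrier \<Omega> \<Longrightarrow> \<phi> x \<in> carrier (X.jet 1)"
    and add: "x \<in> carrier \<Omega> \<Longrightarrow> y \<in> carrier \<Omega> \<Longrightarrow> \<phi> (x \<oplus>\<^bsub>\<Omega>\<^esub> y) = \<phi> x \<oplus>\<^bsub>X.jet 1\<^esub> \<phi> y"
    and smult: "a \<in> carrier C \<Longrightarrow> x \<in> carrier \<Omega> \<Longrightarrow> \<phi> (a \<odot>\<^bsub>\<Omega>\<^esub> x) = a \<odot>\<^bsub>X.jet 1\<^esub> \<phi> x" for x y a
    using lin unfolding linear_map_def by auto
  have zero: "\<phi> \<zero>\<^bsub>\<Omega>\<^esub> = \<zero>\<^bsub>X.jet 1\<^esub>" by (rule linear_map_zero[OF kaehler_module X.module_jet lin])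
  \<comment> \<open>The induced map is thus \<open>x\<close> to \<open>(x, \<delta> x)\<close>, and
    the rules for \<open>\<delta>\<close> are the second components of its linearity.\<close>
  have fst: "fst (\<phi> x) = X.incl1 x" if "x \<in> carrier \<Omega>" for x
    using that
    by (induction rule: kaehler_induct)
       (simp_all add: zero add smult d X.jet_simps X.incl1_zero X.incl1_add X.incl1_smult kaehler_d_closed)
  have "exterior_differential A \<Omega> d (\<lambda>x. snd (\<phi> x))"
  proof (rule exterior_differential.intro[OF X.exterior_derivation_axioms exterior_differential_axioms.intro])
    show "snd (\<phi> x) \<in> carrier (X.L 2)" if "x \<in> carrier \<Omega>" for x
      using closed[OF that] by (auto simp: X.jet_simps)
    show "snd (\<phi> (d a)) = \<zero>\<^bsub>X.L 2\<^esub>" if "a \<in> carrier A" for a using that by (simp add: d)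
    show "carrier \<Omega> \<subseteq> submodule_generated A \<Omega> (d ` carrier A)" by (rule kaehler_span)
  qed (simp_all add: add smult X.jet_simps fst)
  then show ?thesis by blast
qed

end

section \<open>The forms as a graded algebra over the reals\<close>

locale cinfty_exterior = cinfty_ring C + X: exterior_differential "cinfty_alg C" "kaehler C" "kaehler_d C" \<delta>
  for C :: "'c cinfty" and \<delta>
begin

lemma real_module_simps:
  "carrier (real_module C N) = carrier N" "\<zero>\<^bsub>real_module C N\<^esub> = \<zero>\<^bsub>N\<^esub>"
  "x \<oplus>\<^bsub>real_module C N\<^esub> y = x \<oplus>\<^bsub>N\<^esub> y" "r \<odot>\<^bsub>real_module C N\<^esub> x = cinfty_const C r \<odot>\<^bsub>N\<^esub> x"
  by (simp_all add: real_module_def)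

lemma const_closed [simp]: "cinfty_const C r \<in> carrier C"
  by (rule alg_closed)

lemma const_add: "cinfty_const C (r + s) = cinfty_const C r \<oplus>\<^bsub>A\<^esub> cinfty_const C s"
  and const_mult: "cinfty_const C (r * s) = cinfty_const C r \<otimes>\<^bsub>A\<^esub> cinfty_const C s"
  unfolding cinfty_const_def by (subst cop_add cop_mult; simp add: C_infinity_const)+

text \<open>Real scalars act through constants, so the real signs in the graded algebra laws have to
  be matched with the signs taken in the ring.\<close>

lemma const_koszul_sign: "cinfty_const C ((-1) powi k) = X.koszul_sign k"
proof -
  have "cinfty_const C (-1) \<oplus>\<^bsub>A\<^esub> \<one>\<^bsub>A\<^esub> = \<zero>\<^bsub>A\<^esub>"
    using const_add[of "-1" 1] by (simp add: one_alg zero_alg)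
  then have "\<ominus>\<^bsub>A\<^esub> \<one>\<^bsub>A\<^esub> = cinfty_const C (-1)" by (intro K.minus_equality) (simp_all add: one_alg)
  moreover have "(-1 :: real) powi k = (if even k then 1 else -1)"
    by (auto simp: power_int_def even_nat_iff)
  ultimately show ?thesis by (simp add: X.koszul_sign_def one_alg)
qed

lemma real_module_module:
  assumes "Module.module A N" shows "Module.module real_ring (real_module C N)"
proof -
  interpret N: module A N by fact
  show ?thesis
  proof (rule moduleI)
    show "cring real_ring" by (rule cring_from_type_algebra)
    show "abelian_group (real_module C N)"
    proof (rule abelian_groupI)
      fix x assume "x \<in> carrier (real_module C N)"
      then show "\<exists>y\<in>carrier (real_module C N). y \<oplus>\<^bsub>real_module C N\<^esub> x = \<zero>\<^bsub>real_module C N\<^esub>"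
        by (intro bexI[of _ "\<ominus>\<^bsub>N\<^esub> x"]) (simp_all add: real_module_simps N.M.l_neg)
    qed (simp_all add: real_module_simps N.M.a_ac)
  qed (simp_all add: real_module_simps ring_of_type_algebra_def const_add const_mult
      N.smult_l_distr N.smult_r_distr N.smult_assoc1 one_alg[symmetric])
qed

lemma unit_eq: "wedge_list A \<Omega> [] = X.unit"
  by (simp add: ext_incl0_def)

lemma comm_graded_algebra_forms:
  "comm_graded_algebra (\<lambda>k. real_module C (X.L k)) X.W (wedge_list A \<Omega> [])"
  unfolding unit_eq
proof (rule comm_graded_algebra.intro)
  fix p show "Module.module real_ring (real_module C (X.L p))"
    by (rule real_module_module[OF X.module_L])
next
  fix p q x y assume "x \<in> carrier (real_module C (X.L p))" "y \<in> carrier (real_module C (X.L q))"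
  then show "X.W p q x y = (-1) powi (p * q) \<odot>\<^bsub>real_module C (X.L (p + q))\<^esub> X.W q p y x"
    using X.W_commute[of x p y q] by (simp add: real_module_simps const_koszul_sign)
qed (simp_all add: real_module_simps X.W_bilinear X.W_assoc X.W_unit_left X.W_unit_right)

text \<open>Restriction makes each component extensional, so that uniqueness holds as an equality of
  functions.\<close>

definition exterior_d where "exterior_d k = restrict (X.D k) (carrier (X.L k))"

lemma square_zero_extension_exterior_d: "square_zero_extension C exterior_d"
  unfolding square_zero_extension_def
proof (intro conjI allI ballI)
  show "graded_derivation (\<lambda>k. real_module C (X.L k)) X.W (wedge_list A \<Omega> []) 1 exterior_d"
  proof (rule graded_derivation.intro[OF comm_graded_algebra_forms graded_derivation_axioms.intro])
    show "exterior_d p \<in> carrier (real_module C (X.L p)) \<rightarrow>\<^sub>E carrier (real_module C (X.L (p + 1)))" for p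
      using X.D_closed[of _ p] by (auto simp: exterior_d_def real_module_simps add.commute[of p])
  next
    fix x y p assume "x \<in> carrier (real_module C (X.L p))" "y \<in> carrier (real_module C (X.L p))"
    then show "exterior_d p (x \<oplus>\<^bsub>real_module C (X.L p)\<^esub> y) =
        exterior_d p x \<oplus>\<^bsub>real_module C (X.L (p + 1))\<^esub> exterior_d p y"
      by (simp add: exterior_d_def real_module_simps X.D_add add.commute[of p])
  next
    fix x p r assume "x \<in> carrier (real_module C (X.L p))"
    \<comment> \<open>Constants have zero differential, so the twist in \<open>X.D_smult\<close>
      disappears for real scalars.\<close>
    then show "exterior_d p (r \<odot>\<^bsub>real_module C (X.L p)\<^esub> x) = r \<odot>\<^bsub>real_module C (X.L (p + 1))\<^esub> exterior_d p x"
      by (simp add: exterior_d_def real_module_simps X.D_smult kaehler_d_const X.incl1_zero add.commute[of p])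
  next
    fix x y p q assume "x \<in> carrier (real_module C (X.L p))" "y \<in> carrier (real_module C (X.L q))"
    then show "exterior_d (p + q) (X.W p q x y) =
        X.W (p + 1) q (exterior_d p x) y \<oplus>\<^bsub>real_module C (X.L (p + q + 1))\<^esub>
        (-1) powi (p * 1) \<odot>\<^bsub>real_module C (X.L (p + q + 1))\<^esub> X.W p (q + 1) x (exterior_d q y)"
      using X.D_leibniz[of x p y q] by (simp add: exterior_d_def real_module_simps const_koszul_sign add_ac)
  qed
next
  fix a assume "a \<in> carrier C"
  then show "exterior_d 0 (X.incl0 a) = X.incl1 (d a)" by (simp add: exterior_d_def X.D_incl0)
next
  fix k x assume "x \<in> carrier (X.L k)"
  then show "exterior_d (k + 1) (exterior_d k x) = \<zero>\<^bsub>X.L (k + 2)\<^esub>"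
    using X.D_square[of x k] X.D_closed[of x k] by (simp add: exterior_d_def add_ac)
qed

lemma square_zero_extension_unique:
  assumes "square_zero_extension C D'" shows "D' = exterior_d"
proof
  fix k
  interpret D': graded_derivation "\<lambda>k. real_module C (X.L k)" X.W "wedge_list A \<Omega> []" 1 D'
    using assms by (simp add: square_zero_extension_def)
  have square: "D' (k + 1) (D' k x) = \<zero>\<^bsub>X.L (k + 2)\<^esub>" if "x \<in> carrier (X.L k)" for k x
    using assms that by (simp add: square_zero_extension_def)
  have closed: "D' k \<omega> \<in> carrier (X.L (1 + k))" if "\<omega> \<in> carrier (X.L k)" for k \<omega>
    using D'.map[of k] that by (auto simp: real_module_simps add.commute[of k])
  have eq: "D' k \<omega> = X.D k \<omega>" if "\<omega> \<in> carrier (X.L k)" for \<omega>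
  proof (rule X.differential_unique[OF closed _ _ _ _ that])
    fix k \<omega> \<omega>' assume "\<omega> \<in> carrier (X.L k)" "\<omega>' \<in> carrier (X.L k)"
    then show "D' k (\<omega> \<oplus>\<^bsub>X.L k\<^esub> \<omega>') = D' k \<omega> \<oplus>\<^bsub>X.L (1 + k)\<^esub> D' k \<omega>'"
      using D'.additive[of \<omega> k \<omega>'] by (simp add: real_module_simps add.commute[of k])
  next
    fix k l \<omega> \<theta> assume "\<omega> \<in> carrier (X.L k)" "\<theta> \<in> carrier (X.L l)"
    then show "D' (k + l) (X.W k l \<omega> \<theta>) = X.W (1 + k) l (D' k \<omega>) \<theta> \<oplus>\<^bsub>X.L (1 + (k + l))\<^esub>
        X.koszul_sign k \<odot>\<^bsub>X.L (1 + (k + l))\<^esub> X.W k (1 + l) \<omega> (D' l \<theta>)"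
      using D'.graded_leibniz[of \<omega> k \<theta> l] by (simp add: real_module_simps const_koszul_sign add_ac)
  next
    fix a assume "a \<in> carrier A"
    then show "D' 0 (X.incl0 a) = X.incl1 (d a)"
      using assms by (simp add: square_zero_extension_def)
    show "D' 1 (D' 0 (X.incl0 a)) = \<zero>\<^bsub>X.L 2\<^esub>"
      using square[OF X.incl0_closed[OF \<open>a \<in> carrier A\<close>]] by simp
  qed
  show "D' k = exterior_d k"
  proof (rule extensionalityI[of _ "carrier (X.L k)"])
    show "D' k \<in> extensional (carrier (X.L k))"
      using D'.map[of k] by (simp add: real_module_simps PiE_def)
  qed (simp_all add: exterior_d_def eq)
qed

text \<open>Both Leibniz terms vanish: \<open>\<delta> (d b) = 0\<close>, and the remaining factors
  are closed by induction.\<close>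

lemma D_wedge_list: "set bs \<subseteq> carrier C \<Longrightarrow>
  X.D (int (length bs)) (wedge_list A \<Omega> (map d bs)) = \<zero>\<^bsub>X.L (1 + int (length bs))\<^esub>"
proof (induction bs)
  case Nil
  show ?case unfolding list.map unit_eq using X.D_unit by simp
next
  case (Cons b bs)
  have "wedge_list A \<Omega> (map d bs) \<in> carrier (X.L (int (length bs)))"
    using Cons.prems by (subst X.wedge_list_gen) (auto intro!: X.gen_closed X.tuplesI kaehler_d_closed)
  then show ?case using Cons X.D_wedge[of "d b" "wedge_list A \<Omega> (map d bs)" "int (length bs)"]
    by (simp add: X.\<delta>_d a_minus_def)
qed

text \<open>Since the product of exact forms is closed, the scalar rule leaves just the term in
  which \<open>d a\<close> is wedged in front.\<close>

lemma exterior_d_wedge_list: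
  assumes "a \<in> carrier C" "set bs \<subseteq> carrier C"
  shows "exterior_d (int (length bs)) (a \<odot>\<^bsub>X.L (int (length bs))\<^esub> wedge_list A \<Omega> (map d bs)) =
    wedge_list A \<Omega> (d a # map d bs)"
proof -
  have "wedge_list A \<Omega> (map d bs) \<in> carrier (X.L (int (length bs)))"
    using assms(2) by (subst X.wedge_list_gen) (auto intro!: X.gen_closed X.tuplesI kaehler_d_closed)
  then show ?thesis using assms by (simp add: exterior_d_def X.D_smult D_wedge_list)
qed

end

theorem theorem4p2:
  fixes C :: "'c cinfty"
  assumes "cinfty_ring C"
  shows "(\<exists>!d. square_zero_extension C d) \<and>
    (\<forall>d. square_zero_extension C d \<longrightarrow>
      (\<forall>k>0. \<forall>a\<in>carrier C. \<forall>bs. length bs = k \<and> set bs \<subseteq> carrier C \<longrightarrow>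
        d (int k) (a \<odot>\<^bsub>cinfty_forms C (int k)\<^esub>
                    wedge_list (cinfty_alg C) (kaehler C) (map (kaehler_d C) bs)) =
        wedge_list (cinfty_alg C) (kaehler C) (kaehler_d C a # map (kaehler_d C) bs)))"
proof -
  interpret cinfty_ring C by fact
  obtain \<delta> where \<delta>: "exterior_differential A \<Omega> d \<delta>" using ex_exterior_differential by blast
  interpret cinfty_exterior C \<delta>
    by (rule cinfty_exterior.intro[OF assms \<delta>])
  show ?thesis
  proof (intro conjI allI impI ballI)
    show "\<exists>!d. square_zero_extension C d"
      using square_zero_extension_exterior_d square_zero_extension_unique by blast
    fix D' and k :: nat and a bs
    assume "square_zero_extension C D'" and *: "a \<in> carrier C" "length bs = k \<and> set bs \<subseteq> carrier C"
    then have "D' = exterior_d" by (intro square_zero_extension_unique)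
    with * exterior_d_wedge_list[of a bs]
    show "D' (int k) (a \<odot>\<^bsub>X.L (int k)\<^esub> wedge_list A \<Omega> (map d bs)) = wedge_list A \<Omega> (d a # map d bs)"
      by auto
  qed
qed

end
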